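(* Let $\mathscr R$ denote one of the boost vector fields $\mathscr R_i$, $i=1,2,3$, and let ${}^{(\mathscr R)}\pi$ be its deformation tensor. Then in $\mathcal I^+_*(\mathcal O)$, for every integer $m\ge0$ and every $i=1,2,3$, $$\big(\mathcal L^{(m)}_{\mathscr R}\,{}^{(\mathscr R)}\pi\big)(\mathfrak B,\mathfrak B)=0,\qquad\big(\mathcal L^{(m)}_{\mathscr R}\,{}^{(\mathscr R)}\pi\big)(\mathfrak B,\mathscr R_i)=0,$$ where $\mathcal L^{(m)}_{\mathscr R}$ denotes the $m$-fold application of Lie derivatives along boost vector fields.
   Context: $(\mathbf M,\mathbf g)$ is a smooth globally hyperbolic $3{+}1$ dimensional Lorentzian manifold (signature $-+++$) with Levi-Civita connection $\mathbf D$; $\mathcal O\in\mathbf M$. Identify $T_{\mathcal O}\mathbf M$ with $\mathbb R^{3+1}$ by an orthonormal frame with future directed timelike $e_0$. $\mathbb H_1=\{V\in\mathbb R^{3+1}:(V^0)^2-\sum_i(V^i)^2=1, V^0>0\}$; $\exp_{\mathcal O}(\rho V)=\Upsilon_V(\rho)$ with $\Upsilon_V$ the timelike geodesic with $\Upsilon_V(0)=\mathcal O$, $\Upsilon_V'(0)=V$. $i_*$ is the supremum of all $s_0>0$ for which $(\rho,V)\mapsto\Upsilon_V(\rho)$ is a diffeomorphism from $(0,s_0)\times\mathbb H_1$ onto its image in the chronological future $\mathcal I^+(\mathcal O)$; $\mathcal I^+_*(\mathcal O)$ is the part of $\mathcal I^+(\mathcal O)$ within this timelike radius of injectivity. $\rho$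 is the geodesic distance to $\mathcal O$ (so $\mathbf g(\mathbf D\rho,\mathbf D\rho)=-1$) and $\mathfrak B=-\mathbf D\rho$, the future unit normal of the level sets $\mathcal H_\rho$. On $T_{\mathcal O}\mathbf M$ use coordinates $y^0=\tau=\rho\sqrt{1+\sum_i(V^i)^2}$, $y^i=\rho V^i$, and put $\mathring{\mathscr R}_i=y^i\partial_\tau+\tau\partial_{y^i}$, $i=1,2,3$. The boost vector fields are $\mathscr R_i=(d\exp_{\mathcal O})_{\rho V}(\mathring{\mathscr R}_i)$. For a vector field $X$, the deformation tensor is ${}^{(X)}\pi_{\alpha\beta}=\mathbf D_\alpha X_\beta+\mathbf D_\beta X_\alpha$. *)

theory Defs
  imports "HOL-Analysis.Analysis"
begin

section \<open>Smooth maps between Euclidean spaces\<close>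

primrec Ck_on :: "nat \<Rightarrow> 'b::euclidean_space set \<Rightarrow> ('b \<Rightarrow> 'c::euclidean_space) \<Rightarrow> bool" where
  "Ck_on 0 W f = continuous_on W f"
| "Ck_on (Suc k) W f =
     ((\<forall>x\<in>W. f differentiable (at x)) \<and>
      (\<forall>v. Ck_on k W (\<lambda>x. frechet_derivative f (at x) v)))"

text \<open>On an arbitrary subset of a Euclidean space (an open set, an interval with end points, an
  embedded hypersurface), smooth means: locally the restriction of a smooth map defined on an
  open set of the ambient space.\<close>

definition smooth_on :: "'b::euclidean_space set \<Rightarrow> ('b \<Rightarrow> 'c::euclidean_space) \<Rightarrow> bool" where
  "smooth_on S f \<longleftrightarrow>
     (\<forall>x\<in>S. \<exists>W F. open W \<and> x \<in> W \<and> (\<forall>k. Ck_on k W F) \<and> (\<forall>y\<in>W \<inter> S. F y = f y))"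


section \<open>Minkowski space\<close>

text \<open>The index type \<open>4\<close> consists of \<open>0, 1, 2, 3\<close> (with \<open>4 = 0\<close>); index \<open>0\<close> is the time
  direction.\<close>

definition spatial :: "4 set" where
  "spatial = {1, 2, 3}"

definition mink :: "4 \<Rightarrow> 4 \<Rightarrow> real" where
  "mink \<mu> \<nu> = (if \<mu> = \<nu> then if \<mu> = 0 then -1 else 1 else 0)"

definition mink_radius :: "real^4 \<Rightarrow> real" where
  "mink_radius y = sqrt ((y $ 0)\<^sup>2 - (\<Sum>i\<in>spatial. (y $ i)\<^sup>2))"

definition H1 :: "(real^4) set" where
  "H1 = {V. (V $ 0)\<^sup>2 - (\<Sum>i\<in>spatial. (V $ i)\<^sup>2) = 1 \<and> V $ 0 > 0}"

text \<open>The components of \<open>y\<^sup>i \<partial>\<^sub>\<tau> + \<tau> \<partial>\<^sub>y\<^sub>i\<close> at \<open>y\<close>, where \<open>\<tau> = y\<^sup>0\<close>.\<close>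

definition flat_boost :: "4 \<Rightarrow> real^4 \<Rightarrow> real^4" where
  "flat_boost i y = (y $ i) *\<^sub>R axis 0 1 + (y $ 0) *\<^sub>R axis i 1"


section \<open>Smooth four-dimensional manifolds\<close>

text \<open>Tangent vectors at \<open>p\<close> are directional derivative operators on functions that are smooth
  near \<open>p\<close>. So that equality of tangent vectors is equality of functionals, a tangent vector
  takes the value \<open>0\<close> on every function that is not smooth near \<open>p\<close>; the operation \<open>germ\<close> below
  imposes this normalisation. The atlas need not be maximal. Covariant 2-tensors are represented by their action on pairs of
  vector fields.\<close>

type_synonym 'a chart = "'a set \<times> ('a \<Rightarrow> real^4)"
type_synonym 'a tvec = "('a \<Rightarrow> real) \<Rightarrow> real"
type_synonym 'a vfield = "'a \<Rightarrow> 'a tvec"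
type_synonym 'a metric = "'a \<Rightarrow> 'a tvec \<Rightarrow> 'a tvec \<Rightarrow> real"
type_synonym 'a connection = "'a vfield \<Rightarrow> 'a vfield \<Rightarrow> 'a vfield"
type_synonym 'a tensor2 = "'a vfield \<Rightarrow> 'a vfield \<Rightarrow> 'a \<Rightarrow> real"

locale smooth_manifold =
  fixes A :: "'a::{t2_space, second_countable_topology} chart set"
  assumes cover: "(\<Union>(U, x)\<in>A. U) = UNIV"
    and charts: "\<And>U x. (U, x) \<in> A \<Longrightarrow>
          open U \<and> open (x ` U) \<and> inj_on x U \<and>
          continuous_on U x \<and> continuous_on (x ` U) (inv_into U x)"
    and compatible: "\<And>U x U' x'. (U, x) \<in> A \<Longrightarrow> (U', x') \<in> A \<Longrightarrow>
          smooth_on (x ` (U \<inter> U')) (x' \<circ> inv_into U x)"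
begin

definition smooth_fun :: "'a set \<Rightarrow> ('a \<Rightarrow> real) \<Rightarrow> bool" where
  "smooth_fun W f \<longleftrightarrow> (\<forall>(U, x)\<in>A. smooth_on (x ` (U \<inter> W)) (f \<circ> inv_into U x))"

definition smooth_at :: "'a \<Rightarrow> ('a \<Rightarrow> real) \<Rightarrow> bool" where
  "smooth_at p f \<longleftrightarrow> (\<exists>W. open W \<and> p \<in> W \<and> smooth_fun W f)"

definition smooth_map :: "'b::euclidean_space set \<Rightarrow> ('b \<Rightarrow> 'a) \<Rightarrow> bool" where
  "smooth_map S F \<longleftrightarrow>
     continuous_on S F \<and> (\<forall>(U, x)\<in>A. smooth_on {s \<in> S. F s \<in> U} (x \<circ> F))"

definition diffeo_onto_image :: "'b::euclidean_space set \<Rightarrow> ('b \<Rightarrow> 'a) \<Rightarrow> bool" where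
  "diffeo_onto_image S F \<longleftrightarrow>
     inj_on F S \<and> open (F ` S) \<and> smooth_map S F \<and>
     (\<forall>(U, x)\<in>A. smooth_on (x ` (U \<inter> F ` S)) (inv_into S F \<circ> inv_into U x))"

definition germ :: "'a \<Rightarrow> 'a tvec \<Rightarrow> 'a tvec" where
  "germ p v = (\<lambda>f. if smooth_at p f then v f else 0)"

definition chart_vec :: "'a chart \<Rightarrow> 'a \<Rightarrow> real^4 \<Rightarrow> 'a tvec" where
  "chart_vec c p w =
     germ p (\<lambda>f. frechet_derivative (f \<circ> inv_into (fst c) (snd c)) (at (snd c p)) w)"

definition tangent_space :: "'a \<Rightarrow> 'a tvec set" where
  "tangent_space p = {chart_vec c p w | c w. c \<in> A \<and> p \<in> fst c}"

definition smooth_vfield :: "'a set \<Rightarrow> 'a vfield \<Rightarrow> bool" where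
  "smooth_vfield U X \<longleftrightarrow>
     (\<forall>p\<in>U. X p \<in> tangent_space p) \<and>
     (\<forall>W f. open W \<and> W \<subseteq> U \<and> smooth_fun W f \<longrightarrow> smooth_fun W (\<lambda>p. X p f))"

definition velocity :: "real set \<Rightarrow> (real \<Rightarrow> 'a) \<Rightarrow> real \<Rightarrow> 'a tvec" where
  "velocity J \<gamma> t = germ (\<gamma> t) (\<lambda>f. vector_derivative (f \<circ> \<gamma>) (at t within J))"

definition bracket :: "'a vfield \<Rightarrow> 'a vfield \<Rightarrow> 'a vfield" where
  "bracket X Y p = germ p (\<lambda>f. X p (\<lambda>q. Y q f) - Y p (\<lambda>q. X q f))"

definition lie_derivative :: "'a vfield \<Rightarrow> 'a tensor2 \<Rightarrow> 'a tensor2" where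
  "lie_derivative X \<pi> =
     (\<lambda>Y Z p. X p (\<lambda>q. \<pi> Y Z q) - \<pi> (bracket X Y) Z p - \<pi> Y (bracket X Z) p)"

definition lorentz_metric :: "'a metric \<Rightarrow> bool" where
  "lorentz_metric g \<longleftrightarrow>
     (\<forall>p. \<forall>u\<in>tangent_space p. \<forall>v\<in>tangent_space p. g p u v = g p v u) \<and>
     (\<forall>p. \<forall>u\<in>tangent_space p. \<forall>v\<in>tangent_space p. \<forall>w\<in>tangent_space p. \<forall>a b.
        g p (\<lambda>f. a * u f + b * v f) w = a * g p u w + b * g p v w) \<and>
     (\<forall>p. \<exists>b. (\<forall>\<mu>. b \<mu> \<in> tangent_space p) \<and> (\<forall>\<mu> \<nu>. g p (b \<mu>) (b \<nu>) = mink \<mu> \<nu>)) \<and>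
     (\<forall>U X Y. open U \<and> smooth_vfield U X \<and> smooth_vfield U Y \<longrightarrow>
        smooth_fun U (\<lambda>p. g p (X p) (Y p)))"

text \<open>The Levi-Civita connection, \<open>D X Y\<close> being the covariant derivative of \<open>Y\<close> along \<open>X\<close>: the
  affine connection that is torsion free and compatible with the metric. The conditions are
  imposed on all open sets \<open>U\<close>, so \<open>D\<close> acts on locally defined fields.\<close>

definition levi_civita :: "'a metric \<Rightarrow> 'a connection \<Rightarrow> bool" where
  "levi_civita g D \<longleftrightarrow>
     (\<forall>U X Y Z f. open U \<and> smooth_vfield U X \<and> smooth_vfield U Y \<and> smooth_vfield U Z \<and>
        smooth_fun U f \<longrightarrow>
        smooth_vfield U (D X Y) \<and>
        (\<forall>p\<in>U.
          D (\<lambda>q h. X q h + Y q h) Z p = (\<lambda>h. D X Z p h + D Y Z p h) \<and>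
          D (\<lambda>q h. f q * X q h) Y p = (\<lambda>h. f p * D X Y p h) \<and>
          D X (\<lambda>q h. Y q h + Z q h) p = (\<lambda>h. D X Y p h + D X Z p h) \<and>
          D X (\<lambda>q h. f q * Y q h) p = (\<lambda>h. X p f * Y p h + f p * D X Y p h) \<and>
          (\<lambda>h. D X Y p h - D Y X p h) = bracket X Y p \<and>
          X p (\<lambda>q. g q (Y q) (Z q)) = g p (D X Y p) (Z p) + g p (Y p) (D X Z p)))"

text \<open>Since \<open>(D\<^sub>Y X\<^sup>\<flat>)(Z) = g (D\<^sub>Y X, Z)\<close>, this is \<open>D\<^sub>\<alpha> X\<^sub>\<beta> + D\<^sub>\<beta> X\<^sub>\<alpha>\<close> contracted with
  \<open>Y\<^sup>\<alpha> Z\<^sup>\<beta>\<close>.\<close>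

definition deformation :: "'a metric \<Rightarrow> 'a connection \<Rightarrow> 'a vfield \<Rightarrow> 'a tensor2" where
  "deformation g D X = (\<lambda>Y Z p. g p (D Y X p) (Z p) + g p (D Z X p) (Y p))"

definition gradient :: "'a metric \<Rightarrow> ('a \<Rightarrow> real) \<Rightarrow> 'a vfield" where
  "gradient g f p =
     (THE v. v \<in> tangent_space p \<and> (\<forall>w\<in>tangent_space p. g p v w = w f))"

definition christoffel :: "'a connection \<Rightarrow> 'a chart \<Rightarrow> 'a \<Rightarrow> 4 \<Rightarrow> 4 \<Rightarrow> 4 \<Rightarrow> real" where
  "christoffel D c p \<alpha> \<beta> \<gamma> =
     D (\<lambda>q. chart_vec c q (axis \<beta> 1)) (\<lambda>q. chart_vec c q (axis \<gamma> 1)) p (\<lambda>q. snd c q $ \<alpha>)"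

definition geodesic :: "'a connection \<Rightarrow> real set \<Rightarrow> (real \<Rightarrow> 'a) \<Rightarrow> bool" where
  "geodesic D J \<gamma> \<longleftrightarrow>
     smooth_map J \<gamma> \<and>
     (\<forall>t\<in>J. \<forall>(U, x)\<in>A. \<gamma> t \<in> U \<longrightarrow>
       (\<forall>\<alpha>. deriv (deriv (\<lambda>s. x (\<gamma> s) $ \<alpha>)) t
          + (\<Sum>\<beta>\<in>UNIV. \<Sum>\<delta>\<in>UNIV. christoffel D (U, x) (\<gamma> t) \<alpha> \<beta> \<delta>
               * deriv (\<lambda>s. x (\<gamma> s) $ \<beta>) t * deriv (\<lambda>s. x (\<gamma> s) $ \<delta>) t) = 0))"

text \<open>Piecewise smooth curves on \<open>{a..b}\<close> all of whose (one-sided) velocities satisfy \<open>P\<close>.\<close>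

inductive piecewise_curve ::
    "('a \<Rightarrow> 'a tvec \<Rightarrow> bool) \<Rightarrow> (real \<Rightarrow> 'a) \<Rightarrow> real \<Rightarrow> real \<Rightarrow> bool" for P \<gamma> where
  segment: "a < b \<Longrightarrow> smooth_map {a..b} \<gamma> \<Longrightarrow>
     (\<forall>t\<in>{a..b}. P (\<gamma> t) (velocity {a..b} \<gamma> t)) \<Longrightarrow> piecewise_curve P \<gamma> a b"
| join: "piecewise_curve P \<gamma> a b \<Longrightarrow> piecewise_curve P \<gamma> b c \<Longrightarrow> piecewise_curve P \<gamma> a c"

end


section \<open>Globally hyperbolic spacetimes\<close>

text \<open>The time orientation is given by a smooth timelike vector field \<open>T\<close>.\<close>

locale spacetime = smooth_manifold A
  for A :: "'a::{t2_space, second_countable_topology} chart set" +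
  fixes g :: "'a metric" and T :: "'a vfield" and D :: "'a connection"
  assumes metric: "lorentz_metric g"
    and orientation: "smooth_vfield UNIV T" "\<And>p. g p (T p) (T p) < 0"
    and connection: "levi_civita g D"
begin

definition future_timelike :: "'a \<Rightarrow> 'a tvec \<Rightarrow> bool" where
  "future_timelike p v \<longleftrightarrow> v \<in> tangent_space p \<and> g p v v < 0 \<and> g p v (T p) < 0"

definition future_causal :: "'a \<Rightarrow> 'a tvec \<Rightarrow> bool" where
  "future_causal p v \<longleftrightarrow> v \<in> tangent_space p \<and> g p v v \<le> 0 \<and> g p v (T p) < 0"

definition chronological_future :: "'a \<Rightarrow> 'a set" where
  "chronological_future p =
     {q. \<exists>\<gamma> a b. piecewise_curve future_timelike \<gamma> a b \<and> \<gamma> a = p \<and> \<gamma> b = q}"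

definition causally_precedes :: "'a \<Rightarrow> 'a \<Rightarrow> bool" where
  "causally_precedes p q \<longleftrightarrow>
     p = q \<or> (\<exists>\<gamma> a b. piecewise_curve future_causal \<gamma> a b \<and> \<gamma> a = p \<and> \<gamma> b = q)"

definition strongly_causal :: bool where
  "strongly_causal \<longleftrightarrow>
     (\<forall>p U. open U \<and> p \<in> U \<longrightarrow>
       (\<exists>W. open W \<and> p \<in> W \<and> W \<subseteq> U \<and>
         (\<forall>\<gamma> a b. piecewise_curve future_causal \<gamma> a b \<and> \<gamma> a \<in> W \<and> \<gamma> b \<in> W \<longrightarrow>
            \<gamma> ` {a..b} \<subseteq> U)))"

definition globally_hyperbolic :: bool where
  "globally_hyperbolic \<longleftrightarrow>
     strongly_causal \<and>
     (\<forall>p q. compact {r. causally_precedes p r \<and> causally_precedes r q})"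

end


section \<open>Geodesic polar coordinates, boosts\<close>

locale framed_spacetime = spacetime A g T D
  for A :: "'a::{t2_space, second_countable_topology} chart set" and g T D +
  fixes orig :: 'a and e :: "4 \<Rightarrow> 'a tvec"
  assumes hyperbolic: "globally_hyperbolic"
    and frame: "\<And>\<mu>. e \<mu> \<in> tangent_space orig" "\<And>\<mu> \<nu>. g orig (e \<mu>) (e \<nu>) = mink \<mu> \<nu>"
    and frame_future: "future_timelike orig (e 0)"
begin

definition frame_vec :: "real^4 \<Rightarrow> 'a tvec" where
  "frame_vec V = (\<lambda>f. \<Sum>\<mu>\<in>UNIV. V $ \<mu> * e \<mu> f)"

text \<open>Geodesics need not be complete: \<open>geodesic_reaches V t q\<close> says that the geodesic from \<open>orig\<close>
  with initial velocity \<open>V\<close> is defined up to parameter value \<open>t\<close> and is then at \<open>q\<close>.\<close>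

definition geodesic_reaches :: "real^4 \<Rightarrow> real \<Rightarrow> 'a \<Rightarrow> bool" where
  "geodesic_reaches V t q \<longleftrightarrow>
     (\<exists>\<gamma> J. open J \<and> is_interval J \<and> 0 \<in> J \<and> t \<in> J \<and> geodesic D J \<gamma> \<and>
        \<gamma> 0 = orig \<and> velocity J \<gamma> 0 = frame_vec V \<and> \<gamma> t = q)"

definition Upsilon :: "real^4 \<Rightarrow> real \<Rightarrow> 'a" where
  "Upsilon V t = (THE q. geodesic_reaches V t q)"

text \<open>The exponential map at \<open>orig\<close> on future timelike vectors \<open>y = \<rho> V\<close>, \<open>V \<in> H1\<close>.\<close>

definition exp_orig :: "real^4 \<Rightarrow> 'a" where
  "exp_orig y = Upsilon (y /\<^sub>R mink_radius y) (mink_radius y)"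

definition injectivity_parameter :: "real \<Rightarrow> bool" where
  "injectivity_parameter s0 \<longleftrightarrow>
     s0 > 0 \<and>
     (\<forall>\<rho>\<in>{0<..<s0}. \<forall>V\<in>H1. \<exists>q. geodesic_reaches V \<rho> q) \<and>
     diffeo_onto_image ({0<..<s0} \<times> H1) (\<lambda>(\<rho>, V). Upsilon V \<rho>) \<and>
     (\<lambda>(\<rho>, V). Upsilon V \<rho>) ` ({0<..<s0} \<times> H1) \<subseteq> chronological_future orig"

definition i_star :: ereal where
  "i_star = Sup {ereal s0 | s0. injectivity_parameter s0}"

definition polar :: "'a \<Rightarrow> real \<Rightarrow> real^4 \<Rightarrow> bool" where
  "polar p \<rho> V \<longleftrightarrow> 0 < \<rho> \<and> ereal \<rho> < i_star \<and> V \<in> H1 \<and> p = exp_orig (\<rho> *\<^sub>R V)"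

definition I_star :: "'a set" where
  "I_star = {p \<in> chronological_future orig. \<exists>\<rho> V. polar p \<rho> V}"

text \<open>The geodesic distance to \<open>orig\<close>: the length of the timelike geodesic from \<open>orig\<close> to \<open>p\<close>,
  for \<open>p\<close> within the timelike radius of injectivity.\<close>

definition rho :: "'a \<Rightarrow> real" where
  "rho p = (THE \<rho>. \<exists>V. polar p \<rho> V)"

definition normal :: "'a vfield" where
  "normal p = (\<lambda>f. - gradient g rho p f)"

definition log_orig :: "'a \<Rightarrow> real^4" where
  "log_orig p = (THE y. \<exists>\<rho> V. polar p \<rho> V \<and> y = \<rho> *\<^sub>R V)"

definition d_exp_orig :: "real^4 \<Rightarrow> real^4 \<Rightarrow> 'a tvec" where
  "d_exp_orig y w =
     germ (exp_orig y) (\<lambda>f. frechet_derivative (f \<circ> exp_orig) (at y) w)"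

definition boost :: "4 \<Rightarrow> 'a vfield" where
  "boost i p = d_exp_orig (log_orig p) (flat_boost i (log_orig p))"

text \<open>Iterated Lie derivative along the boosts with the indices listed in \<open>js\<close>.\<close>

definition lie_boosts :: "4 list \<Rightarrow> 'a tensor2 \<Rightarrow> 'a tensor2" where
  "lie_boosts js \<pi> = foldr (\<lambda>j. lie_derivative (boost j)) js \<pi>"

definition boost_deformation :: "4 \<Rightarrow> 'a tensor2" where
  "boost_deformation k = deformation g D (boost k)"

end

end

theory Submission
  imports Defs
begin

text \<open>In exponential coordinates \<open>y\<close> around \<open>orig\<close> the boosts are linear fields \<open>y \<mapsto> M y\<close> with
\<open>M\<close> in the Lie algebra \<open>so31\<close> of the Lorentz group, and the unit radial field is
\<open>y / mink_radius y\<close>. Brackets of \<open>so31\<close> fields are \<open>so31\<close> fields again, and \<open>so31\<close> fields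
commute with the radial field, because Lorentz transformations are linear and preserve
\<open>mink_radius\<close>. The Gauss lemma adds two metric facts: the radial field is a unit field orthogonal
to all \<open>so31\<close> fields. As the radial field and the \<open>so31\<close> fields span the tangent spaces, it
follows that \<open>normal\<close> is the radial field (\<open>normal_eq_radial\<close>).

The theorem is then formal. Write \<open>N\<close> for the normal, \<open>R\<close> for a boost, \<open>X\<close> for \<open>N\<close> or any \<open>so31\<close>
field. As \<open>[N, R] = 0\<close>, absence of torsion gives \<open>D N R = D R N\<close>. As \<open>g N X\<close> is constant, the two
terms of the deformation tensor at \<open>(N, X)\<close> are \<open>g (D R N) X = - g N (D R X)\<close> and \<open>g N (D X R)\<close>.
Their sum is \<open>- g N [R, X]\<close>, which is zero since \<open>[R, X]\<close> is zero or an \<open>so31\<close> field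
(\<open>radially_trivial_deformation\<close>). In the Lie derivative of a tensor \<open>\<pi>\<close> along another boost \<open>S\<close> the
terms \<open>S (\<pi> N X)\<close>, \<open>\<pi> [S, N] X\<close> and \<open>\<pi> N [S, X]\<close> vanish by induction (\<open>radially_trivial_lie\<close>).
The induction has to run over all \<open>so31\<close> fields because the bracket of two boosts is a rotation.

The analytic content is the Gauss lemma (\<open>radial_unit\<close>, \<open>gauss_lemma\<close>). The products of the radial
field with itself and with an \<open>so31\<close> field are constant along rays, so they can be computed in the
limit at \<open>orig\<close>. There the exponential map is not known to be smooth, since polar coordinates
degenerate at \<open>\<rho> = 0\<close>. The limit comes from the geodesic equation instead: by a Gronwall estimate
geodesics from \<open>orig\<close> depend on their initial velocity in a Lipschitz way with a constant of the
order of the elapsed time (\<open>geodesic_lipschitz_in_velocity\<close>), so the components of an \<open>so31\<close> field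
tend to zero along a ray.\<close>

section \<open>Calculus of smooth maps\<close>

lemma Ck_on_subset: "Ck_on k W f \<Longrightarrow> V \<subseteq> W \<Longrightarrow> Ck_on k V f"
  by (induction k arbitrary: f) (auto intro: continuous_on_subset)

lemma frechet_derivative_cong_open:
  assumes "open W" "x \<in> W" "\<And>y. y \<in> W \<Longrightarrow> f y = h y"
  shows "frechet_derivative f (at x) = frechet_derivative h (at x)"
proof -
  have "(f has_derivative D) (at x) \<longleftrightarrow> (h has_derivative D) (at x)" for D
    using assms has_derivative_transform_within_open[of f D x UNIV W h]
      has_derivative_transform_within_open[of h D x UNIV W f] by auto
  then show ?thesis unfolding frechet_derivative_def by simp
qed

lemma differentiable_cong_open:
  assumes "open W" "x \<in> W" "\<And>y. y \<in> W \<Longrightarrow> f y = h y"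
  shows "f differentiable (at x) \<Longrightarrow> h differentiable (at x)"
  using assms has_derivative_transform_within_open[of f _ x UNIV W h]
  unfolding differentiable_def by auto

lemma Ck_on_cong:
  assumes "open W"
  shows "Ck_on k W f \<Longrightarrow> (\<And>x. x \<in> W \<Longrightarrow> f x = h x) \<Longrightarrow> Ck_on k W h"
proof (induction k arbitrary: f h)
  case 0 then show ?case by (metis Ck_on.simps(1) continuous_on_cong)
next
  case (Suc k)
  have "h differentiable (at x)" if "x \<in> W" for x
    using differentiable_cong_open[OF assms that Suc.prems(2)] Suc.prems that by auto
  moreover have "Ck_on k W (\<lambda>x. frechet_derivative h (at x) v)" for v
    by (rule Suc.IH[of "\<lambda>x. frechet_derivative f (at x) v"])
      (use Suc.prems frechet_derivative_cong_open[OF assms _ Suc.prems(2)] in auto)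
  ultimately show ?case by simp
qed

lemma Ck_on_Suc_D: "Ck_on (Suc k) W f \<Longrightarrow> Ck_on k W f"
proof (induction k arbitrary: f)
  case 0 then show ?case
    by (auto intro!: continuous_at_imp_continuous_on dest: differentiable_imp_continuous_within)
next
  case (Suc k)
  show ?case using Suc.prems Suc.IH unfolding Ck_on.simps(2)[of k] Ck_on.simps(2)[of "Suc k"] by blast
qed

lemma Ck_on_local:
  "(\<And>x. x \<in> S \<Longrightarrow> \<exists>W. open W \<and> x \<in> W \<and> Ck_on k W f) \<Longrightarrow> Ck_on k S f"
proof (induction k arbitrary: f)
  case 0 
  have "isCont f x" if "x \<in> S" for x
    using 0[OF that] by (auto simp: continuous_on_eq_continuous_at)
  then show ?case by (simp add: continuous_at_imp_continuous_on)
next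
  case (Suc k)
  have "Ck_on k S (\<lambda>x. frechet_derivative f (at x) v)" for v
    using Suc.prems by (intro Suc.IH) (auto, blast)
  moreover have "f differentiable (at x)" if "x \<in> S" for x
    using Suc.prems[OF that] by auto
  ultimately show ?case by simp
qed

lemma Ck_on_const [simp]: "Ck_on k W (\<lambda>x. c)"
  by (induction k arbitrary: c) auto

lemma Ck_on_Suc_I:
  assumes "open W" and D: "\<And>x. x \<in> W \<Longrightarrow> (f has_derivative f' x) (at x)"
    and "\<And>v. Ck_on k W (\<lambda>x. f' x v)"
  shows "Ck_on (Suc k) W f"
proof -
  have "Ck_on k W (\<lambda>x. frechet_derivative f (at x) v)" for v
    by (rule Ck_on_cong[OF assms(1,3)]) (simp add: frechet_derivative_at[OF D, symmetric])
  then show ?thesis using D differentiableI by simp blast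
qed

lemma Ck_on_Suc_D_deriv:
  assumes "Ck_on (Suc k) W f"
  shows "x \<in> W \<Longrightarrow> (f has_derivative frechet_derivative f (at x)) (at x)"
    and "Ck_on k W (\<lambda>x. frechet_derivative f (at x) v)"
  using assms frechet_derivative_works by auto

lemma Ck_on_bounded_linear:
  assumes "bounded_linear f" "open W"
  shows "Ck_on k W f"
proof (cases k)
  case 0 then show ?thesis using assms by (simp add: linear_continuous_on)
next
  case (Suc n)
  show ?thesis unfolding Suc
    by (rule Ck_on_Suc_I[OF assms(2) bounded_linear_imp_has_derivative[OF assms(1)] Ck_on_const])
qed

lemma Ck_on_add: "open W \<Longrightarrow> Ck_on k W f \<Longrightarrow> Ck_on k W h \<Longrightarrow> Ck_on k W (\<lambda>x. f x + h x)"
proof (induction k arbitrary: f h)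
  case (Suc k)
  note f = Ck_on_Suc_D_deriv[OF Suc.prems(2)] and h = Ck_on_Suc_D_deriv[OF Suc.prems(3)]
  show ?case
    by (rule Ck_on_Suc_I[OF Suc.prems(1) has_derivative_add[OF f(1) h(1)] Suc.IH[OF Suc.prems(1) f(2) h(2)]])
qed (auto intro: continuous_intros)

lemma Ck_on_sum: "open W \<Longrightarrow> (\<And>i. i \<in> I \<Longrightarrow> Ck_on k W (f i)) \<Longrightarrow> Ck_on k W (\<lambda>x. \<Sum>i\<in>I. f i x)"
  by (induction I rule: infinite_finite_induct) (simp_all add: Ck_on_add)

lemma Ck_on_bilinear:
  assumes "open W" "bounded_bilinear pr"
  shows "Ck_on k W f \<Longrightarrow> Ck_on k W h \<Longrightarrow> Ck_on k W (\<lambda>x. pr (f x) (h x))"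
proof (induction k arbitrary: f h)
  case 0 then show ?case using bounded_bilinear.continuous_on[OF assms(2)] by auto
next
  case (Suc k)
  note f = Ck_on_Suc_D_deriv[OF Suc.prems(1)] and h = Ck_on_Suc_D_deriv[OF Suc.prems(2)]
  show ?case
    by (rule Ck_on_Suc_I[OF assms(1) bounded_bilinear.FDERIV[OF assms(2) f(1) h(1)]
          Ck_on_add[OF assms(1) Suc.IH[OF Ck_on_Suc_D[OF Suc.prems(1)] h(2)]
            Suc.IH[OF f(2) Ck_on_Suc_D[OF Suc.prems(2)]]]])
qed

lemma linear_Basis_expansion:
  fixes D :: "'b::euclidean_space \<Rightarrow> 'c::real_vector"
  assumes "linear D"
  shows "D w = (\<Sum>b\<in>Basis. (w \<bullet> b) *\<^sub>R D b)"
  using linear_sum[OF assms, of "\<lambda>b. (w \<bullet> b) *\<^sub>R b" Basis]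
  by (simp add: euclidean_representation linear_scale[OF assms])

text \<open>The derivative of a composition is a sum of products of derivatives of the inner map with
  compositions of derivatives of the outer one, so the orders go up in step.\<close>

lemma Ck_on_compose:
  assumes "open V"
  shows "Ck_on k W f \<Longrightarrow> Ck_on k V h \<Longrightarrow> h ` V \<subseteq> W \<Longrightarrow> Ck_on k V (\<lambda>x. f (h x))"
proof (induction k arbitrary: f)
  case 0 then show ?case using continuous_on_compose2 by auto
next
  case (Suc k)
  note f = Ck_on_Suc_D_deriv[OF Suc.prems(1)] and h = Ck_on_Suc_D_deriv[OF Suc.prems(2)]
  have W: "h x \<in> W" if "x \<in> V" for x using that Suc.prems by auto
  have D: "((\<lambda>x. f (h x)) has_derivative (\<lambda>v. \<Sum>b\<in>Basis.
      (frechet_derivative h (at x) v \<bullet> b) *\<^sub>R frechet_derivative f (at (h x)) b)) (at x)"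
    if "x \<in> V" for x
    by (rule has_derivative_eq_rhs[OF diff_chain_at[OF h(1)[OF that] f(1)[OF W[OF that]], unfolded o_def]],
        rule ext, rule linear_Basis_expansion[OF has_derivative_linear[OF f(1)[OF W[OF that]]]])
  show ?case
  proof (rule Ck_on_Suc_I[OF assms D])
    show "Ck_on k V (\<lambda>x. \<Sum>b\<in>Basis. (frechet_derivative h (at x) v \<bullet> b) *\<^sub>R frechet_derivative f (at (h x)) b)" for v
    proof (rule Ck_on_sum[OF assms], rule Ck_on_bilinear[OF assms bounded_bilinear_scaleR])
      fix b
      show "Ck_on k V (\<lambda>x. frechet_derivative h (at x) v \<bullet> b)"
        by (rule Ck_on_bilinear[OF assms bounded_bilinear_inner h(2) Ck_on_const])
      show "Ck_on k V (\<lambda>x. frechet_derivative f (at (h x)) b)"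
        by (rule Suc.IH[OF f(2) Ck_on_Suc_D[OF Suc.prems(2)] Suc.prems(3)])
    qed
  qed
qed

text \<open>The derivatives of \<open>inverse\<close> and \<open>sqrt\<close> are expressed through \<open>inverse\<close> and \<open>sqrt\<close> themselves,
so each order of differentiability gives the next one.\<close>

lemma Ck_on_inverse: "Ck_on k {0<..} (inverse :: real \<Rightarrow> real)"
proof (induction k)
  case 0 then show ?case by (auto intro!: continuous_intros)
next
  case (Suc k)
  have D: "((inverse :: real \<Rightarrow> real) has_derivative (\<lambda>v. - v * (inverse x * inverse x))) (at x)"
    if "x \<in> {0<..}" for x
    using has_derivative_inverse'[of x UNIV] that by (simp add: algebra_simps)
  show ?case
    by (rule Ck_on_Suc_I[OF open_greaterThan D Ck_on_bilinear[OF open_greaterThan bounded_bilinear_mult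
          Ck_on_const Ck_on_bilinear[OF open_greaterThan bounded_bilinear_mult Suc Suc]]])
qed

lemma Ck_on_sqrt: "Ck_on k {0<..} sqrt"
proof (induction k)
  case 0 then show ?case by (auto intro!: continuous_intros)
next
  case (Suc k)
  have D: "(sqrt has_derivative (\<lambda>v. (v / 2) * inverse (sqrt x))) (at x)"
    if "x \<in> {0<..}" for x
    by (rule has_derivative_eq_rhs[OF DERIV_real_sqrt[THEN has_field_derivative_imp_has_derivative]])
      (use that in \<open>auto simp: field_simps\<close>)
  have "Ck_on k {0<..} (\<lambda>x. inverse (sqrt x))"
    by (rule Ck_on_compose[OF open_greaterThan Ck_on_inverse Suc]) auto
  then show ?case
    by (intro Ck_on_Suc_I[OF open_greaterThan D] Ck_on_bilinear[OF open_greaterThan bounded_bilinear_mult Ck_on_const])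
qed

lemma smooth_onE:
  assumes "smooth_on S f" "x \<in> S"
  obtains W F where "open W" "x \<in> W" "\<And>k. Ck_on k W F" "\<And>y. y \<in> W \<Longrightarrow> y \<in> S \<Longrightarrow> F y = f y"
proof -
  from assms obtain W F where "open W \<and> x \<in> W \<and> (\<forall>k. Ck_on k W F) \<and> (\<forall>y\<in>W \<inter> S. F y = f y)"
    unfolding smooth_on_def by meson
  then show thesis by (intro that[of W F]) auto
qed

lemma smooth_onI_open: "open S \<Longrightarrow> (\<And>k. Ck_on k S f) \<Longrightarrow> smooth_on S f"
  unfolding smooth_on_def by blast

lemma smooth_on_open_iff: "open S \<Longrightarrow> smooth_on S f \<longleftrightarrow> (\<forall>k. Ck_on k S f)"
proof (intro iffI allI smooth_onI_open)
  fix k assume "open S" "smooth_on S f"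
  show "Ck_on k S f"
  proof (rule Ck_on_local)
    fix x assume "x \<in> S"
    obtain W F where W: "open W" "x \<in> W" "\<And>k. Ck_on k W F" "\<And>y. y \<in> W \<Longrightarrow> y \<in> S \<Longrightarrow> F y = f y"
      by (rule smooth_onE[OF \<open>smooth_on S f\<close> \<open>x \<in> S\<close>], metis)
    have "Ck_on k (W \<inter> S) f"
      using W Ck_on_cong[OF open_Int[OF W(1) \<open>open S\<close>] Ck_on_subset[OF W(3)]] by auto
    with W \<open>x \<in> S\<close> \<open>open S\<close> show "\<exists>W. open W \<and> x \<in> W \<and> Ck_on k W f" by blast
  qed
qed auto

lemma smooth_onI:
  assumes "\<And>x. x \<in> S \<Longrightarrow> \<exists>W F. open W \<and> x \<in> W \<and> (\<forall>k. Ck_on k W F) \<and> (\<forall>y\<in>W \<inter> S. F y = f y)"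
  shows "smooth_on S f"
  using assms unfolding smooth_on_def by simp

lemma smooth_on_subset:
  assumes "smooth_on S f" "R \<subseteq> S"
  shows "smooth_on R f"
proof (rule smooth_onI)
  fix x assume "x \<in> R"
  with assms obtain W F where "open W" "x \<in> W" "\<And>k. Ck_on k W F" "\<And>y. y \<in> W \<Longrightarrow> y \<in> S \<Longrightarrow> F y = f y"
    using smooth_onE[of S f x] by auto
  with assms(2) show "\<exists>W F. open W \<and> x \<in> W \<and> (\<forall>k. Ck_on k W F) \<and> (\<forall>y\<in>W \<inter> R. F y = f y)"
    by (intro exI[of _ W] exI[of _ F]) auto
qed

lemma smooth_on_cong: "smooth_on S f \<Longrightarrow> (\<And>x. x \<in> S \<Longrightarrow> f x = h x) \<Longrightarrow> smooth_on S h"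
  unfolding smooth_on_def by simp

lemma smooth_on_local:
  assumes "\<And>x. x \<in> S \<Longrightarrow> \<exists>W. open W \<and> x \<in> W \<and> smooth_on (W \<inter> S) f"
  shows "smooth_on S f"
proof (rule smooth_onI)
  fix x assume "x \<in> S"
  with assms obtain W where W: "open W" "x \<in> W" "smooth_on (W \<inter> S) f" by blast
  then obtain V F where "open V" "x \<in> V" "\<And>k. Ck_on k V F" "\<And>y. y \<in> V \<Longrightarrow> y \<in> W \<inter> S \<Longrightarrow> F y = f y"
    using \<open>x \<in> S\<close> by (auto elim!: smooth_onE[of "W \<inter> S" f x])
  with W show "\<exists>W F. open W \<and> x \<in> W \<and> (\<forall>k. Ck_on k W F) \<and> (\<forall>y\<in>W \<inter> S. F y = f y)"
    by (intro exI[of _ "V \<inter> W"] exI[of _ F]) (auto intro: Ck_on_subset)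
qed

lemma smooth_on_compose:
  assumes f: "smooth_on R f" and h: "smooth_on S h" and sub: "h ` S \<subseteq> R"
  shows "smooth_on S (\<lambda>x. f (h x))"
proof (rule smooth_onI)
  fix x assume x: "x \<in> S"
  obtain V H where V: "open V" "x \<in> V" "\<And>k. Ck_on k V H" "\<And>y. y \<in> V \<Longrightarrow> y \<in> S \<Longrightarrow> H y = h y"
    by (rule smooth_onE[OF h x], metis)
  obtain W F where W: "open W" "h x \<in> W" "\<And>k. Ck_on k W F" "\<And>y. y \<in> W \<Longrightarrow> y \<in> R \<Longrightarrow> F y = f y"
  proof -
    have "h x \<in> R" using x sub by auto
    from smooth_onE[OF f this] that show thesis by metis
  qed
  have op: "open (V \<inter> H -` W)"
    using V(1) V(3)[of 0] W(1) by (simp add: continuous_on_open_vimage Int_commute)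
  have "Ck_on k (V \<inter> H -` W) (\<lambda>y. F (H y))" for k
    by (rule Ck_on_compose[OF op W(3) Ck_on_subset[OF V(3)]]) auto
  then show "\<exists>W F. open W \<and> x \<in> W \<and> (\<forall>k. Ck_on k W F) \<and> (\<forall>y\<in>W \<inter> S. F y = f (h y))"
    using op x V W sub by (intro exI[of _ "V \<inter> H -` W"] exI[of _ "\<lambda>y. F (H y)"]) auto
qed

lemma smooth_on_binop:
  fixes S :: "'b::euclidean_space set"
  assumes f: "smooth_on S f" and h: "smooth_on S h"
    and pr: "\<And>k (W :: 'b set) f h. open W \<Longrightarrow> Ck_on k W f \<Longrightarrow> Ck_on k W h \<Longrightarrow> Ck_on k W (\<lambda>x. pr (f x) (h x))"
  shows "smooth_on S (\<lambda>x. pr (f x) (h x))"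
proof (rule smooth_onI)
  fix x assume x: "x \<in> S"
  obtain V H where V: "open V" "x \<in> V" "\<And>k. Ck_on k V H" "\<And>y. y \<in> V \<Longrightarrow> y \<in> S \<Longrightarrow> H y = h y"
    by (rule smooth_onE[OF h x], metis)
  obtain W F where W: "open W" "x \<in> W" "\<And>k. Ck_on k W F" "\<And>y. y \<in> W \<Longrightarrow> y \<in> S \<Longrightarrow> F y = f y"
    by (rule smooth_onE[OF f x], metis)
  have "Ck_on k (V \<inter> W) (\<lambda>y. pr (F y) (H y))" for k
    using pr[of "V \<inter> W" k F H] Ck_on_subset[OF W(3), of "V \<inter> W" k] Ck_on_subset[OF V(3), of "V \<inter> W" k]
      V(1) W(1) by auto
  then show "\<exists>W F. open W \<and> x \<in> W \<and> (\<forall>k. Ck_on k W F) \<and> (\<forall>y\<in>W \<inter> S. F y = pr (f y) (h y))"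
    using V W by (intro exI[of _ "V \<inter> W"] exI[of _ "\<lambda>y. pr (F y) (H y)"]) auto
qed

lemma smooth_on_const: "smooth_on S (\<lambda>x. c)"
  by (rule smooth_onI, intro exI[of _ UNIV] exI[of _ "\<lambda>x. c"]) simp

lemma smooth_on_add: "smooth_on S f \<Longrightarrow> smooth_on S h \<Longrightarrow> smooth_on S (\<lambda>x. f x + h x)"
  by (rule smooth_on_binop[where pr="\<lambda>u v. u + v"]) (assumption | rule Ck_on_add)+

lemma smooth_on_bilinear:
  "bounded_bilinear pr \<Longrightarrow> smooth_on S f \<Longrightarrow> smooth_on S h \<Longrightarrow> smooth_on S (\<lambda>x. pr (f x) (h x))"
  by (rule smooth_on_binop[where pr=pr]) (assumption | rule Ck_on_bilinear)+

lemmas smooth_on_mult = smooth_on_bilinear[OF bounded_bilinear_mult]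
lemmas smooth_on_scaleR = smooth_on_bilinear[OF bounded_bilinear_scaleR]

lemma smooth_on_sum: "(\<And>i. i \<in> I \<Longrightarrow> smooth_on S (f i)) \<Longrightarrow> smooth_on S (\<lambda>x. \<Sum>i\<in>I. f i x)"
  by (induction I rule: infinite_finite_induct) (simp_all add: smooth_on_add smooth_on_const)

lemma smooth_on_bounded_linear: "bounded_linear f \<Longrightarrow> smooth_on S f"
  by (rule smooth_onI, intro exI[of _ UNIV] exI[of _ f]) (simp add: Ck_on_bounded_linear)

lemma smooth_on_linear: "linear f \<Longrightarrow> smooth_on S f"
  by (simp add: smooth_on_bounded_linear linear_conv_bounded_linear)

lemma smooth_on_nth: "smooth_on S f \<Longrightarrow> smooth_on S (\<lambda>x. f x $ i)"
  by (rule smooth_on_compose[OF smooth_on_bounded_linear[OF bounded_linear_vec_nth, of UNIV]]) auto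

lemma smooth_on_componentwise:
  fixes f :: "'b::euclidean_space \<Rightarrow> real ^ 'n"
  assumes "\<And>i. smooth_on S (\<lambda>x. f x $ i)"
  shows "smooth_on S f"
proof (rule smooth_on_cong)
  show "smooth_on S (\<lambda>x. \<Sum>i\<in>UNIV. f x $ i *\<^sub>R axis i 1)"
    by (intro smooth_on_sum smooth_on_scaleR smooth_on_const assms)
  show "(\<Sum>i\<in>UNIV. f x $ i *\<^sub>R axis i 1) = f x" for x
    using basis_expansion[of "f x"] by (simp add: scalar_mult_eq_scaleR)
qed

lemma smooth_on_differentiable:
  "open S \<Longrightarrow> smooth_on S f \<Longrightarrow> x \<in> S \<Longrightarrow> f differentiable (at x)"
  unfolding smooth_on_open_iff by (metis Ck_on.simps(2))

lemma smooth_on_frechet_derivative: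
  "open S \<Longrightarrow> smooth_on S f \<Longrightarrow> smooth_on S (\<lambda>x. frechet_derivative f (at x) v)"
  unfolding smooth_on_open_iff by (metis Ck_on.simps(2))

lemma smooth_on_has_derivative:
  "open S \<Longrightarrow> smooth_on S f \<Longrightarrow> x \<in> S \<Longrightarrow> (f has_derivative frechet_derivative f (at x)) (at x)"
  using smooth_on_differentiable frechet_derivative_works by blast

lemma smooth_on_continuous:
  assumes "smooth_on S f"
  shows "continuous_on S f"
  unfolding continuous_on_def
proof
  fix x assume x: "x \<in> S"
  obtain W F where W: "open W" "x \<in> W" "\<And>k. Ck_on k W F" "\<And>y. y \<in> W \<Longrightarrow> y \<in> S \<Longrightarrow> F y = f y"
    by (rule smooth_onE[OF assms x], metis)
  then have "(F \<longlongrightarrow> F x) (at x within S)"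
    using Ck_on.simps(1)[THEN iffD1, OF W(3)] continuous_on_interior[of W F x]
    by (auto simp: interior_open isCont_def Lim_at_imp_Lim_at_within)
  moreover have "eventually (\<lambda>y. F y = f y) (at x within S)"
    unfolding eventually_at_topological using W(1,2,4) by blast
  ultimately have "(f \<longlongrightarrow> F x) (at x within S)"
    by (rule Lim_transform_eventually)
  with W x show "(f \<longlongrightarrow> f x) (at x within S)" by auto
qed

text \<open>A derivative is linear in the direction, hence smooth in base point and direction together.\<close>

lemma smooth_on_frechet_derivative_along:
  assumes S: "open S" "smooth_on S f" and h: "smooth_on S h"
  shows "smooth_on S (\<lambda>x. frechet_derivative f (at x) (h x))"
proof (rule smooth_on_cong)
  show "smooth_on S (\<lambda>x. \<Sum>b\<in>Basis. (h x \<bullet> b) *\<^sub>R frechet_derivative f (at x) b)"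
    by (intro smooth_on_sum smooth_on_scaleR smooth_on_frechet_derivative S
          smooth_on_bilinear[OF bounded_bilinear_inner] smooth_on_const h)
  fix x assume "x \<in> S"
  then have "linear (frechet_derivative f (at x))"
    by (intro linear_frechet_derivative smooth_on_differentiable[OF S])
  from linear_Basis_expansion[OF this, of "h x"]
  show "(\<Sum>b\<in>Basis. (h x \<bullet> b) *\<^sub>R frechet_derivative f (at x) b) = frechet_derivative f (at x) (h x)"
    by simp
qed

lemma smooth_on_Pair:
  assumes "smooth_on S f" "smooth_on S h"
  shows "smooth_on S (\<lambda>x. (f x, h x))"
proof (rule smooth_on_cong)
  have l: "linear (\<lambda>u. (u, 0))" "linear (\<lambda>v. (0, v))" by (auto intro!: linearI)
  show "smooth_on S (\<lambda>x. (f x, 0) + (0, h x))"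
    by (intro smooth_on_add smooth_on_compose[OF smooth_on_linear[OF l(1)] assms(1) subset_UNIV]
          smooth_on_compose[OF smooth_on_linear[OF l(2)] assms(2) subset_UNIV])
qed simp

lemma smooth_curve:
  fixes c :: "real \<Rightarrow> 'b::euclidean_space"
  assumes K: "open K" and c: "smooth_on K c"
  shows smooth_curve_derivative: "t \<in> K \<Longrightarrow> (c has_vector_derivative vector_derivative c (at t)) (at t)"
    and smooth_curve_velocity: "smooth_on K (\<lambda>t. vector_derivative c (at t))"
proof -
  have D: "(c has_vector_derivative frechet_derivative c (at t) 1) (at t)" if "t \<in> K" for t
  proof -
    have d: "(c has_derivative frechet_derivative c (at t)) (at t)"
      by (rule smooth_on_has_derivative[OF K c that])
    have "frechet_derivative c (at t) h = h *\<^sub>R frechet_derivative c (at t) 1" for h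
      using linear_scale[OF has_derivative_linear[OF d], of h 1] by simp
    then have "frechet_derivative c (at t) = (\<lambda>h. h *\<^sub>R frechet_derivative c (at t) 1)" by (rule ext)
    with d show ?thesis unfolding has_vector_derivative_def by metis
  qed
  show "t \<in> K \<Longrightarrow> (c has_vector_derivative vector_derivative c (at t)) (at t)"
    using D vector_derivative_at by metis
  show "smooth_on K (\<lambda>t. vector_derivative c (at t))"
    by (rule smooth_on_cong[OF smooth_on_frechet_derivative[OF K c, of 1]])
      (use D vector_derivative_at in metis)
qed

section \<open>Coordinate systems and tangent vectors\<close>

context smooth_manifold
begin

text \<open>The exponential coordinates around \<open>orig\<close> are to be used in the same way as the charts of the
atlas without belonging to it: an atlas need not be maximal. The notion collects what the
coordinate calculus uses, a homeomorphism with smooth transitions to every chart in both directions.\<close>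

definition coord_system :: "'a set \<Rightarrow> ('a \<Rightarrow> real^4) \<Rightarrow> bool" where
  "coord_system W \<phi> \<longleftrightarrow>
     open W \<and> inj_on \<phi> W \<and> open (\<phi> ` W) \<and>
     continuous_on W \<phi> \<and> continuous_on (\<phi> ` W) (inv_into W \<phi>) \<and>
     (\<forall>(U, x)\<in>A. smooth_on (x ` (U \<inter> W)) (\<phi> \<circ> inv_into U x) \<and>
        smooth_on (\<phi> ` (U \<inter> W)) (x \<circ> inv_into W \<phi>))"

lemma chart_coord_system:
  assumes "(U, x) \<in> A"
  shows "coord_system U x"
proof -
  have "smooth_on (x' ` (U' \<inter> U)) (x \<circ> inv_into U' x') \<and> smooth_on (x ` (U' \<inter> U)) (x' \<circ> inv_into U x)"
    if "(U', x') \<in> A" for U' x'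
    using compatible[OF assms that] compatible[OF that assms] by (simp add: Int_commute)
  then show ?thesis unfolding coord_system_def using charts[OF assms] by auto
qed

lemma coord_systemD:
  assumes "coord_system W \<phi>"
  shows "open W" "inj_on \<phi> W" "open (\<phi> ` W)" "continuous_on W \<phi>"
    "continuous_on (\<phi> ` W) (inv_into W \<phi>)"
    "(U, x) \<in> A \<Longrightarrow> smooth_on (x ` (U \<inter> W)) (\<phi> \<circ> inv_into U x)"
    "(U, x) \<in> A \<Longrightarrow> smooth_on (\<phi> ` (U \<inter> W)) (x \<circ> inv_into W \<phi>)"
    "p \<in> W \<Longrightarrow> inv_into W \<phi> (\<phi> p) = p"
  using assms by (auto simp: coord_system_def dest: bspec[where x="(U, x)"])

lemma chart_at:
  obtains U x where "(U, x) \<in> A" "p \<in> U"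
proof -
  have "p \<in> (\<Union>(U, x)\<in>A. U)" using cover by simp
  then show thesis using that by auto
qed

lemma coord_open_image:
  assumes "coord_system W \<phi>" "open V" "V \<subseteq> W"
  shows "open (\<phi> ` V)"
proof -
  note c = coord_systemD[OF assms(1)]
  have "\<phi> ` V = \<phi> ` W \<inter> inv_into W \<phi> -` V"
    using assms(3) c(8) by (auto simp: image_iff)
  then show ?thesis using continuous_open_preimage[OF c(5,3) assms(2)] by simp
qed

text \<open>Smoothness of a function refers to all charts; because transition maps are smooth, it can be tested
in a single coordinate system.\<close>

lemma smooth_fun_iff_coord:
  assumes c: "coord_system W \<phi>" and V: "open V" "V \<subseteq> W"
  shows "smooth_fun V f \<longleftrightarrow> smooth_on (\<phi> ` V) (f \<circ> inv_into W \<phi>)"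
proof
  note cD = coord_systemD[OF c]
  assume f: "smooth_fun V f"
  show "smooth_on (\<phi> ` V) (f \<circ> inv_into W \<phi>)"
  proof (rule smooth_on_local)
    fix z assume "z \<in> \<phi> ` V"
    then obtain p where p: "p \<in> V" "z = \<phi> p" by auto
    obtain U x where U: "(U, x) \<in> A" "p \<in> U" by (rule chart_at)
    note xD = coord_systemD[OF chart_coord_system[OF U(1)]]
    have "smooth_on (\<phi> ` (U \<inter> V)) (\<lambda>z. (f \<circ> inv_into U x) ((x \<circ> inv_into W \<phi>) z))"
    proof (rule smooth_on_compose[of "x ` (U \<inter> V)"])
      show "smooth_on (x ` (U \<inter> V)) (f \<circ> inv_into U x)"
        using f U unfolding smooth_fun_def by auto
      show "smooth_on (\<phi> ` (U \<inter> V)) (x \<circ> inv_into W \<phi>)"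
        by (rule smooth_on_subset[OF cD(7)[OF U(1)]]) (use V in auto)
    qed (use V cD(8) in \<open>auto simp: subset_iff\<close>)
    then have "smooth_on (\<phi> ` (U \<inter> V)) (f \<circ> inv_into W \<phi>)"
      by (rule smooth_on_cong) (use V cD(8) xD(8) in \<open>auto simp: subset_iff\<close>)
    moreover have "open (\<phi> ` (U \<inter> V))"
      using coord_open_image[OF c, of "U \<inter> V"] V xD(1) by auto
    ultimately show "\<exists>N. open N \<and> z \<in> N \<and> smooth_on (N \<inter> \<phi> ` V) (f \<circ> inv_into W \<phi>)"
      using U p by (intro exI[of _ "\<phi> ` (U \<inter> V)"]) (auto elim: smooth_on_subset)
  qed
next
  note cD = coord_systemD[OF c]
  assume f: "smooth_on (\<phi> ` V) (f \<circ> inv_into W \<phi>)"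
  have "smooth_on (x ` (U \<inter> V)) (f \<circ> inv_into U x)" if U: "(U, x) \<in> A" for U x
  proof -
    note xD = coord_systemD[OF chart_coord_system[OF U(1)]]
    have "smooth_on (x ` (U \<inter> V)) (\<lambda>z. (f \<circ> inv_into W \<phi>) ((\<phi> \<circ> inv_into U x) z))"
    proof (rule smooth_on_compose[OF f])
      show "smooth_on (x ` (U \<inter> V)) (\<phi> \<circ> inv_into U x)"
        by (rule smooth_on_subset[OF cD(6)[OF U(1)]]) (use V in auto)
    qed (use xD(8) in auto)
    then show ?thesis
      by (rule smooth_on_cong) (use V cD(8) xD(8) in \<open>auto simp: subset_iff\<close>)
  qed
  then show "smooth_fun V f" unfolding smooth_fun_def by auto
qed

lemma smooth_fun_subset: "smooth_fun V f \<Longrightarrow> V' \<subseteq> V \<Longrightarrow> smooth_fun V' f"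
  unfolding smooth_fun_def by (auto elim!: ballE smooth_on_subset)

lemma smooth_fun_cong:
  assumes "smooth_fun V f" "\<And>p. p \<in> V \<Longrightarrow> f p = h p"
  shows "smooth_fun V h"
proof -
  have "smooth_on (x ` (U \<inter> V)) (h \<circ> inv_into U x)" if U: "(U, x) \<in> A" for U x
    by (rule smooth_on_cong[of _ "f \<circ> inv_into U x"])
      (use assms U coord_systemD(8)[OF chart_coord_system[OF U(1)]] in \<open>auto simp: smooth_fun_def\<close>)
  then show ?thesis unfolding smooth_fun_def by auto
qed

lemma smooth_fun_const: "smooth_fun V (\<lambda>p. k)"
  unfolding smooth_fun_def o_def by (auto intro: smooth_on_const)

lemma smooth_fun_add: "smooth_fun V f \<Longrightarrow> smooth_fun V h \<Longrightarrow> smooth_fun V (\<lambda>p. f p + h p)"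
  unfolding smooth_fun_def o_def by (auto intro: smooth_on_add)

lemma smooth_fun_mult: "smooth_fun V f \<Longrightarrow> smooth_fun V h \<Longrightarrow> smooth_fun V (\<lambda>p. f p * h p)"
  unfolding smooth_fun_def o_def by (auto intro: smooth_on_mult)

lemma smooth_fun_sum:
  "(\<And>i. i \<in> I \<Longrightarrow> smooth_fun V (f i)) \<Longrightarrow> smooth_fun V (\<lambda>p. \<Sum>i\<in>I. f i p)"
proof (induction I rule: infinite_finite_induct)
  case (insert i I)
  then show ?case
    by (simp add: smooth_fun_add[of V "f i" "\<lambda>p. \<Sum>i\<in>I. f i p"])
qed (simp_all add: smooth_fun_const)

lemma coord_smooth_fun:
  assumes c: "coord_system W \<phi>"
  shows "smooth_fun W (\<lambda>q. \<phi> q $ i)"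
proof -
  have "smooth_on (\<phi> ` W) (\<lambda>z. z $ i)"
    by (rule smooth_on_bounded_linear[OF bounded_linear_vec_nth])
  then have "smooth_on (\<phi> ` W) ((\<lambda>q. \<phi> q $ i) \<circ> inv_into W \<phi>)"
    by (rule smooth_on_cong) (auto simp: coord_systemD(8)[OF c])
  then show ?thesis using smooth_fun_iff_coord[OF c coord_systemD(1)[OF c]] by simp
qed

lemma coord_smooth_at: "coord_system W \<phi> \<Longrightarrow> p \<in> W \<Longrightarrow> smooth_at p (\<lambda>q. \<phi> q $ i)"
  unfolding smooth_at_def
  by (rule exI[of _ W]) (use coord_smooth_fun[of W \<phi> i] coord_systemD(1)[of W \<phi>] in auto)

lemma coord_change_smooth:
  assumes c: "coord_system W \<phi>" and c': "coord_system W' \<phi>'"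
  shows "smooth_on (\<phi> ` (W \<inter> W')) (\<phi>' \<circ> inv_into W \<phi>)"
proof (rule smooth_on_componentwise)
  fix i
  have "open (W \<inter> W')" using coord_systemD(1)[OF c] coord_systemD(1)[OF c'] by auto
  moreover have "smooth_fun (W \<inter> W') (\<lambda>q. \<phi>' q $ i)"
    using smooth_fun_subset[OF coord_smooth_fun[OF c']] by auto
  ultimately show "smooth_on (\<phi> ` (W \<inter> W')) (\<lambda>z. (\<phi>' \<circ> inv_into W \<phi>) z $ i)"
    using smooth_fun_iff_coord[OF c, of "W \<inter> W'" "\<lambda>q. \<phi>' q $ i"] by (auto simp: o_def)
qed

lemma smooth_at_coord:
  assumes c: "coord_system W \<phi>" and p: "p \<in> W" "smooth_at p f"
  obtains N where "open N" "\<phi> p \<in> N" "N \<subseteq> \<phi> ` W" "smooth_on N (f \<circ> inv_into W \<phi>)"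
proof -
  obtain V where V: "open V" "p \<in> V" "smooth_fun V f" using p unfolding smooth_at_def by auto
  have o: "open (V \<inter> W)" using V coord_systemD(1)[OF c] by auto
  show thesis
  proof (rule that)
    show "open (\<phi> ` (V \<inter> W))" by (rule coord_open_image[OF c o]) auto
    show "smooth_on (\<phi> ` (V \<inter> W)) (f \<circ> inv_into W \<phi>)"
      using smooth_fun_iff_coord[OF c o, of f] smooth_fun_subset[OF V(3)] by auto
  qed (use V p in auto)
qed

lemma smooth_at_cong: "smooth_at p f \<Longrightarrow> open V \<Longrightarrow> p \<in> V \<Longrightarrow> (\<And>q. q \<in> V \<Longrightarrow> f q = h q) \<Longrightarrow> smooth_at p h"
  unfolding smooth_at_def
proof (elim exE conjE)
  fix W assume "open V" "p \<in> V" "\<And>q. q \<in> V \<Longrightarrow> f q = h q" "open W" "p \<in> W" "smooth_fun W f"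
  then show "\<exists>W. open W \<and> p \<in> W \<and> smooth_fun W h"
    using smooth_fun_cong[OF smooth_fun_subset, of W f "V \<inter> W" h] by (intro exI[of _ "V \<inter> W"]) auto
qed

lemma chart_vec_apply:
  "chart_vec (W, \<phi>) p w f =
     (if smooth_at p f then frechet_derivative (f \<circ> inv_into W \<phi>) (at (\<phi> p)) w else 0)"
  unfolding chart_vec_def germ_def by simp

lemma smooth_at_has_derivative:
  assumes "coord_system W \<phi>" "p \<in> W" "smooth_at p f"
  shows "((f \<circ> inv_into W \<phi>) has_derivative frechet_derivative (f \<circ> inv_into W \<phi>) (at (\<phi> p))) (at (\<phi> p))"
  using smooth_at_coord[OF assms] smooth_on_has_derivative by metis

lemma chart_vec_change:
  assumes c: "coord_system W \<phi>" and c': "coord_system W' \<phi>'" and p: "p \<in> W" "p \<in> W'"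
  shows "chart_vec (W, \<phi>) p w =
    chart_vec (W', \<phi>') p (frechet_derivative (\<phi>' \<circ> inv_into W \<phi>) (at (\<phi> p)) w)"
proof
  fix f :: "'a \<Rightarrow> real"
  let ?t = "\<phi>' \<circ> inv_into W \<phi>" and ?F = "f \<circ> inv_into W' \<phi>'"
  have o: "open (\<phi> ` (W \<inter> W'))"
    by (rule coord_open_image[OF c]) (use coord_systemD(1)[OF c] coord_systemD(1)[OF c'] in auto)
  have t: "(?t has_derivative frechet_derivative ?t (at (\<phi> p))) (at (\<phi> p))"
    by (rule smooth_on_has_derivative[OF o coord_change_smooth[OF c c']]) (use p in auto)
  show "chart_vec (W, \<phi>) p w f = chart_vec (W', \<phi>') p (frechet_derivative ?t (at (\<phi> p)) w) f"
  proof (cases "smooth_at p f")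
    case True
    have "?t (\<phi> p) = \<phi>' p" using coord_systemD(8)[OF c] p by auto
    with smooth_at_has_derivative[OF c' p(2) True]
    have "(?F has_derivative frechet_derivative ?F (at (\<phi>' p))) (at (?t (\<phi> p)))" by simp
    from diff_chain_at[OF t this]
    have "frechet_derivative (?F \<circ> ?t) (at (\<phi> p)) = frechet_derivative ?F (at (\<phi>' p)) \<circ> frechet_derivative ?t (at (\<phi> p))"
      by (rule frechet_derivative_at[symmetric])
    moreover have "frechet_derivative (f \<circ> inv_into W \<phi>) (at (\<phi> p)) = frechet_derivative (?F \<circ> ?t) (at (\<phi> p))"
      by (rule frechet_derivative_cong_open[OF o])
        (use p coord_systemD(8)[OF c] coord_systemD(8)[OF c'] in auto)
    ultimately show ?thesis using True by (simp add: chart_vec_apply)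
  qed (simp add: chart_vec_apply)
qed

lemma tangent_space_eq_range:
  assumes c: "coord_system W \<phi>" and p: "p \<in> W"
  shows "tangent_space p = range (chart_vec (W, \<phi>) p)"
proof
  show "tangent_space p \<subseteq> range (chart_vec (W, \<phi>) p)"
    unfolding tangent_space_def using chart_vec_change[OF chart_coord_system c _ p] by auto
  obtain U x where "(U, x) \<in> A" "p \<in> U" by (rule chart_at)
  then show "range (chart_vec (W, \<phi>) p) \<subseteq> tangent_space p"
    unfolding tangent_space_def using chart_vec_change[OF c chart_coord_system p] by fastforce
qed

lemma chart_vec_tangent:
  "coord_system W \<phi> \<Longrightarrow> p \<in> W \<Longrightarrow> chart_vec (W, \<phi>) p w \<in> tangent_space p"
  by (simp add: tangent_space_eq_range)

lemma chart_vec_coord: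
  assumes c: "coord_system W \<phi>" and p: "p \<in> W"
  shows "chart_vec (W, \<phi>) p w (\<lambda>q. \<phi> q $ i) = w $ i"
proof -
  have "frechet_derivative ((\<lambda>q. \<phi> q $ i) \<circ> inv_into W \<phi>) (at (\<phi> p)) =
      frechet_derivative (\<lambda>z. z $ i) (at (\<phi> p))"
    by (rule frechet_derivative_cong_open[OF coord_systemD(3)[OF c]])
      (use p coord_systemD(8)[OF c] in auto)
  also have "\<dots> = (\<lambda>z. z $ i)"
    by (rule frechet_derivative_at[symmetric])
      (rule bounded_linear_imp_has_derivative[OF bounded_linear_vec_nth])
  finally show ?thesis using coord_smooth_at[OF c p] by (simp add: chart_vec_apply)
qed

text \<open>A tangent vector is determined by its values on the coordinate functions; equality of vectors is
always proved in this way.\<close>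

lemma tangent_eq_chart_vec:
  assumes c: "coord_system W \<phi>" and p: "p \<in> W" "v \<in> tangent_space p"
  shows "v = chart_vec (W, \<phi>) p (\<chi> i. v (\<lambda>q. \<phi> q $ i))"
proof -
  obtain w where w: "v = chart_vec (W, \<phi>) p w" using tangent_space_eq_range[OF c p(1)] p(2) by auto
  then have "(\<chi> i. v (\<lambda>q. \<phi> q $ i)) = w" using chart_vec_coord[OF c p(1)] by (simp add: vec_eq_iff)
  with w show ?thesis by simp
qed

lemma linear_chart_vec:
  assumes c: "coord_system W \<phi>" and p: "p \<in> W"
  shows "linear (\<lambda>w. chart_vec (W, \<phi>) p w f)"
proof (cases "smooth_at p f")
  case True
  from has_derivative_linear[OF smooth_at_has_derivative[OF c p True]] True
  show ?thesis by (simp add: chart_vec_apply)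
qed (simp add: chart_vec_apply linear_zero)

lemma chart_vec_sum:
  assumes c: "coord_system W \<phi>" and p: "p \<in> W"
  shows "chart_vec (W, \<phi>) p (\<Sum>i\<in>I. a i *\<^sub>R w i) = (\<lambda>f. \<Sum>i\<in>I. a i * chart_vec (W, \<phi>) p (w i) f)"
  by (intro ext) (simp add: linear_sum[OF linear_chart_vec[OF c p]] linear_scale[OF linear_chart_vec[OF c p]])

lemma chart_vec_0:
  assumes c: "coord_system W \<phi>" and p: "p \<in> W"
  shows "chart_vec (W, \<phi>) p 0 = (\<lambda>f. 0)"
  using linear_0[OF linear_chart_vec[OF c p]] by (intro ext) simp

lemma tangent_space_sum:
  assumes "\<And>i. i \<in> I \<Longrightarrow> v i \<in> tangent_space p"
  shows "(\<lambda>f. \<Sum>i\<in>I. a i * v i f) \<in> tangent_space p"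
proof -
  obtain U x where U: "(U, x) \<in> A" "p \<in> U" by (rule chart_at)
  note c = chart_coord_system[OF U(1)]
  have "(\<lambda>f. \<Sum>i\<in>I. a i * v i f) = chart_vec (U, x) p (\<Sum>i\<in>I. a i *\<^sub>R (\<chi> j. v i (\<lambda>q. x q $ j)))"
    unfolding chart_vec_sum[OF c U(2)]
    using tangent_eq_chart_vec[OF c U(2) assms] by (intro ext sum.cong) auto
  then show ?thesis using chart_vec_tangent[OF c U(2)] by simp
qed

lemma tangent_space_scale: "v \<in> tangent_space p \<Longrightarrow> (\<lambda>f. a * v f) \<in> tangent_space p"
  using tangent_space_sum[of "{()}" "\<lambda>_. v" p "\<lambda>_. a"] by simp

lemma tangent_space_add:
  "u \<in> tangent_space p \<Longrightarrow> v \<in> tangent_space p \<Longrightarrow> (\<lambda>f. u f + v f) \<in> tangent_space p"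
  using tangent_space_sum[of UNIV "\<lambda>b::bool. if b then u else v" p "\<lambda>_. 1"]
  by (simp add: UNIV_bool add.commute)

text \<open>Smoothness near \<open>p\<close> and derivatives at \<open>p\<close> depend only on the values near \<open>p\<close>; functions that are
not smooth near \<open>p\<close> are sent to \<open>0\<close>.\<close>

lemma tangent_cong:
  assumes v: "v \<in> tangent_space p" and V: "open V" "p \<in> V" "\<And>q. q \<in> V \<Longrightarrow> f q = h q"
  shows "v f = v h"
proof -
  obtain U x where U: "(U, x) \<in> A" "p \<in> U" by (rule chart_at)
  note c = chart_coord_system[OF U(1)]
  have "smooth_at p f \<longleftrightarrow> smooth_at p h"
    using smooth_at_cong[of p f V h] smooth_at_cong[of p h V f] V by auto
  moreover have o: "open (x ` (U \<inter> V))"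
    by (rule coord_open_image[OF c]) (use V coord_systemD(1)[OF c] in auto)
  have "frechet_derivative (f \<circ> inv_into U x) (at (x p)) = frechet_derivative (h \<circ> inv_into U x) (at (x p))"
    by (rule frechet_derivative_cong_open[OF o]) (use U V coord_systemD(8)[OF c] in auto)
  ultimately show ?thesis
    using v unfolding tangent_space_eq_range[OF c U(2)] by (auto simp: chart_vec_apply)
qed

lemma tangent_const:
  assumes v: "v \<in> tangent_space p"
  shows "v (\<lambda>q. k) = 0"
proof -
  obtain U x where U: "(U, x) \<in> A" "p \<in> U" by (rule chart_at)
  note c = chart_coord_system[OF U(1)]
  have "frechet_derivative (\<lambda>z. k) (at (x p)) = (\<lambda>z. 0)"
    by (rule frechet_derivative_at[symmetric]) simp
  then show ?thesis using v unfolding tangent_space_eq_range[OF c U(2)] by (auto simp: chart_vec_apply o_def)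
qed

lemma tangent_locally_const:
  assumes v: "v \<in> tangent_space p" and V: "open V" "p \<in> V" "\<And>q. q \<in> V \<Longrightarrow> f q = k"
  shows "v f = 0"
  using tangent_cong[OF v V] tangent_const[OF v] by simp

lemma smooth_vfield_tangent: "smooth_vfield V X \<Longrightarrow> p \<in> V \<Longrightarrow> X p \<in> tangent_space p"
  unfolding smooth_vfield_def by auto

lemma smooth_vfield_smooth_fun:
  "smooth_vfield V X \<Longrightarrow> open W \<Longrightarrow> W \<subseteq> V \<Longrightarrow> smooth_fun W f \<Longrightarrow> smooth_fun W (\<lambda>p. X p f)"
  unfolding smooth_vfield_def by simp

lemma smooth_vfield_subset:
  assumes "smooth_vfield V X" "V' \<subseteq> V"
  shows "smooth_vfield V' X"
  unfolding smooth_vfield_def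
proof (intro conjI ballI allI impI)
  fix p assume "p \<in> V'"
  then show "X p \<in> tangent_space p" using smooth_vfield_tangent[OF assms(1)] assms(2) by auto
next
  fix W f assume "open W \<and> W \<subseteq> V' \<and> smooth_fun W f"
  then show "smooth_fun W (\<lambda>p. X p f)" using smooth_vfield_smooth_fun[OF assms(1)] assms(2) by auto
qed

lemma smooth_vfield_cong:
  assumes X: "smooth_vfield V X" and eq: "\<And>q. q \<in> V \<Longrightarrow> X q = Y q"
  shows "smooth_vfield V Y"
  unfolding smooth_vfield_def
proof (intro conjI ballI allI impI)
  fix p assume "p \<in> V" then show "Y p \<in> tangent_space p" using smooth_vfield_tangent[OF X] eq by metis
next
  fix W f assume W: "open W \<and> W \<subseteq> V \<and> smooth_fun W f"
  then have "smooth_fun W (\<lambda>p. X p f)" using smooth_vfield_smooth_fun[OF X, of W f] by simp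
  then show "smooth_fun W (\<lambda>p. Y p f)" by (rule smooth_fun_cong) (use W eq in auto)
qed

lemma smooth_vfield_sum:
  assumes "\<And>i. i \<in> I \<Longrightarrow> smooth_fun V (a i)" "\<And>i. i \<in> I \<Longrightarrow> smooth_vfield V (X i)"
  shows "smooth_vfield V (\<lambda>q f. \<Sum>i\<in>I. a i q * X i q f)"
  unfolding smooth_vfield_def
proof (intro conjI ballI allI impI)
  fix p assume "p \<in> V"
  then show "(\<lambda>f. \<Sum>i\<in>I. a i p * X i p f) \<in> tangent_space p"
    by (intro tangent_space_sum smooth_vfield_tangent[OF assms(2)])
next
  fix W f assume W: "open W \<and> W \<subseteq> V \<and> smooth_fun W f"
  then show "smooth_fun W (\<lambda>p. \<Sum>i\<in>I. a i p * X i p f)"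
    by (intro smooth_fun_sum smooth_fun_mult smooth_vfield_smooth_fun[OF assms(2)]
          smooth_fun_subset[OF assms(1), of _ W]) auto
qed

lemma smooth_vfield_scale:
  "smooth_fun V a \<Longrightarrow> smooth_vfield V X \<Longrightarrow> smooth_vfield V (\<lambda>q f. a q * X q f)"
  using smooth_vfield_sum[of "{()}" V "\<lambda>_. a" "\<lambda>_. X"] by simp

lemma smooth_vfield_coord:
  assumes c: "coord_system W \<phi>" and V: "open V" "V \<subseteq> W" and \<xi>: "smooth_on (\<phi> ` V) \<xi>"
  shows "smooth_vfield V (\<lambda>q. chart_vec (W, \<phi>) q (\<xi> (\<phi> q)))"
  unfolding smooth_vfield_def
proof (intro conjI ballI allI impI)
  fix p assume "p \<in> V"
  then show "chart_vec (W, \<phi>) p (\<xi> (\<phi> p)) \<in> tangent_space p"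
    using V by (intro chart_vec_tangent[OF c]) auto
next
  fix N f assume N: "open N \<and> N \<subseteq> V \<and> smooth_fun N f"
  then have NW: "open N" "N \<subseteq> W" using V by auto
  note o = coord_open_image[OF c NW]
  have f: "smooth_on (\<phi> ` N) (f \<circ> inv_into W \<phi>)" using smooth_fun_iff_coord[OF c NW, of f] N by auto
  have "smooth_on (\<phi> ` N) \<xi>" by (rule smooth_on_subset[OF \<xi>]) (use N in auto)
  then have "smooth_on (\<phi> ` N) (\<lambda>z. frechet_derivative (f \<circ> inv_into W \<phi>) (at z) (\<xi> z))"
    by (rule smooth_on_frechet_derivative_along[OF o f])
  then have "smooth_on (\<phi> ` N) ((\<lambda>p. chart_vec (W, \<phi>) p (\<xi> (\<phi> p)) f) \<circ> inv_into W \<phi>)"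
  proof (rule smooth_on_cong)
    fix z assume "z \<in> \<phi> ` N"
    then obtain q where q: "q \<in> N" "z = \<phi> q" by auto
    with N have "smooth_at q f" unfolding smooth_at_def by auto
    then show "frechet_derivative (f \<circ> inv_into W \<phi>) (at z) (\<xi> z) =
        ((\<lambda>p. chart_vec (W, \<phi>) p (\<xi> (\<phi> p)) f) \<circ> inv_into W \<phi>) z"
      using q NW coord_systemD(8)[OF c] by (auto simp: chart_vec_apply)
  qed
  then show "smooth_fun N (\<lambda>p. chart_vec (W, \<phi>) p (\<xi> (\<phi> p)) f)"
    using smooth_fun_iff_coord[OF c NW] by simp
qed

lemma smooth_vfield_component:
  assumes c: "coord_system W \<phi>" and V: "open V" "V \<subseteq> W" and X: "smooth_vfield V X"
  shows "smooth_fun V (\<lambda>q. X q (\<lambda>q. \<phi> q $ i))"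
  using smooth_vfield_smooth_fun[OF X V(1) order_refl smooth_fun_subset[OF coord_smooth_fun[OF c] V(2)]] .

lemma smooth_fun_continuous:
  assumes V: "open V" and f: "smooth_fun V f"
  shows "continuous_on V f"
proof (rule continuous_at_imp_continuous_on, rule ballI)
  fix p assume p: "p \<in> V"
  obtain U x where U: "(U, x) \<in> A" "p \<in> U" by (rule chart_at)
  note c = chart_coord_system[OF U(1)]
  have VU: "open (U \<inter> V)" "U \<inter> V \<subseteq> U" using V coord_systemD(1)[OF c] by auto
  have "continuous_on (x ` (U \<inter> V)) (f \<circ> inv_into U x)"
    using smooth_fun_iff_coord[OF c VU, of f] smooth_fun_subset[OF f, of "U \<inter> V"] by (intro smooth_on_continuous) auto
  from continuous_on_compose[OF continuous_on_subset[OF coord_systemD(4)[OF c] VU(2)] this]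
  have "continuous_on (U \<inter> V) f"
    by (rule continuous_on_eq) (use coord_systemD(8)[OF c] in auto)
  then show "isCont f p" using VU p U continuous_on_eq_continuous_at by blast
qed

end

section \<open>Minkowski algebra\<close>

definition mink_inner :: "real^4 \<Rightarrow> real^4 \<Rightarrow> real" where
  "mink_inner u v = (\<Sum>i\<in>spatial. u $ i * v $ i) - u $ 0 * v $ 0"

lemma mink_inner_expand:
  "mink_inner u v = u $ 1 * v $ 1 + u $ 2 * v $ 2 + u $ 3 * v $ 3 - u $ 0 * v $ 0"
  unfolding mink_inner_def spatial_def by simp

lemma index_4_eq_0: "(4 :: 4) = 0"
  by (simp add: eq_numeral_iff_iszero)

lemma sum_4_0: "(\<Sum>\<mu>\<in>(UNIV :: 4 set). f \<mu>) = f 1 + f 2 + f 3 + f 0"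
  by (simp only: sum_4 index_4_eq_0)

lemma mink_inner_eq_sum: "(\<Sum>\<mu>\<in>UNIV. \<Sum>\<nu>\<in>UNIV. u $ \<mu> * v $ \<nu> * mink \<mu> \<nu>) = mink_inner u v"
  by (simp add: sum_4_0 mink_def mink_inner_expand)

lemma mink_inner_sym: "mink_inner u v = mink_inner v u"
  by (simp add: mink_inner_expand mult.commute)

lemma bounded_bilinear_mink_inner: "bounded_bilinear mink_inner"
  unfolding bilinear_conv_bounded_bilinear[symmetric] bilinear_def
  by (auto intro!: linearI simp: mink_inner_expand algebra_simps)

lemmas mink_inner_linear =
  bounded_bilinear.add_left[OF bounded_bilinear_mink_inner]
  bounded_bilinear.add_right[OF bounded_bilinear_mink_inner]
  bounded_bilinear.diff_left[OF bounded_bilinear_mink_inner]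
  bounded_bilinear.diff_right[OF bounded_bilinear_mink_inner]
  bounded_bilinear.scaleR_left[OF bounded_bilinear_mink_inner]
  bounded_bilinear.scaleR_right[OF bounded_bilinear_mink_inner]

lemma mink_radius_eq: "mink_radius y = sqrt (- mink_inner y y)"
  unfolding mink_radius_def mink_inner_def by (simp add: power2_eq_square)

definition timelike_cone :: "(real^4) set" where
  "timelike_cone = {y. 0 < y $ 0 \<and> mink_inner y y < 0}"

lemma H1_eq: "H1 = {V. 0 < V $ 0 \<and> mink_inner V V = -1}"
  unfolding H1_def mink_inner_def by (auto simp: power2_eq_square)

lemma mink_radius_pos: "y \<in> timelike_cone \<Longrightarrow> mink_radius y > 0"
  unfolding mink_radius_eq timelike_cone_def by simp

lemma mink_radius_sq: "y \<in> timelike_cone \<Longrightarrow> mink_inner y y = - (mink_radius y * mink_radius y)"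
  unfolding mink_radius_eq timelike_cone_def by simp

lemma scaled_H1:
  assumes "V \<in> H1" "\<rho> > 0"
  shows "\<rho> *\<^sub>R V \<in> timelike_cone" "mink_radius (\<rho> *\<^sub>R V) = \<rho>"
  using assms by (auto simp: H1_eq timelike_cone_def mink_radius_eq mink_inner_linear real_sqrt_mult)

lemma unit_timelike_H1: "y \<in> timelike_cone \<Longrightarrow> y /\<^sub>R mink_radius y \<in> H1"
proof -
  assume y: "y \<in> timelike_cone"
  have "inverse (mink_radius y) * (inverse (mink_radius y) * (mink_radius y * mink_radius y)) = 1"
    using mink_radius_pos[OF y] by (simp add: field_simps)
  then show ?thesis
    using mink_radius_pos[OF y] mink_radius_sq[OF y] y
    by (auto simp: H1_eq timelike_cone_def mink_inner_linear)
qed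

lemma open_timelike_cone: "open timelike_cone"
  unfolding timelike_cone_def
  by (intro open_Collect_conj open_Collect_less bounded_bilinear.continuous_on[OF bounded_bilinear_mink_inner]
       continuous_intros)

lemma mink_radius_has_derivative:
  assumes y: "y \<in> timelike_cone"
  shows "(mink_radius has_derivative (\<lambda>v. - mink_inner y v / mink_radius y)) (at y)"
proof -
  have 1: "((\<lambda>y. - mink_inner y y) has_derivative (\<lambda>v. - (mink_inner y v + mink_inner v y))) (at y)"
    by (intro has_derivative_minus bounded_bilinear.FDERIV[OF bounded_bilinear_mink_inner] has_derivative_ident)
  have pos: "- mink_inner y y > 0" using y by (simp add: timelike_cone_def)
  have "(sqrt has_derivative (\<lambda>v. inverse (sqrt (- mink_inner y y)) / 2 * v)) (at (- mink_inner y y))"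
    using DERIV_real_sqrt[OF pos] unfolding has_field_derivative_def .
  from has_derivative_compose[OF 1 this]
  have "(mink_radius has_derivative
      (\<lambda>v. inverse (sqrt (- mink_inner y y)) / 2 * - (mink_inner y v + mink_inner v y))) (at y)"
    by (simp only: mink_radius_eq[abs_def])
  then show ?thesis
  proof (rule has_derivative_eq_rhs, intro ext)
    fix v
    show "inverse (sqrt (- mink_inner y y)) / 2 * - (mink_inner y v + mink_inner v y) =
        - mink_inner y v / mink_radius y"
      unfolding mink_inner_sym[of v y] mink_radius_eq by (simp add: field_simps)
  qed
qed

lemma smooth_on_mink_radius: "smooth_on timelike_cone mink_radius"
proof -
  have "smooth_on timelike_cone (\<lambda>y. sqrt (- mink_inner y y))"
  proof (rule smooth_on_compose[of "{0<..}" sqrt])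
    show "smooth_on {0<..} sqrt" using Ck_on_sqrt by (intro smooth_onI_open) auto
    have "smooth_on timelike_cone (\<lambda>y. mink_inner y y)"
      by (intro smooth_on_bilinear[OF bounded_bilinear_mink_inner] smooth_on_linear linear_ident)
    from smooth_on_mult[OF smooth_on_const[of _ "-1"] this]
    show "smooth_on timelike_cone (\<lambda>y. - mink_inner y y)" by simp
  qed (auto simp: timelike_cone_def)
  then show ?thesis by (simp add: mink_radius_eq[abs_def])
qed

lemma smooth_on_unit_timelike: "smooth_on timelike_cone (\<lambda>y. y /\<^sub>R mink_radius y)"
proof (rule smooth_on_scaleR[OF _ smooth_on_linear[OF linear_ident]])
  show "smooth_on timelike_cone (\<lambda>y. inverse (mink_radius y))"
  proof (rule smooth_on_compose[of "{0<..}" inverse])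
    show "smooth_on {0<..} (inverse :: real \<Rightarrow> real)" using Ck_on_inverse by (intro smooth_onI_open) auto
  qed (auto simp: mink_radius_pos smooth_on_mink_radius)
qed

lemma unit_timelike_has_derivative:
  assumes y: "y \<in> timelike_cone"
  shows "((\<lambda>y. y /\<^sub>R mink_radius y) has_derivative
    (\<lambda>v. v /\<^sub>R mink_radius y + (mink_inner y v / mink_radius y ^ 3) *\<^sub>R y)) (at y)"
proof -
  have "((\<lambda>y. y /\<^sub>R mink_radius y) has_derivative
     (\<lambda>v. inverse (mink_radius y) *\<^sub>R v +
        (- (inverse (mink_radius y) * (- mink_inner y v / mink_radius y) * inverse (mink_radius y))) *\<^sub>R y)) (at y)"
    by (rule has_derivative_scaleR[OF Deriv.has_derivative_inverse[OF _ mink_radius_has_derivative[OF y]]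
          has_derivative_ident]) (use mink_radius_pos[OF y] in simp)
  then show ?thesis
    by (rule has_derivative_eq_rhs) (use mink_radius_pos[OF y] in \<open>auto simp: field_simps power3_eq_cube\<close>)
qed

definition so31 :: "(real^4 \<Rightarrow> real^4) set" where
  "so31 = {M. linear M \<and> (\<forall>y. mink_inner (M y) y = 0)}"

lemma flat_boost_so31: "i \<in> spatial \<Longrightarrow> flat_boost i \<in> so31"
  unfolding so31_def spatial_def
  by (auto intro!: linearI simp: flat_boost_def mink_inner_expand axis_def algebra_simps scaleR_add_left)

lemma so31_skew:
  assumes "M \<in> so31"
  shows "mink_inner (M y) z = - mink_inner (M z) y"
proof -
  have lin: "linear M" and sk: "\<And>y. mink_inner (M y) y = 0" using assms by (auto simp: so31_def)
  from sk[of "y + z"] show ?thesis by (simp add: linear_add[OF lin] mink_inner_linear sk)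
qed

lemma so31_commutator:
  assumes M: "M \<in> so31" and N: "N \<in> so31"
  shows "(\<lambda>y. N (M y) - M (N y)) \<in> so31"
proof -
  have "linear M" "linear N" using M N by (auto simp: so31_def)
  then have "linear (\<lambda>y. N (M y) - M (N y))"
    by (intro linear_compose_sub) (auto intro: linear_compose[unfolded o_def])
  moreover have "mink_inner (N (M y) - M (N y)) y = 0" for y
    using so31_skew[OF N, of "M y" y] so31_skew[OF M, of "N y" y]
    by (simp add: mink_inner_linear mink_inner_sym)
  ultimately show ?thesis by (simp add: so31_def)
qed

text \<open>At a timelike point \<open>y\<close> the \<open>so31\<close> fields sweep out the orthogonal complement of \<open>y\<close>: a vector \<open>u\<close>
orthogonal to \<open>y\<close> is the image of \<open>y\<close> under the infinitesimal Lorentz transformation of the plane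
spanned by \<open>u\<close> and \<open>y\<close>.\<close>

lemma radial_plus_so31:
  assumes y: "y \<in> timelike_cone"
  obtains a M where "M \<in> so31" "w = a *\<^sub>R y + M y"
proof -
  define q where "q = mink_inner y y"
  have q: "q < 0" using y by (simp add: q_def timelike_cone_def)
  define a where "a = mink_inner w y / q"
  define u where "u = w - a *\<^sub>R y"
  define M where "M = (\<lambda>z. (mink_inner y z / q) *\<^sub>R u - (mink_inner u z / q) *\<^sub>R y)"
  have u: "mink_inner u y = 0" using q by (simp add: u_def a_def mink_inner_linear q_def)
  have "linear M"
    unfolding M_def by (auto intro!: linearI simp: mink_inner_linear algebra_simps add_divide_distrib scaleR_add_left)
  moreover have "mink_inner (M z) z = 0" for z by (simp add: M_def mink_inner_linear)
  ultimately have "M \<in> so31" by (simp add: so31_def)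
  moreover have "w = a *\<^sub>R y + M y" using q u by (simp add: M_def u_def q_def[symmetric])
  ultimately show thesis by (rule that)
qed


section \<open>Growth estimates for curves\<close>

text \<open>The function \<open>(norm (w t))\<^sup>2 * exp (- 2 * L * (t - a))\<close> is nonincreasing.\<close>

lemma gronwall_forward:
  fixes w :: "real \<Rightarrow> 'b::euclidean_space"
  assumes ab: "a \<le> b"
    and w: "\<And>t. t \<in> {a..b} \<Longrightarrow> (w has_vector_derivative w' t) (at t)"
    and L: "\<And>t. t \<in> {a..b} \<Longrightarrow> norm (w' t) \<le> L * norm (w t)"
  shows "norm (w b) \<le> exp (L * (b - a)) * norm (w a)"
proof -
  define h where "h t = (w t \<bullet> w t) * exp (- 2 * L * (t - a))" for t
  have "h b \<le> h a"
  proof (rule DERIV_nonpos_imp_nonincreasing[OF ab])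
    fix t assume "a \<le> t" "t \<le> b"
    then have t: "t \<in> {a..b}" by simp
    have 1: "((\<lambda>t. w t \<bullet> w t) has_real_derivative 2 * (w t \<bullet> w' t)) (at t)"
      using bounded_bilinear.has_vector_derivative[OF bounded_bilinear_inner w[OF t] w[OF t]]
      by (simp add: has_real_derivative_iff_has_vector_derivative inner_commute)
    have "(h has_real_derivative (2 * (w t \<bullet> w' t) - 2 * L * (w t \<bullet> w t)) * exp (- 2 * L * (t - a))) (at t)"
      unfolding h_def by (auto intro!: derivative_eq_intros 1 simp: algebra_simps)
    moreover have "w t \<bullet> w' t \<le> L * (w t \<bullet> w t)"
    proof -
      have "w t \<bullet> w' t \<le> norm (w t) * norm (w' t)" by (rule norm_cauchy_schwarz)
      also have "\<dots> \<le> norm (w t) * (L * norm (w t))" using L[OF t] by (intro mult_left_mono) auto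
      finally show ?thesis by (simp add: power2_norm_eq_inner[symmetric] power2_eq_square mult_ac)
    qed
    ultimately show "\<exists>y. DERIV h t :> y \<and> y \<le> 0"
      by (intro exI[of _ "(2 * (w t \<bullet> w' t) - 2 * L * (w t \<bullet> w t)) * exp (- 2 * L * (t - a))"])
        (auto intro: mult_nonpos_nonneg)
  qed
  then have "(norm (w b))\<^sup>2 * exp (- 2 * L * (b - a)) \<le> (norm (w a))\<^sup>2"
    by (simp add: h_def power2_norm_eq_inner)
  then have "(norm (w b))\<^sup>2 * exp (- 2 * L * (b - a)) * exp (2 * L * (b - a)) \<le> (norm (w a))\<^sup>2 * exp (2 * L * (b - a))"
    by (intro mult_right_mono) auto
  also have "(norm (w b))\<^sup>2 * exp (- 2 * L * (b - a)) * exp (2 * L * (b - a)) = (norm (w b))\<^sup>2"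
    by (simp add: mult.assoc exp_add[symmetric])
  also have "(norm (w a))\<^sup>2 * exp (2 * L * (b - a)) = (exp (L * (b - a)) * norm (w a))\<^sup>2"
    by (simp add: power_mult_distrib exp_double[symmetric] mult_ac)
  finally show ?thesis by (rule power2_le_imp_le) simp
qed

lemma gronwall_backward:
  fixes w :: "real \<Rightarrow> 'b::euclidean_space"
  assumes ab: "a \<le> b"
    and w: "\<And>t. t \<in> {a..b} \<Longrightarrow> (w has_vector_derivative w' t) (at t)"
    and L: "\<And>t. t \<in> {a..b} \<Longrightarrow> norm (w' t) \<le> L * norm (w t)"
  shows "norm (w a) \<le> exp (L * (b - a)) * norm (w b)"
proof -
  have "norm ((\<lambda>t. w (- t)) (- a)) \<le> exp (L * (- a - - b)) * norm ((\<lambda>t. w (- t)) (- b))"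
  proof (rule gronwall_forward[where w'="\<lambda>t. - w' (- t)"])
    fix t assume t: "t \<in> {- b..- a}"
    then have "- t \<in> {a..b}" by auto
    have "(uminus has_vector_derivative (- 1)) (at t)"
      by (auto intro!: derivative_eq_intros)
    from vector_diff_chain_at[OF this w[OF \<open>- t \<in> {a..b}\<close>]]
    show "((\<lambda>t. w (- t)) has_vector_derivative - w' (- t)) (at t)" by (simp add: o_def)
    show "norm (- w' (- t)) \<le> L * norm (w (- t))" using L[OF \<open>- t \<in> {a..b}\<close>] by simp
  qed (use ab in simp)
  then show ?thesis by simp
qed

lemma C1_lipschitz_on_compact_convex:
  assumes f: "Ck_on 1 W f" and C: "compact C" "convex C" "C \<subseteq> W"
  obtains L where "L \<ge> 0" "\<And>x y. x \<in> C \<Longrightarrow> y \<in> C \<Longrightarrow> norm (f x - f y) \<le> L * norm (x - y)"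
proof -
  have D: "(f has_derivative frechet_derivative f (at x)) (at x)" if "x \<in> W" for x
    using f that frechet_derivative_works by auto
  have "\<exists>B. \<forall>x\<in>C. norm (frechet_derivative f (at x) b) \<le> B" for b
  proof -
    have "continuous_on C (\<lambda>x. frechet_derivative f (at x) b)"
      using f C by (auto intro: continuous_on_subset)
    then have "compact ((\<lambda>x. frechet_derivative f (at x) b) ` C)" using C by (intro compact_continuous_image)
    then show ?thesis using compact_imp_bounded by (fastforce simp: bounded_iff)
  qed
  then obtain B where B: "\<And>b x. x \<in> C \<Longrightarrow> norm (frechet_derivative f (at x) b) \<le> B b" by metis
  define L where "L = (\<Sum>b\<in>Basis. \<bar>B b\<bar>)"
  have "norm (f x - f y) \<le> L * norm (x - y)" if "x \<in> C" "y \<in> C" for x y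
  proof (rule differentiable_bound[OF C(2) _ _ that])
    fix z assume z: "z \<in> C"
    then show "(f has_derivative frechet_derivative f (at z)) (at z within C)"
      using D[of z] C(3) by (auto intro: has_derivative_at_withinI)
    show "onorm (frechet_derivative f (at z)) \<le> L"
    proof (rule onorm_le)
      fix v
      have "norm (frechet_derivative f (at z) v) = norm (\<Sum>b\<in>Basis. (v \<bullet> b) *\<^sub>R frechet_derivative f (at z) b)"
        using z C by (subst linear_Basis_expansion[OF has_derivative_linear[OF D]]) auto
      also have "\<dots> \<le> (\<Sum>b\<in>Basis. norm v * \<bar>B b\<bar>)"
        using B[OF z] by (intro sum_norm_le) (auto intro!: mult_mono Basis_le_norm order_trans[OF B[OF z] abs_ge_self])
      finally show "norm (frechet_derivative f (at z) v) \<le> L * norm v"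
        by (simp add: L_def sum_distrib_left mult.commute)
    qed
  qed
  moreover have "L \<ge> 0" by (simp add: L_def sum_nonneg)
  ultimately show thesis using that by blast
qed

lemma mean_value_vector:
  fixes c :: "real \<Rightarrow> 'b::euclidean_space"
  assumes "\<And>s. s \<in> {0..t} \<Longrightarrow> (c has_vector_derivative c' s) (at s)"
    and "\<And>s. s \<in> {0..t} \<Longrightarrow> norm (c' s) \<le> B" and "0 \<le> t"
  shows "norm (c t - c 0) \<le> B * t"
proof -
  have "norm (c t - c 0) \<le> B * norm (t - 0)"
  proof (rule differentiable_bound[of "{0..t}"])
    fix s assume s: "s \<in> {0..t}"
    show "(c has_derivative (\<lambda>h. h *\<^sub>R c' s)) (at s within {0..t})"
      using assms(1)[OF s] unfolding has_vector_derivative_def by (rule has_derivative_at_withinI)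
    show "onorm (\<lambda>h. h *\<^sub>R c' s) \<le> B"
      by (rule onorm_le) (use mult_right_mono[OF assms(2)[OF s] abs_ge_zero] in \<open>auto simp: mult.commute\<close>)
  qed (use assms(3) in auto)
  then show ?thesis using assms(3) by simp
qed

lemma tendsto_difference_quotient_norm:
  fixes f :: "real \<Rightarrow> 'b::real_normed_vector"
  assumes "(f has_vector_derivative f') (at 0)"
  shows "((\<lambda>s. norm (f s - f 0) / \<bar>s\<bar>) \<longlongrightarrow> norm f') (at 0)"
proof (rule LIM_zero_cancel, rule Lim_null_comparison)
  show "((\<lambda>s. norm (f s - f 0 - s *\<^sub>R f') / \<bar>s\<bar>) \<longlongrightarrow> 0) (at 0)"
    using assms unfolding has_vector_derivative_def has_derivative_iff_norm by simp
  have "norm (norm (f s - f 0) / \<bar>s\<bar> - norm f') \<le> norm (f s - f 0 - s *\<^sub>R f') / \<bar>s\<bar>" if "s \<noteq> 0" for s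
  proof -
    have "norm (f s - f 0) / \<bar>s\<bar> - norm f' = (norm (f s - f 0) - norm (s *\<^sub>R f')) / \<bar>s\<bar>"
      using that by (simp add: field_simps)
    then show ?thesis using norm_triangle_ineq3[of "f s - f 0" "s *\<^sub>R f'"]
      by (simp add: abs_divide divide_right_mono)
  qed
  then show "\<forall>\<^sub>F s in at 0. norm (norm (f s - f 0) / \<bar>s\<bar> - norm f') \<le> norm (f s - f 0 - s *\<^sub>R f') / \<bar>s\<bar>"
    by (intro eventually_at_filter[THEN iffD2] always_eventually) auto
qed

text \<open>This turns a Lipschitz estimate along a curve of parameters into a bound on the derivative along
this curve.\<close>

lemma vector_derivative_norm_le:
  fixes f :: "real \<Rightarrow> 'b::real_normed_vector" and h :: "real \<Rightarrow> 'c::real_normed_vector"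
  assumes f: "(f has_vector_derivative f') (at 0)" and h: "(h has_vector_derivative h') (at 0)"
    and le: "eventually (\<lambda>s. norm (f s - f 0) \<le> k * norm (h s - h 0)) (at 0)"
  shows "norm f' \<le> k * norm h'"
proof (rule tendsto_le[of "at (0::real)"])
  show "((\<lambda>s. k * (norm (h s - h 0) / \<bar>s\<bar>)) \<longlongrightarrow> k * norm h') (at 0)"
    by (intro tendsto_mult_left tendsto_difference_quotient_norm h)
  show "((\<lambda>s. norm (f s - f 0) / \<bar>s\<bar>) \<longlongrightarrow> norm f') (at 0)"
    by (rule tendsto_difference_quotient_norm[OF f])
  show "\<forall>\<^sub>F s in at 0. norm (f s - f 0) / \<bar>s\<bar> \<le> k * (norm (h s - h 0) / \<bar>s\<bar>)"
    using le by eventually_elim (simp add: divide_right_mono)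
qed simp

section \<open>Vector fields in coordinates\<close>

lemma axis_expansion: "(\<Sum>i\<in>UNIV. \<xi> $ i *\<^sub>R axis i 1) = (\<xi> :: real ^ 'n)"
  using basis_expansion[of \<xi>] by (simp add: scalar_mult_eq_scaleR)

context smooth_manifold
begin

lemma smooth_fun_coord:
  assumes c: "coord_system W \<phi>" and V: "open V" "V \<subseteq> W"
    and F: "smooth_on (\<phi> ` V) F" and f: "\<And>q. q \<in> V \<Longrightarrow> f q = F (\<phi> q)"
  shows "smooth_fun V f"
proof -
  have "smooth_on (\<phi> ` V) (f \<circ> inv_into W \<phi>)"
    by (rule smooth_on_cong[OF F]) (use V f coord_systemD(8)[OF c] in \<open>auto simp: subset_iff\<close>)
  then show ?thesis using smooth_fun_iff_coord[OF c V] by simp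
qed

lemma chart_vec_fun:
  assumes c: "coord_system W \<phi>" and V: "open V" "V \<subseteq> W" and p: "p \<in> V"
    and F: "smooth_on (\<phi> ` V) F" and f: "\<And>q. q \<in> V \<Longrightarrow> f q = F (\<phi> q)"
  shows "chart_vec (W, \<phi>) p w f = frechet_derivative F (at (\<phi> p)) w"
proof -
  have "smooth_at p f"
    unfolding smooth_at_def using smooth_fun_coord[OF c V F f] V p by auto
  moreover have "frechet_derivative (f \<circ> inv_into W \<phi>) (at (\<phi> p)) = frechet_derivative F (at (\<phi> p))"
    by (rule frechet_derivative_cong_open[OF coord_open_image[OF c V]])
      (use V f p coord_systemD(8)[OF c] in \<open>auto simp: subset_iff\<close>)
  ultimately show ?thesis by (simp add: chart_vec_apply)
qed

lemma smooth_vfield_coordI: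
  assumes "coord_system W \<phi>" "open V" "V \<subseteq> W" "smooth_on (\<phi> ` V) \<xi>"
    and "\<And>q. q \<in> V \<Longrightarrow> X q = chart_vec (W, \<phi>) q (\<xi> (\<phi> q))"
  shows "smooth_vfield V X"
  by (rule smooth_vfield_cong[OF smooth_vfield_coord[OF assms(1-4)]]) (simp add: assms(5))

text \<open>The first derivatives of a coordinate function in its own coordinates are constant, so only
derivatives of the components of the two fields remain.\<close>

lemma bracket_coord_component:
  assumes c: "coord_system W \<phi>" and V: "open V" "V \<subseteq> W" and p: "p \<in> V"
    and \<xi>: "smooth_on (\<phi> ` V) \<xi>" and X: "\<And>q. q \<in> V \<Longrightarrow> X q = chart_vec (W, \<phi>) q (\<xi> (\<phi> q))"
    and \<eta>: "smooth_on (\<phi> ` V) \<eta>" and Y: "\<And>q. q \<in> V \<Longrightarrow> Y q = chart_vec (W, \<phi>) q (\<eta> (\<phi> q))"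
  shows "bracket X Y p (\<lambda>q. \<phi> q $ i) =
    (frechet_derivative \<eta> (at (\<phi> p)) (\<xi> (\<phi> p)) - frechet_derivative \<xi> (at (\<phi> p)) (\<eta> (\<phi> p))) $ i"
proof -
  have pW: "p \<in> W" using V p by auto
  have *: "X p (\<lambda>q. Y q (\<lambda>q. \<phi> q $ i)) = frechet_derivative \<eta> (at (\<phi> p)) (\<xi> (\<phi> p)) $ i"
    if \<eta>: "smooth_on (\<phi> ` V) \<eta>" and X: "\<And>q. q \<in> V \<Longrightarrow> X q = chart_vec (W, \<phi>) q (\<xi> (\<phi> q))"
      and Y: "\<And>q. q \<in> V \<Longrightarrow> Y q = chart_vec (W, \<phi>) q (\<eta> (\<phi> q))" for X Y \<xi> \<eta>
  proof -
    have "X p (\<lambda>q. Y q (\<lambda>q. \<phi> q $ i)) = frechet_derivative (\<lambda>z. \<eta> z $ i) (at (\<phi> p)) (\<xi> (\<phi> p))"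
      unfolding X[OF p]
      by (rule chart_vec_fun[OF c V p smooth_on_nth[OF \<eta>]])
        (use Y chart_vec_coord[OF c] V in \<open>auto simp: subset_iff\<close>)
    also have "frechet_derivative (\<lambda>z. \<eta> z $ i) (at (\<phi> p)) = (\<lambda>w. frechet_derivative \<eta> (at (\<phi> p)) w $ i)"
      by (rule frechet_derivative_at[symmetric], rule bounded_linear.has_derivative[OF bounded_linear_vec_nth],
          rule smooth_on_has_derivative[OF coord_open_image[OF c V] \<eta>]) (use p in auto)
    finally show ?thesis .
  qed
  show ?thesis
    using coord_smooth_at[OF c pW] *[OF \<eta> X Y] *[OF \<xi> Y X] by (simp add: bracket_def germ_def)
qed

end


section \<open>The metric and the connection\<close>

context spacetime
begin

lemma metric_sym: "u \<in> tangent_space p \<Longrightarrow> v \<in> tangent_space p \<Longrightarrow> g p u v = g p v u"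
  using metric unfolding lorentz_metric_def by auto

lemma metric_lincomb:
  "u \<in> tangent_space p \<Longrightarrow> v \<in> tangent_space p \<Longrightarrow> w \<in> tangent_space p \<Longrightarrow>
   g p (\<lambda>f. a * u f + b * v f) w = a * g p u w + b * g p v w"
  using metric unfolding lorentz_metric_def by auto

lemma metric_smooth:
  "open U \<Longrightarrow> smooth_vfield U X \<Longrightarrow> smooth_vfield U Y \<Longrightarrow> smooth_fun U (\<lambda>p. g p (X p) (Y p))"
  using metric unfolding lorentz_metric_def by auto

lemma metric_frame: obtains b where "\<And>\<mu>. b \<mu> \<in> tangent_space p" "\<And>\<mu> \<nu>. g p (b \<mu>) (b \<nu>) = mink \<mu> \<nu>"
proof -
  have "\<exists>b. (\<forall>\<mu>. b \<mu> \<in> tangent_space p) \<and> (\<forall>\<mu> \<nu>. g p (b \<mu>) (b \<nu>) = mink \<mu> \<nu>)"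
    using metric unfolding lorentz_metric_def by auto
  then show thesis using that by auto
qed

lemma metric_linear:
  assumes c: "coord_system W \<phi>" and p: "p \<in> W" and v: "v \<in> tangent_space p"
  shows "linear (\<lambda>\<xi>. g p (chart_vec (W, \<phi>) p \<xi>) v)"
proof -
  note T = chart_vec_tangent[OF c p]
  have "chart_vec (W, \<phi>) p (\<xi> + \<eta>) = (\<lambda>f. 1 * chart_vec (W, \<phi>) p \<xi> f + 1 * chart_vec (W, \<phi>) p \<eta> f)" for \<xi> \<eta>
    using linear_add[OF linear_chart_vec[OF c p]] by auto
  moreover have "chart_vec (W, \<phi>) p (a *\<^sub>R \<xi>) = (\<lambda>f. a * chart_vec (W, \<phi>) p \<xi> f + 0 * chart_vec (W, \<phi>) p \<xi> f)" for a \<xi>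
    using linear_scale[OF linear_chart_vec[OF c p]] by auto
  ultimately show ?thesis
    by (intro linearI) (simp_all only: metric_lincomb[OF T T v], simp_all)
qed

lemma metric_linear_right:
  assumes c: "coord_system W \<phi>" and p: "p \<in> W" and v: "v \<in> tangent_space p"
  shows "linear (\<lambda>\<xi>. g p v (chart_vec (W, \<phi>) p \<xi>))"
  using metric_linear[OF assms] metric_sym[OF chart_vec_tangent[OF c p] v] by simp

lemma metric_components:
  assumes c: "coord_system W \<phi>" and p: "p \<in> W"
  shows "g p (chart_vec (W, \<phi>) p \<xi>) (chart_vec (W, \<phi>) p \<eta>) =
    (\<Sum>i\<in>UNIV. \<Sum>j\<in>UNIV. \<xi> $ i * \<eta> $ j * g p (chart_vec (W, \<phi>) p (axis i 1)) (chart_vec (W, \<phi>) p (axis j 1)))"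
proof -
  note T = chart_vec_tangent[OF c p]
  note l = metric_linear[OF c p T] and r = metric_linear_right[OF c p T]
  have "g p (chart_vec (W, \<phi>) p \<xi>) (chart_vec (W, \<phi>) p \<eta>) =
      g p (chart_vec (W, \<phi>) p (\<Sum>i\<in>UNIV. \<xi> $ i *\<^sub>R axis i 1)) (chart_vec (W, \<phi>) p \<eta>)"
    by (simp only: axis_expansion)
  also have "\<dots> = (\<Sum>i\<in>UNIV. \<xi> $ i * g p (chart_vec (W, \<phi>) p (axis i 1)) (chart_vec (W, \<phi>) p \<eta>))"
    by (simp add: linear_sum[OF l] linear_scale[OF l])
  also have "\<dots> = (\<Sum>i\<in>UNIV. \<xi> $ i * g p (chart_vec (W, \<phi>) p (axis i 1)) (chart_vec (W, \<phi>) p (\<Sum>j\<in>UNIV. \<eta> $ j *\<^sub>R axis j 1)))"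
    by (simp only: axis_expansion)
  also have "\<dots> = (\<Sum>i\<in>UNIV. \<xi> $ i * (\<Sum>j\<in>UNIV. \<eta> $ j * g p (chart_vec (W, \<phi>) p (axis i 1)) (chart_vec (W, \<phi>) p (axis j 1))))"
    by (simp add: linear_sum[OF r] linear_scale[OF r])
  finally show ?thesis by (simp add: sum_distrib_left mult.assoc)
qed

lemma metric_zero:
  assumes v: "v \<in> tangent_space p"
  shows "g p (\<lambda>f. 0) v = 0" "g p v (\<lambda>f. 0) = 0"
proof -
  obtain U x where U: "(U, x) \<in> A" "p \<in> U" by (rule chart_at)
  note c = chart_coord_system[OF U(1)]
  show "g p (\<lambda>f. 0) v = 0" "g p v (\<lambda>f. 0) = 0"
    using linear_0[OF metric_linear[OF c U(2) v]] linear_0[OF metric_linear_right[OF c U(2) v]]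
    by (simp_all add: chart_vec_0[OF c U(2)])
qed

text \<open>An orthonormal quadruple is linearly independent, hence a basis of the four-dimensional
  tangent space; a vector orthogonal to everything has vanishing coefficients in it.\<close>

lemma metric_nondegenerate:
  assumes u: "u \<in> tangent_space p" and orth: "\<And>w. w \<in> tangent_space p \<Longrightarrow> g p u w = 0"
  shows "u = (\<lambda>f. 0)"
proof -
  obtain U x where U: "(U, x) \<in> A" "p \<in> U" by (rule chart_at)
  note c = chart_coord_system[OF U(1)]
  obtain b where b: "\<And>\<mu>. b \<mu> \<in> tangent_space p" "\<And>\<mu> \<nu>. g p (b \<mu>) (b \<nu>) = mink \<mu> \<nu>"
    using metric_frame[of p] by blast
  define \<beta> where "\<beta> \<mu> = (\<chi> i. b \<mu> (\<lambda>q. x q $ i))" for \<mu>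
  have b_eq: "chart_vec (U, x) p (\<beta> \<mu>) = b \<mu>" for \<mu>
    using tangent_eq_chart_vec[OF c U(2) b(1)] unfolding \<beta>_def by simp
  have coeff: "g p (chart_vec (U, x) p (\<Sum>\<mu>\<in>UNIV. a \<mu> *\<^sub>R \<beta> \<mu>)) (b \<nu>) = a \<nu> * mink \<nu> \<nu>" for a \<nu>
  proof -
    note l = metric_linear[OF c U(2) b(1)]
    have "g p (chart_vec (U, x) p (\<Sum>\<mu>\<in>UNIV. a \<mu> *\<^sub>R \<beta> \<mu>)) (b \<nu>) = (\<Sum>\<mu>\<in>UNIV. a \<mu> * mink \<mu> \<nu>)"
      by (simp add: linear_sum[OF l] linear_scale[OF l] b_eq b(2))
    also have "\<dots> = (\<Sum>\<mu>\<in>UNIV. if \<mu> = \<nu> then a \<nu> * mink \<nu> \<nu> else 0)"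
      by (intro sum.cong) (auto simp: mink_def)
    finally show ?thesis by simp
  qed
  have mink_diag: "mink \<nu> \<nu> \<noteq> 0" for \<nu> by (simp add: mink_def)
  have lin: "linear (\<lambda>a::real^4. \<Sum>\<mu>\<in>UNIV. a $ \<mu> *\<^sub>R \<beta> \<mu>)"
    by (auto intro!: linearI simp: scaleR_add_left sum.distrib scaleR_sum_right)
  have "inj (\<lambda>a::real^4. \<Sum>\<mu>\<in>UNIV. a $ \<mu> *\<^sub>R \<beta> \<mu>)"
    unfolding linear_injective_0[OF lin]
  proof (intro allI impI)
    fix a :: "real^4" assume "(\<Sum>\<mu>\<in>UNIV. a $ \<mu> *\<^sub>R \<beta> \<mu>) = 0"
    then have "a $ \<nu> * mink \<nu> \<nu> = 0" for \<nu>
      using coeff[of "\<lambda>\<mu>. a $ \<mu>" \<nu>] linear_0[OF metric_linear[OF c U(2) b(1)]] by simp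
    then have "a $ \<nu> = 0" for \<nu> by (simp add: mink_diag)
    then show "a = 0" by (simp add: vec_eq_iff)
  qed
  then have "surj (\<lambda>a::real^4. \<Sum>\<mu>\<in>UNIV. a $ \<mu> *\<^sub>R \<beta> \<mu>)"
    using linear_injective_imp_surjective[OF lin] by simp
  from surjD[OF this, of "\<chi> i. u (\<lambda>q. x q $ i)"]
  obtain a :: "real^4" where a: "(\<chi> i. u (\<lambda>q. x q $ i)) = (\<Sum>\<mu>\<in>UNIV. a $ \<mu> *\<^sub>R \<beta> \<mu>)"
    by (elim exE)
  have u_eq: "u = chart_vec (U, x) p (\<Sum>\<mu>\<in>UNIV. a $ \<mu> *\<^sub>R \<beta> \<mu>)"
    using tangent_eq_chart_vec[OF c U(2) u] unfolding a .
  have "a $ \<nu> * mink \<nu> \<nu> = 0" for \<nu>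
    using coeff[of "\<lambda>\<mu>. a $ \<mu>" \<nu>] orth[OF b(1)] u_eq by simp
  then have "a $ \<nu> = 0" for \<nu> by (simp add: mink_diag)
  then have "a = 0" by (simp add: vec_eq_iff)
  then show ?thesis using u_eq chart_vec_0[OF c U(2)] by simp
qed

lemma levi_civitaD:
  assumes "open U" "smooth_vfield U X" "smooth_vfield U Y"
  shows D_smooth: "smooth_vfield U (D X Y)"
    and D_torsion_free: "p \<in> U \<Longrightarrow> (\<lambda>h. D X Y p h - D Y X p h) = bracket X Y p"
    and D_add_left: "p \<in> U \<Longrightarrow> smooth_vfield U Z \<Longrightarrow>
      D (\<lambda>q h. X q h + Y q h) Z p = (\<lambda>h. D X Z p h + D Y Z p h)"
    and D_add_right: "p \<in> U \<Longrightarrow> smooth_vfield U Z \<Longrightarrow>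
      D X (\<lambda>q h. Y q h + Z q h) p = (\<lambda>h. D X Y p h + D X Z p h)"
    and D_scale_left: "p \<in> U \<Longrightarrow> smooth_fun U f \<Longrightarrow> D (\<lambda>q h. f q * X q h) Y p = (\<lambda>h. f p * D X Y p h)"
    and D_scale_right: "p \<in> U \<Longrightarrow> smooth_fun U f \<Longrightarrow>
      D X (\<lambda>q h. f q * Y q h) p = (\<lambda>h. X p f * Y p h + f p * D X Y p h)"
    and D_metric: "p \<in> U \<Longrightarrow> smooth_vfield U Z \<Longrightarrow>
      X p (\<lambda>q. g q (Y q) (Z q)) = g p (D X Y p) (Z p) + g p (Y p) (D X Z p)"
  using connection[unfolded levi_civita_def, rule_format, of U X Y,
      OF conjI[OF assms(1) conjI[OF assms(2) conjI[OF assms(3) conjI]]]] smooth_fun_const[of U 0] assms(2)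
  by blast+

text \<open>The connection acts on fields that are defined globally but smooth only on \<open>U\<close>. That its
  value on \<open>U\<close> ignores what happens outside follows from linearity over functions: a field that
  vanishes on \<open>U\<close> equals its own product with the indicator function of the complement, and this
  function is smooth on \<open>U\<close> and vanishes there.\<close>

lemma D_zero_left:
  assumes U: "open U" "smooth_vfield U Y" "p \<in> U" and Z: "\<And>q. q \<in> U \<Longrightarrow> Z q = (\<lambda>h. 0)"
  shows "smooth_vfield U Z" "D Z Y p = (\<lambda>h. 0)"
proof -
  have "smooth_vfield U (\<lambda>q f. 0)"
    using smooth_vfield_sum[of "{}" U] by simp
  then show sZ: "smooth_vfield U Z" by (rule smooth_vfield_cong) (simp add: Z)
  have f: "smooth_fun U (indicator (- U))"
    by (rule smooth_fun_cong[OF smooth_fun_const[of U 0]]) simp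
  have "(\<lambda>q h. indicator (- U) q * Z q h) = Z"
    by (intro ext) (auto simp: indicator_def Z)
  then show "D Z Y p = (\<lambda>h. 0)"
    using D_scale_left[OF U(1) sZ U(2,3) f] U(3) by simp
qed

lemma D_zero_right:
  assumes U: "open U" "smooth_vfield U X" "p \<in> U" and Z: "\<And>q. q \<in> U \<Longrightarrow> Z q = (\<lambda>h. 0)"
  shows "D X Z p = (\<lambda>h. 0)"
proof -
  note sZ = D_zero_left(1)[of U X p Z, OF U Z]
  have f: "smooth_fun U (indicator (- U))"
    by (rule smooth_fun_cong[OF smooth_fun_const[of U 0]]) simp
  have "(\<lambda>q h. indicator (- U) q * Z q h) = Z"
    by (intro ext) (auto simp: indicator_def Z)
  then show ?thesis
    using D_scale_right[OF U(1,2) sZ U(3) f] U(3) Z[OF U(3)] by simp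
qed

lemma D_local:
  assumes U: "open U" "p \<in> U" and X: "smooth_vfield U X" "\<And>q. q \<in> U \<Longrightarrow> X' q = X q"
    and Y: "smooth_vfield U Y" "\<And>q. q \<in> U \<Longrightarrow> Y' q = Y q"
  shows "D X' Y' p = D X Y p"
proof -
  have sX': "smooth_vfield U X'" by (rule smooth_vfield_cong[OF X(1)]) (simp add: X)
  define Z where "Z = (\<lambda>q h. X' q h - X q h)"
  define Z' where "Z' = (\<lambda>q h. Y' q h - Y q h)"
  have Z: "Z q = (\<lambda>h. 0)" "Z' q = (\<lambda>h. 0)" if "q \<in> U" for q using that X Y by (auto simp: Z_def Z'_def)
  have "D X' Y p = (\<lambda>h. D X Y p h + D Z Y p h)"
    using D_add_left[OF U(1) X(1) D_zero_left(1)[of U Y p Z, OF U(1) Y(1) U(2) Z(1)] U(2) Y(1)] by (simp add: Z_def)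
  then have 1: "D X' Y p = D X Y p" using D_zero_left(2)[of U Y p Z, OF U(1) Y(1) U(2) Z(1)] by simp
  have "D X' Y' p = (\<lambda>h. D X' Y p h + D X' Z' p h)"
    using D_add_right[OF U(1) sX' Y(1) U(2) D_zero_left(1)[of U Y p Z', OF U(1) Y(1) U(2) Z(2)]] by (simp add: Z'_def)
  then show ?thesis using D_zero_right[of U X' p Z', OF U(1) sX' U(2) Z(2)] 1 by simp
qed

lemma D_sum_left:
  assumes U: "open U" "p \<in> U" and I: "finite I" and a: "\<And>i. i \<in> I \<Longrightarrow> smooth_fun U (a i)"
    and X: "\<And>i. i \<in> I \<Longrightarrow> smooth_vfield U (X i)" and Y: "smooth_vfield U Y"
  shows "D (\<lambda>q h. \<Sum>i\<in>I. a i q * X i q h) Y p = (\<lambda>h. \<Sum>i\<in>I. a i p * D (X i) Y p h)"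
  using I a X
proof (induction I)
  case empty
  then show ?case using D_zero_left(2)[OF U(1) Y U(2), of "\<lambda>q h. 0"] by simp
next
  case (insert i I)
  have "D (\<lambda>q h. a i q * X i q h + (\<Sum>i\<in>I. a i q * X i q h)) Y p =
      (\<lambda>h. D (\<lambda>q h. a i q * X i q h) Y p h + D (\<lambda>q h. \<Sum>i\<in>I. a i q * X i q h) Y p h)"
    by (intro D_add_left[OF U(1)] U(2) Y smooth_vfield_scale smooth_vfield_sum insert.prems) auto
  moreover have "D (\<lambda>q h. a i q * X i q h) Y p = (\<lambda>h. a i p * D (X i) Y p h)"
    by (intro D_scale_left[OF U(1)] U Y insert.prems) auto
  ultimately show ?case using insert by simp
qed

lemma D_sum_right:
  assumes U: "open U" "p \<in> U" and I: "finite I" and a: "\<And>i. i \<in> I \<Longrightarrow> smooth_fun U (a i)"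
    and Y: "\<And>i. i \<in> I \<Longrightarrow> smooth_vfield U (Y i)" and X: "smooth_vfield U X"
  shows "D X (\<lambda>q h. \<Sum>i\<in>I. a i q * Y i q h) p = (\<lambda>h. \<Sum>i\<in>I. X p (a i) * Y i p h + a i p * D X (Y i) p h)"
  using I a Y
proof (induction I)
  case empty
  then show ?case using D_zero_right[OF U(1) X U(2), of "\<lambda>q h. 0"] by simp
next
  case (insert i I)
  have "D X (\<lambda>q h. a i q * Y i q h + (\<Sum>i\<in>I. a i q * Y i q h)) p =
      (\<lambda>h. D X (\<lambda>q h. a i q * Y i q h) p h + D X (\<lambda>q h. \<Sum>i\<in>I. a i q * Y i q h) p h)"
    by (intro D_add_right[OF U(1)] U(2) X smooth_vfield_scale smooth_vfield_sum insert.prems) auto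
  moreover have "D X (\<lambda>q h. a i q * Y i q h) p = (\<lambda>h. X p (a i) * Y i p h + a i p * D X (Y i) p h)"
    by (intro D_scale_right[OF U(1)] U X insert.prems) auto
  ultimately show ?case using insert by simp
qed

lemma coord_field_smooth:
  assumes "coord_system W \<phi>"
  shows "smooth_vfield W (\<lambda>q. chart_vec (W, \<phi>) q w)"
  using smooth_vfield_coord[OF assms coord_systemD(1)[OF assms] order_refl smooth_on_const] .

lemma christoffel_smooth:
  assumes U: "(U, x) \<in> A"
  shows "smooth_fun U (\<lambda>p. christoffel D (U, x) p \<alpha> \<beta> \<gamma>)"
proof -
  note c = chart_coord_system[OF U] and o = coord_systemD(1)[OF chart_coord_system[OF U]]
  show ?thesis
    unfolding christoffel_def snd_conv
    by (rule smooth_vfield_component[OF c o order_refl D_smooth[OF o coord_field_smooth[OF c] coord_field_smooth[OF c]]])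
qed

text \<open>Both fields agree on \<open>V\<close> with their expansions in coordinate fields. Outside \<open>V\<close> they need not, so
the Leibniz rules can be applied to the expansions only after an appeal to locality.\<close>

lemma D_coord_component:
  assumes U: "(U, x) \<in> A" and V: "open V" "V \<subseteq> U" "p \<in> V"
    and X: "smooth_vfield V X" and Y: "smooth_vfield V Y"
  shows "D X Y p (\<lambda>q. x q $ \<alpha>) = X p (\<lambda>q. Y q (\<lambda>q. x q $ \<alpha>)) +
    (\<Sum>\<beta>\<in>UNIV. \<Sum>\<gamma>\<in>UNIV. christoffel D (U, x) p \<alpha> \<beta> \<gamma> * X p (\<lambda>q. x q $ \<beta>) * Y p (\<lambda>q. x q $ \<gamma>))"
proof -
  note c = chart_coord_system[OF U]
  let ?e = "\<lambda>\<beta> q. chart_vec (U, x) q (axis \<beta> 1)"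
  let ?X = "\<lambda>\<beta> q. X q (\<lambda>q. x q $ \<beta>)" and ?Y = "\<lambda>\<beta> q. Y q (\<lambda>q. x q $ \<beta>)"
  have e: "smooth_vfield V (?e \<beta>)" for \<beta>
    by (rule smooth_vfield_subset[OF coord_field_smooth[OF c] V(2)])
  have cX: "smooth_fun V (?X \<beta>)" and cY: "smooth_fun V (?Y \<beta>)" for \<beta>
    using smooth_vfield_component[OF c V(1,2)] X Y by auto
  have exp: "Z q = (\<lambda>h. \<Sum>\<beta>\<in>UNIV. Z q (\<lambda>q. x q $ \<beta>) * ?e \<beta> q h)" if "q \<in> V" "smooth_vfield V Z" for q Z
  proof -
    have q: "q \<in> U" using that V by auto
    have "Z q = chart_vec (U, x) q (\<Sum>\<beta>\<in>UNIV. (\<chi> i. Z q (\<lambda>q. x q $ i)) $ \<beta> *\<^sub>R axis \<beta> 1)"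
      unfolding axis_expansion by (rule tangent_eq_chart_vec[OF c q smooth_vfield_tangent[OF that(2,1)]])
    then show ?thesis unfolding chart_vec_sum[OF c q] by simp
  qed
  have p: "p \<in> U" using V by auto
  have "D X Y p = D (\<lambda>q h. \<Sum>\<beta>\<in>UNIV. ?X \<beta> q * ?e \<beta> q h) (\<lambda>q h. \<Sum>\<gamma>\<in>UNIV. ?Y \<gamma> q * ?e \<gamma> q h) p"
    by (intro D_local[OF V(1,3)] smooth_vfield_sum cX cY e) (simp_all add: exp[OF _ X, symmetric] exp[OF _ Y, symmetric])
  also have "\<dots> = (\<lambda>h. \<Sum>\<beta>\<in>UNIV. ?X \<beta> p * D (?e \<beta>) (\<lambda>q h. \<Sum>\<gamma>\<in>UNIV. ?Y \<gamma> q * ?e \<gamma> q h) p h)"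
    by (intro D_sum_left[OF V(1,3)] cX e smooth_vfield_sum cY) auto
  also have "\<dots> = (\<lambda>h. \<Sum>\<beta>\<in>UNIV. ?X \<beta> p * (\<Sum>\<gamma>\<in>UNIV. ?e \<beta> p (?Y \<gamma>) * ?e \<gamma> p h + ?Y \<gamma> p * D (?e \<beta>) (?e \<gamma>) p h))"
    by (simp add: D_sum_right[OF V(1,3) finite cY e e])
  finally have "D X Y p (\<lambda>q. x q $ \<alpha>) = (\<Sum>\<beta>\<in>UNIV. ?X \<beta> p *
      (\<Sum>\<gamma>\<in>UNIV. ?e \<beta> p (?Y \<gamma>) * axis \<gamma> 1 $ \<alpha> + ?Y \<gamma> p * christoffel D (U, x) p \<alpha> \<beta> \<gamma>))"
    by (simp add: chart_vec_coord[OF c p] christoffel_def)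
  also have "\<dots> = (\<Sum>\<beta>\<in>UNIV. ?X \<beta> p * ?e \<beta> p (?Y \<alpha>)) +
      (\<Sum>\<beta>\<in>UNIV. \<Sum>\<gamma>\<in>UNIV. christoffel D (U, x) p \<alpha> \<beta> \<gamma> * ?X \<beta> p * ?Y \<gamma> p)"
  proof -
    have "(\<Sum>\<gamma>\<in>UNIV. ?e \<beta> p (?Y \<gamma>) * axis \<gamma> 1 $ \<alpha>) = ?e \<beta> p (?Y \<alpha>)" for \<beta>
      by (simp add: axis_def if_distrib cong: if_cong)
    then show ?thesis by (simp add: sum.distrib distrib_left sum_distrib_left mult_ac)
  qed
  also have "(\<Sum>\<beta>\<in>UNIV. ?X \<beta> p * ?e \<beta> p (?Y \<alpha>)) = X p (?Y \<alpha>)"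
    using fun_cong[OF exp[OF V(3) X], of "?Y \<alpha>"] by simp
  finally show ?thesis .
qed

text \<open>Absence of torsion shows that the bracket of two fields is a tangent vector, and such a vector
  is determined by its action on the coordinate functions.\<close>

lemma bracket_coord:
  assumes c: "coord_system W \<phi>" and V: "open V" "V \<subseteq> W" and p: "p \<in> V"
    and \<xi>: "smooth_on (\<phi> ` V) \<xi>" and X: "\<And>q. q \<in> V \<Longrightarrow> X q = chart_vec (W, \<phi>) q (\<xi> (\<phi> q))"
    and \<eta>: "smooth_on (\<phi> ` V) \<eta>" and Y: "\<And>q. q \<in> V \<Longrightarrow> Y q = chart_vec (W, \<phi>) q (\<eta> (\<phi> q))"
  shows "bracket X Y p = chart_vec (W, \<phi>) p
    (frechet_derivative \<eta> (at (\<phi> p)) (\<xi> (\<phi> p)) - frechet_derivative \<xi> (at (\<phi> p)) (\<eta> (\<phi> p)))"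
proof -
  have sX: "smooth_vfield V X" by (rule smooth_vfield_coordI[OF c V \<xi> X])
  have sY: "smooth_vfield V Y" by (rule smooth_vfield_coordI[OF c V \<eta> Y])
  have "(\<lambda>h. D X Y p h + -1 * D Y X p h) \<in> tangent_space p"
    by (intro tangent_space_add tangent_space_scale)
      (use smooth_vfield_tangent[OF D_smooth[OF V(1)] p] sX sY in auto)
  then have "bracket X Y p \<in> tangent_space p"
    using D_torsion_free[OF V(1) sX sY p] by simp
  from tangent_eq_chart_vec[OF c _ this] V p
  show ?thesis by (simp add: bracket_coord_component[OF c V p \<xi> X \<eta> Y] subset_iff del: vector_minus_component)
qed

end

section \<open>Geodesics as solutions of a first order system\<close>

context spacetime
begin

text \<open>The geodesic equation as a first order system for position and velocity.\<close>

definition spray :: "'a set \<Rightarrow> ('a \<Rightarrow> real^4) \<Rightarrow> (real^4) \<times> (real^4) \<Rightarrow> (real^4) \<times> (real^4)" where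
  "spray U x z = (snd z, - (\<chi> \<alpha>. \<Sum>\<beta>\<in>UNIV. \<Sum>\<delta>\<in>UNIV.
     christoffel D (U, x) (inv_into U x (fst z)) \<alpha> \<beta> \<delta> * snd z $ \<beta> * snd z $ \<delta>))"

definition phase :: "('a \<Rightarrow> real^4) \<Rightarrow> (real \<Rightarrow> 'a) \<Rightarrow> real \<Rightarrow> (real^4) \<times> (real^4)" where
  "phase x \<gamma> t = (x (\<gamma> t), vector_derivative (x \<circ> \<gamma>) (at t))"

definition geodesic_from :: "'a \<Rightarrow> real set \<Rightarrow> (real \<Rightarrow> 'a) \<Rightarrow> bool" where
  "geodesic_from q J \<gamma> \<longleftrightarrow> geodesic D J \<gamma> \<and> open J \<and> is_interval J \<and> 0 \<in> J \<and> \<gamma> 0 = q"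

lemma geodesic_fromD:
  assumes "geodesic_from q J \<gamma>"
  shows "geodesic D J \<gamma>" "open J" "is_interval J" "0 \<in> J" "\<gamma> 0 = q"
  using assms unfolding geodesic_from_def by auto

lemma spray_smooth:
  assumes U: "(U, x) \<in> A"
  shows "smooth_on (x ` U \<times> UNIV) (spray U x)"
proof -
  note c = chart_coord_system[OF U] and o = coord_systemD(1)[OF chart_coord_system[OF U]]
  have fst: "smooth_on (x ` U \<times> UNIV) (fst :: (real^4) \<times> (real^4) \<Rightarrow> _)"
    and snd: "smooth_on (x ` U \<times> UNIV) (snd :: (real^4) \<times> (real^4) \<Rightarrow> _)"
    by (intro smooth_on_bounded_linear bounded_linear_fst bounded_linear_snd)+
  have G0: "smooth_on (x ` U) (\<lambda>y. christoffel D (U, x) (inv_into U x y) \<alpha> \<beta> \<delta>)" for \<alpha> \<beta> \<delta>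
    using smooth_fun_iff_coord[OF c o order_refl] christoffel_smooth[OF U, of \<alpha> \<beta> \<delta>] by (simp add: o_def)
  have G: "smooth_on (x ` U \<times> UNIV) (\<lambda>z :: (real^4) \<times> (real^4). christoffel D (U, x) (inv_into U x (fst z)) \<alpha> \<beta> \<delta>)" for \<alpha> \<beta> \<delta>
    by (rule smooth_on_compose[OF G0 fst]) auto
  have "smooth_on (x ` U \<times> UNIV) (\<lambda>z :: (real^4) \<times> (real^4). (\<chi> \<alpha>. \<Sum>\<beta>\<in>UNIV. \<Sum>\<delta>\<in>UNIV.
     christoffel D (U, x) (inv_into U x (fst z)) \<alpha> \<beta> \<delta> * snd z $ \<beta> * snd z $ \<delta>))"
  proof (rule smooth_on_componentwise)
    fix \<alpha>
    have "smooth_on (x ` U \<times> UNIV) (\<lambda>z :: (real^4) \<times> (real^4). \<Sum>\<beta>\<in>UNIV. \<Sum>\<delta>\<in>UNIV.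
     christoffel D (U, x) (inv_into U x (fst z)) \<alpha> \<beta> \<delta> * snd z $ \<beta> * snd z $ \<delta>)"
      by (intro smooth_on_sum smooth_on_mult G smooth_on_nth snd)
    then show "smooth_on (x ` U \<times> UNIV) (\<lambda>z :: (real^4) \<times> (real^4). (\<chi> \<alpha>. \<Sum>\<beta>\<in>UNIV. \<Sum>\<delta>\<in>UNIV.
     christoffel D (U, x) (inv_into U x (fst z)) \<alpha> \<beta> \<delta> * snd z $ \<beta> * snd z $ \<delta>) $ \<alpha>)" by simp
  qed
  from smooth_on_scaleR[OF smooth_on_const[of _ "-1"] this] snd
  show ?thesis unfolding spray_def[abs_def] by (intro smooth_on_Pair) simp_all
qed

lemma geodesic_chart_domain:
  assumes "geodesic D J \<gamma>" "open J" "(U, x) \<in> A"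
  shows "open (J \<inter> \<gamma> -` U)" "smooth_on (J \<inter> \<gamma> -` U) (x \<circ> \<gamma>)"
proof -
  have sm: "smooth_map J \<gamma>" using assms(1) unfolding geodesic_def by auto
  have U: "open U" using coord_systemD(1)[OF chart_coord_system[OF assms(3)]] .
  show "open (J \<inter> \<gamma> -` U)"
    using sm U assms(2) unfolding smooth_map_def by (intro continuous_open_preimage) auto
  have "smooth_on {s \<in> J. \<gamma> s \<in> U} (x \<circ> \<gamma>)"
    using sm assms(3) unfolding smooth_map_def by auto
  then show "smooth_on (J \<inter> \<gamma> -` U) (x \<circ> \<gamma>)" by (rule smooth_on_subset) auto
qed

lemma phase_continuous:
  assumes \<gamma>: "geodesic D J \<gamma>" "open J" and U: "(U, x) \<in> A"
  shows "continuous_on (J \<inter> \<gamma> -` U) (phase x \<gamma>)"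
proof -
  note K = geodesic_chart_domain[OF \<gamma> U]
  show ?thesis
    unfolding phase_def[abs_def]
    using smooth_on_continuous[OF K(2)] smooth_on_continuous[OF smooth_curve_velocity[OF K]]
    by (intro continuous_on_Pair) (auto simp: o_def)
qed

lemma deriv_component:
  assumes "(c has_vector_derivative v) (at t)"
  shows "deriv (\<lambda>s. c s $ \<alpha>) t = (v :: real^4) $ \<alpha>"
proof (rule DERIV_imp_deriv)
  show "((\<lambda>s. c s $ \<alpha>) has_real_derivative v $ \<alpha>) (at t)"
    using bounded_linear.has_vector_derivative[OF bounded_linear_vec_nth assms]
    by (simp add: has_real_derivative_iff_has_vector_derivative)
qed

lemma geodesic_phase_derivative:
  assumes \<gamma>: "geodesic D J \<gamma>" "open J" and U: "(U, x) \<in> A" and t: "t \<in> J" "\<gamma> t \<in> U"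
  shows "(phase x \<gamma> has_vector_derivative spray U x (phase x \<gamma> t)) (at t)"
proof -
  note K = geodesic_chart_domain[OF \<gamma> U]
  have tK: "t \<in> J \<inter> \<gamma> -` U" using t by simp
  let ?c = "x \<circ> \<gamma>"
  let ?v = "\<lambda>t. vector_derivative ?c (at t)"
  note c1 = smooth_curve_derivative[OF K]
  note c2 = smooth_curve_derivative[OF K(1) smooth_curve_velocity[OF K]]
  have d1: "deriv (\<lambda>s. x (\<gamma> s) $ \<alpha>) s = ?v s $ \<alpha>" if "s \<in> J \<inter> \<gamma> -` U" for s \<alpha>
    using deriv_component[OF c1[OF that]] by (simp add: o_def)
  have d2: "deriv (deriv (\<lambda>s. x (\<gamma> s) $ \<alpha>)) t = vector_derivative ?v (at t) $ \<alpha>" for \<alpha>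
  proof -
    have "eventually (\<lambda>s. deriv (\<lambda>s. x (\<gamma> s) $ \<alpha>) s = ?v s $ \<alpha>) (nhds t)"
      using d1 K(1) tK unfolding eventually_nhds by metis
    from deriv_cong_ev[OF this refl] show ?thesis using deriv_component[OF c2[OF tK]] by simp
  qed
  have "vector_derivative ?v (at t) $ \<alpha> = snd (spray U x (phase x \<gamma> t)) $ \<alpha>" for \<alpha>
  proof -
    have inv: "inv_into U x (x (\<gamma> t)) = \<gamma> t" using coord_systemD(8)[OF chart_coord_system[OF U]] t by auto
    have "\<forall>\<alpha>. deriv (deriv (\<lambda>s. x (\<gamma> s) $ \<alpha>)) t
          + (\<Sum>\<beta>\<in>UNIV. \<Sum>\<delta>\<in>UNIV. christoffel D (U, x) (\<gamma> t) \<alpha> \<beta> \<delta>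
               * deriv (\<lambda>s. x (\<gamma> s) $ \<beta>) t * deriv (\<lambda>s. x (\<gamma> s) $ \<delta>) t) = 0"
      using bspec[OF bspec[OF conjunct2[OF \<gamma>(1)[unfolded geodesic_def]] t(1)] U] t(2) by simp
    then show ?thesis
      by (simp add: spray_def phase_def inv d1[OF tK] d2 eq_neg_iff_add_eq_0)
  qed
  then have "vector_derivative ?v (at t) = snd (spray U x (phase x \<gamma> t))" by (simp add: vec_eq_iff)
  moreover have "fst (spray U x (phase x \<gamma> t)) = ?v t" by (simp add: spray_def phase_def)
  ultimately have "spray U x (phase x \<gamma> t) = (?v t, vector_derivative ?v (at t))" by (metis prod.collapse)
  moreover have "((\<lambda>t. (?c t, ?v t)) has_vector_derivative (?v t, vector_derivative ?v (at t))) (at t)"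
    by (rule has_vector_derivative_Pair[OF c1[OF tK] c2[OF tK]])
  ultimately show ?thesis by (simp add: phase_def[abs_def] o_def)
qed

lemma spray_bounds:
  assumes U: "(U, x) \<in> A" and z: "fst z \<in> x ` U"
  obtains r L M where "r > 0" "cball z r \<subseteq> x ` U \<times> UNIV" "L \<ge> 0" "M \<ge> 0"
    "\<And>u v. u \<in> cball z r \<Longrightarrow> v \<in> cball z r \<Longrightarrow> norm (spray U x u - spray U x v) \<le> L * norm (u - v)"
    "\<And>u. u \<in> cball z r \<Longrightarrow> norm (spray U x u) \<le> M"
proof -
  have o: "open (x ` U \<times> (UNIV :: (real^4) set))"
    using coord_systemD(3)[OF chart_coord_system[OF U]] by (intro open_Times) auto
  have "z \<in> x ` U \<times> UNIV" using z by (cases z) auto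
  with o obtain r where r: "r > 0" "cball z r \<subseteq> x ` U \<times> UNIV"
    using open_contains_cball by blast
  have "Ck_on 1 (x ` U \<times> UNIV) (spray U x)"
    using spray_smooth[OF U] unfolding smooth_on_open_iff[OF o] by blast
  then obtain L where L: "L \<ge> 0" "\<And>u v. u \<in> cball z r \<Longrightarrow> v \<in> cball z r \<Longrightarrow> norm (spray U x u - spray U x v) \<le> L * norm (u - v)"
    using C1_lipschitz_on_compact_convex[OF _ compact_cball convex_cball r(2)] by metis
  have "compact (spray U x ` cball z r)"
    by (intro compact_continuous_image continuous_on_subset[OF smooth_on_continuous[OF spray_smooth[OF U]] r(2)] compact_cball)
  then have "bounded (spray U x ` cball z r)" by (rule compact_imp_bounded)
  then obtain M where M: "\<forall>w\<in>spray U x ` cball z r. norm w \<le> M"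
    unfolding bounded_iff by (elim exE)
  then have "\<And>u. u \<in> cball z r \<Longrightarrow> norm (spray U x u) \<le> M" by blast
  moreover from this[of z] r(1) have "M \<ge> 0" by (meson centre_in_cball less_imp_le norm_ge_zero order_trans)
  ultimately show thesis using that[OF r L(1) _ L(2)] by blast
qed

lemma phase_injective:
  assumes "(U, x) \<in> A" "\<gamma>1 t \<in> U" "\<gamma>2 t \<in> U" "phase x \<gamma>1 t = phase x \<gamma>2 t"
  shows "\<gamma>1 t = \<gamma>2 t"
  using assms coord_systemD(2)[OF chart_coord_system[OF assms(1)]] by (auto simp: phase_def inj_on_def)

text \<open>The difference in phase space vanishes at \<open>t\<close>, and the Gronwall estimate propagates this in both
time directions.\<close>

lemma geodesic_local_unique:
  assumes \<gamma>1: "geodesic D J1 \<gamma>1" "open J1" and \<gamma>2: "geodesic D J2 \<gamma>2" "open J2"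
    and U: "(U, x) \<in> A" and t: "t \<in> J1" "t \<in> J2" "\<gamma>1 t \<in> U" "\<gamma>2 t \<in> U"
    and eq: "phase x \<gamma>1 t = phase x \<gamma>2 t"
  obtains N where "open N" "t \<in> N" "N \<subseteq> J1 \<inter> J2" "\<And>s. s \<in> N \<Longrightarrow> \<gamma>1 s = \<gamma>2 s"
proof -
  let ?z = "phase x \<gamma>1 t"
  have "fst ?z \<in> x ` U" using t by (simp add: phase_def)
  from spray_bounds[OF U this] obtain r L where r: "r > 0" and L:
    "\<And>u v. u \<in> cball ?z r \<Longrightarrow> v \<in> cball ?z r \<Longrightarrow> norm (spray U x u - spray U x v) \<le> L * norm (u - v)" by metis
  note K1 = geodesic_chart_domain(1)[OF \<gamma>1 U] and K2 = geodesic_chart_domain(1)[OF \<gamma>2 U]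
  define N where "N = ((J1 \<inter> \<gamma>1 -` U) \<inter> phase x \<gamma>1 -` ball ?z r) \<inter> ((J2 \<inter> \<gamma>2 -` U) \<inter> phase x \<gamma>2 -` ball ?z r)"
  have oN: "open N"
    unfolding N_def by (intro open_Int continuous_open_preimage phase_continuous \<gamma>1 \<gamma>2 U K1 K2 open_ball)
  have "t \<in> N" using t r eq by (simp add: N_def)
  with oN obtain e where e: "e > 0" "ball t e \<subseteq> N" using open_contains_ball by blast
  define w where "w s = phase x \<gamma>1 s - phase x \<gamma>2 s" for s
  have wd: "(w has_vector_derivative spray U x (phase x \<gamma>1 s) - spray U x (phase x \<gamma>2 s)) (at s)"
    and wb: "norm (spray U x (phase x \<gamma>1 s) - spray U x (phase x \<gamma>2 s)) \<le> L * norm (w s)"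
    if "s \<in> ball t e" for s
  proof -
    have s: "s \<in> N" using that e by auto
    then show "(w has_vector_derivative spray U x (phase x \<gamma>1 s) - spray U x (phase x \<gamma>2 s)) (at s)"
      unfolding w_def N_def
      by (intro has_vector_derivative_diff geodesic_phase_derivative[OF \<gamma>1 U] geodesic_phase_derivative[OF \<gamma>2 U]) auto
    show "norm (spray U x (phase x \<gamma>1 s) - spray U x (phase x \<gamma>2 s)) \<le> L * norm (w s)"
      unfolding w_def using s by (intro L) (auto simp: N_def)
  qed
  have w0: "w t = 0" by (simp add: w_def eq)
  show thesis
  proof (rule that[of "ball t e"])
    fix s assume s: "s \<in> ball t e"
    have "norm (w s) \<le> 0"
    proof (cases "t \<le> s")
      case True
      have "{t..s} \<subseteq> ball t e" using s True by (auto simp: dist_real_def)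
      then have "norm (w s) \<le> exp (L * (s - t)) * norm (w t)"
        by (intro gronwall_forward[OF True wd wb]) auto
      then show ?thesis by (simp add: w0)
    next
      case False
      then have st: "s \<le> t" by simp
      have "{s..t} \<subseteq> ball t e" using s st by (auto simp: dist_real_def)
      then have "norm (w s) \<le> exp (L * (t - s)) * norm (w t)"
        by (intro gronwall_backward[OF st wd wb]) auto
      then show ?thesis by (simp add: w0)
    qed
    then have "phase x \<gamma>1 s = phase x \<gamma>2 s" by (simp add: w_def)
    then show "\<gamma>1 s = \<gamma>2 s" using s e by (intro phase_injective[OF U]) (auto simp: N_def)
  qed (use e in \<open>auto simp: N_def\<close>)
qed

lemma velocity_coord:
  assumes \<gamma>: "geodesic D J \<gamma>" "open J" and U: "(U, x) \<in> A" and t: "t \<in> J" "\<gamma> t \<in> U"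
  shows "velocity J \<gamma> t (\<lambda>q. x q $ i) = snd (phase x \<gamma> t) $ i"
proof -
  note K = geodesic_chart_domain[OF \<gamma> U]
  have "smooth_at (\<gamma> t) (\<lambda>q. x q $ i)" by (rule coord_smooth_at[OF chart_coord_system[OF U] t(2)])
  moreover have "(x \<circ> \<gamma> has_vector_derivative vector_derivative (x \<circ> \<gamma>) (at t)) (at t)"
    using t by (intro smooth_curve_derivative[OF K]) auto
  from bounded_linear.has_vector_derivative[OF bounded_linear_vec_nth this, of i]
  have "vector_derivative ((\<lambda>q. x q $ i) \<circ> \<gamma>) (at t) = snd (phase x \<gamma> t) $ i"
    by (intro vector_derivative_at) (simp add: phase_def o_def)
  moreover have "at t within J = at t" using t(1) \<gamma>(2) by (rule at_within_open)
  ultimately show ?thesis by (simp add: velocity_def germ_def)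
qed

text \<open>The instants at which position and velocity of the two geodesics agree form a set that is open by
local uniqueness and whose complement is open by continuity.\<close>

lemma geodesic_unique:
  assumes "geodesic_from q J1 \<gamma>1" "geodesic_from q J2 \<gamma>2"
    and vel: "velocity J1 \<gamma>1 0 = velocity J2 \<gamma>2 0" and t: "t \<in> J1" "t \<in> J2"
  shows "\<gamma>1 t = \<gamma>2 t"
proof -
  note \<gamma>1 = geodesic_fromD[OF assms(1)] and \<gamma>2 = geodesic_fromD[OF assms(2)]
  have init: "\<gamma>1 0 = \<gamma>2 0" using \<gamma>1(5) \<gamma>2(5) by simp
  define P where "P s \<longleftrightarrow> \<gamma>1 s = \<gamma>2 s \<and> (\<forall>(U, x)\<in>A. \<gamma>1 s \<in> U \<longrightarrow> phase x \<gamma>1 s = phase x \<gamma>2 s)" for s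
  define J where "J = J1 \<inter> J2"
  have J: "open J" "connected J" "0 \<in> J" "t \<in> J"
    using \<gamma>1 \<gamma>2 t by (auto simp: J_def is_interval_connected is_interval_Int)
  have cont: "continuous_on J \<gamma>1" "continuous_on J \<gamma>2"
    using \<gamma>1(1) \<gamma>2(1) unfolding geodesic_def smooth_map_def J_def by (auto intro: continuous_on_subset)
  have "P 0"
    unfolding P_def
  proof (intro conjI ballI, rule init, clarify)
    fix U x assume U: "(U, x) \<in> A" "\<gamma>1 0 \<in> U"
    have "snd (phase x \<gamma>1 0) $ i = snd (phase x \<gamma>2 0) $ i" for i
      using velocity_coord[OF \<gamma>1(1,2) U(1) \<gamma>1(4) U(2), of i] velocity_coord[OF \<gamma>2(1,2) U(1) \<gamma>2(4), of i] U(2) init vel by simp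
    then show "phase x \<gamma>1 0 = phase x \<gamma>2 0" using init by (simp add: phase_def vec_eq_iff)
  qed
  have "open {s \<in> J. P s}"
  proof (subst open_subopen, intro ballI)
    fix s assume "s \<in> {s \<in> J. P s}"
    then have s: "s \<in> J" "P s" by auto
    obtain U x where U: "(U, x) \<in> A" "\<gamma>1 s \<in> U" by (rule chart_at)
    have "phase x \<gamma>1 s = phase x \<gamma>2 s" "\<gamma>2 s \<in> U" using s U unfolding P_def by auto
    with s U obtain N where N: "open N" "s \<in> N" "N \<subseteq> J" "\<And>r. r \<in> N \<Longrightarrow> \<gamma>1 r = \<gamma>2 r"
      using geodesic_local_unique[OF \<gamma>1(1,2) \<gamma>2(1,2) U(1), of s] unfolding J_def by auto
    have "P r" if r: "r \<in> N" for r
      unfolding P_def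
    proof (intro conjI ballI, rule N(4)[OF r], clarify)
      fix U x assume U: "(U, x) \<in> A" "\<gamma>1 r \<in> U"
      have "(x \<circ> \<gamma>2 has_vector_derivative vector_derivative (x \<circ> \<gamma>2) (at r)) (at r)"
        using U N r by (intro smooth_curve_derivative[OF geodesic_chart_domain[OF \<gamma>2(1,2) U(1)]]) (auto simp: J_def)
      then have "(x \<circ> \<gamma>1 has_vector_derivative vector_derivative (x \<circ> \<gamma>2) (at r)) (at r)"
        by (rule has_vector_derivative_transform_within_open[OF _ N(1) r]) (simp add: N(4))
      then show "phase x \<gamma>1 r = phase x \<gamma>2 r"
        using N(4)[OF r] by (simp add: phase_def vector_derivative_at)
    qed
    with N show "\<exists>N. open N \<and> s \<in> N \<and> N \<subseteq> {s \<in> J. P s}" by blast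
  qed
  moreover have "open {s \<in> J. \<not> P s}"
  proof (subst open_subopen, intro ballI)
    fix s assume "s \<in> {s \<in> J. \<not> P s}"
    then have s: "s \<in> J" "\<not> P s" by auto
    show "\<exists>N. open N \<and> s \<in> N \<and> N \<subseteq> {s \<in> J. \<not> P s}"
    proof (cases "\<gamma>1 s = \<gamma>2 s")
      case False
      from hausdorff[OF this] obtain B1 B2
        where B: "open B1" "open B2" "\<gamma>1 s \<in> B1" "\<gamma>2 s \<in> B2" "B1 \<inter> B2 = {}"
        by (elim exE conjE)
      have "open ((J \<inter> \<gamma>1 -` B1) \<inter> (J \<inter> \<gamma>2 -` B2))"
        by (intro open_Int continuous_open_preimage cont J B)
      then show ?thesis
        using s B by (intro exI[of _ "(J \<inter> \<gamma>1 -` B1) \<inter> (J \<inter> \<gamma>2 -` B2)"]) (auto simp: P_def)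
    next
      case True
      with s obtain U x where U: "(U, x) \<in> A" "\<gamma>1 s \<in> U" "phase x \<gamma>1 s \<noteq> phase x \<gamma>2 s"
        unfolding P_def by auto
      let ?K = "(J1 \<inter> \<gamma>1 -` U) \<inter> (J2 \<inter> \<gamma>2 -` U)"
      have oK: "open ?K"
        by (intro open_Int geodesic_chart_domain(1)[OF \<gamma>1(1,2) U(1)] geodesic_chart_domain(1)[OF \<gamma>2(1,2) U(1)])
      have "continuous_on ?K (\<lambda>s. phase x \<gamma>1 s - phase x \<gamma>2 s)"
        by (intro continuous_on_diff continuous_on_subset[OF phase_continuous[OF \<gamma>1(1,2) U(1)]]
              continuous_on_subset[OF phase_continuous[OF \<gamma>2(1,2) U(1)]]) auto
      then have "open (?K \<inter> (\<lambda>s. phase x \<gamma>1 s - phase x \<gamma>2 s) -` (- {0}))"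
        by (intro continuous_open_preimage oK) auto
      moreover have "r \<in> J \<and> \<not> P r" if "r \<in> ?K \<inter> (\<lambda>s. phase x \<gamma>1 s - phase x \<gamma>2 s) -` (- {0})" for r
      proof -
        have "phase x \<gamma>1 r \<noteq> phase x \<gamma>2 r" using that by (simp add: vimage_def)
        then show ?thesis using that unfolding P_def J_def by (auto intro!: bexI[OF _ U(1)])
      qed
      then have "?K \<inter> (\<lambda>s. phase x \<gamma>1 s - phase x \<gamma>2 s) -` (- {0}) \<subseteq> {s \<in> J. \<not> P s}" by (intro subsetI) simp
      moreover have "s \<in> ?K \<inter> (\<lambda>s. phase x \<gamma>1 s - phase x \<gamma>2 s) -` (- {0})"
        using s(1) U True by (simp add: J_def)
      ultimately show ?thesis by (intro exI[of _ "?K \<inter> (\<lambda>s. phase x \<gamma>1 s - phase x \<gamma>2 s) -` (- {0})"]) (intro conjI)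
    qed
  qed
  ultimately have "{s \<in> J. P s} \<inter> J = {} \<or> {s \<in> J. \<not> P s} \<inter> J = {}"
    by (intro connectedD[OF J(2)]) auto
  with J \<open>P 0\<close> have "P t" by auto
  then show ?thesis by (simp add: P_def)
qed

text \<open>A first exit time from the smaller ball of radius \<open>3/4 * r\<close> cannot exist: up to that time the speed in
phase space is at most \<open>M\<close>, so the distance from \<open>z\<close> is at most \<open>r/2 + r/8\<close>.\<close>

lemma geodesic_stays_near:
  assumes "geodesic_from q J \<gamma>" and U: "(U, x) \<in> A" "q \<in> U"
    and r: "r > 0" "cball z r \<subseteq> x ` U \<times> UNIV" and M: "\<And>u. u \<in> cball z r \<Longrightarrow> norm (spray U x u) \<le> M"
    and start: "norm (phase x \<gamma> 0 - z) \<le> r / 2"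
    and \<tau>: "\<tau> \<in> J" "0 \<le> \<tau>" "M * \<tau> \<le> r / 8" "0 \<le> M" and t: "t \<in> {0..\<tau>}"
  shows "\<gamma> t \<in> U \<and> phase x \<gamma> t \<in> cball z r"
proof -
  note \<gamma> = geodesic_fromD[OF assms(1)]
  define good where "good s \<longleftrightarrow> \<gamma> s \<in> U \<and> phase x \<gamma> s \<in> cball z (3/4 * r)" for s
  define Bd where "Bd = {s \<in> {0..\<tau>}. \<not> good s}"
  have sub: "{0..\<tau>} \<subseteq> J"
    using \<gamma>(3,4) \<tau>(1) unfolding is_interval_1 by (meson atLeastAtMost_iff subsetI)
  have good0: "good 0" using start r U \<gamma>(5) by (auto simp: good_def dist_norm norm_minus_commute)
  have "Bd = {}"
  proof (rule ccontr)
    assume ne: "Bd \<noteq> {}"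
    define T where "T = Inf Bd"
    have bb: "bdd_below Bd" by (auto simp: Bd_def intro!: bdd_belowI[of _ 0])
    have T0: "0 \<le> T" unfolding T_def by (rule cInf_greatest[OF ne]) (auto simp: Bd_def)
    obtain b where b: "b \<in> Bd" using ne by auto
    have "T \<le> b" unfolding T_def by (rule cInf_lower[OF b bb])
    then have T\<tau>: "T \<le> \<tau>" using b by (auto simp: Bd_def)
    have before: "good s" if "0 \<le> s" "s < T" for s
    proof (rule ccontr)
      assume "\<not> good s"
      then have "s \<in> Bd" using that T\<tau> by (auto simp: Bd_def)
      then show False using cInf_lower[OF _ bb] that unfolding T_def by fastforce
    qed
    have near: "phase x \<gamma> s \<in> cball z (5/8 * r)" if s: "0 \<le> s" "s < T \<or> s = 0" for s
    proof -
      have "norm (phase x \<gamma> s - phase x \<gamma> 0) \<le> M * s"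
      proof (rule mean_value_vector[OF _ _ s(1)])
        fix u assume "u \<in> {0..s}"
        then have u: "good u" "u \<in> J" using before good0 s sub T\<tau> \<tau>(2) by (cases "u = 0"; auto)+
        then show "(phase x \<gamma> has_vector_derivative spray U x (phase x \<gamma> u)) (at u)"
          by (intro geodesic_phase_derivative[OF \<gamma>(1,2) U(1)]) (auto simp: good_def)
        show "norm (spray U x (phase x \<gamma> u)) \<le> M" using u(1) r(1) by (intro M) (auto simp: good_def)
      qed
      also have "M * s \<le> r / 8" using s \<tau>(2-4) T\<tau> mult_left_mono[of s \<tau> M] by linarith
      finally show ?thesis
        using start norm_triangle_ineq[of "phase x \<gamma> s - phase x \<gamma> 0" "phase x \<gamma> 0 - z"]
        by (simp add: dist_norm norm_minus_commute)
    qed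
    have T: "\<gamma> T \<in> U \<and> phase x \<gamma> T \<in> cball z (5/8 * r)"
    proof (cases "T = 0")
      case False
      then have clT: "closure {0..<T} = {0..T}" using T0 by simp
      have JT: "{0..T} \<subseteq> J" using sub T\<tau> by auto
      \<comment> \<open>before time \<open>T\<close> the geodesic runs in a compact subset of the chart domain, so it cannot leave the domain at time \<open>T\<close>\<close>
      define Cx where "Cx = inv_into U x ` cball (fst z) r"
      have ball: "cball (fst z) r \<subseteq> x ` U"
      proof
        fix u assume "u \<in> cball (fst z) r"
        then have "(u, snd z) \<in> cball z r" by (cases z) (auto simp: dist_Pair_Pair)
        then show "u \<in> x ` U" using r(2) by auto
      qed
      note c = chart_coord_system[OF U(1)]
      have "compact Cx" unfolding Cx_def
        by (intro compact_continuous_image continuous_on_subset[OF coord_systemD(5)[OF c] ball] compact_cball)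
      then have clC: "closed Cx" by (rule compact_imp_closed)
      have CU: "Cx \<subseteq> U" using ball unfolding Cx_def by (auto intro!: inv_into_into)
      have "\<gamma> s \<in> Cx" if "s \<in> {0..<T}" for s
      proof -
        have "good s" using before that by auto
        then have "x (\<gamma> s) \<in> cball (fst z) r" "\<gamma> s \<in> U"
          using dist_fst_le[of z "phase x \<gamma> s"] r(1) by (auto simp: good_def phase_def)
        then show ?thesis unfolding Cx_def using coord_systemD(8)[OF c] by (metis imageI)
      qed
      then have "{0..<T} \<subseteq> {0..T} \<inter> \<gamma> -` Cx" by auto
      moreover have "continuous_on J \<gamma>" using \<gamma>(1) unfolding geodesic_def smooth_map_def by auto
      then have "closed ({0..T} \<inter> \<gamma> -` Cx)"
        by (intro continuous_closed_preimage clC continuous_on_subset[OF _ JT]) auto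
      ultimately have "{0..T} \<subseteq> {0..T} \<inter> \<gamma> -` Cx" using closure_minimal clT by metis
      then have inU: "\<gamma> s \<in> U" if "s \<in> {0..T}" for s using CU that by auto
      have "continuous_on {0..T} (phase x \<gamma>)"
        by (rule continuous_on_subset[OF phase_continuous[OF \<gamma>(1,2) U(1)]]) (use JT inU in auto)
      then have "closed ({0..T} \<inter> phase x \<gamma> -` cball z (5/8 * r))"
        by (intro continuous_closed_preimage) auto
      moreover have "{0..<T} \<subseteq> {0..T} \<inter> phase x \<gamma> -` cball z (5/8 * r)"
        using near by auto
      ultimately have "{0..T} \<subseteq> {0..T} \<inter> phase x \<gamma> -` cball z (5/8 * r)" using closure_minimal clT by metis
      then show ?thesis using inU[of T] T0 by auto
    qed (use good0 near[of 0] in \<open>simp add: good_def\<close>)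
    define N where "N = (J \<inter> \<gamma> -` U) \<inter> phase x \<gamma> -` ball z (3/4 * r)"
    have oN: "open N" unfolding N_def
      by (rule continuous_open_preimage[OF phase_continuous[OF \<gamma>(1,2) U(1)]
            geodesic_chart_domain(1)[OF \<gamma>(1,2) U(1)] open_ball])
    have "T \<in> N" using T r(1) sub T0 T\<tau> by (auto simp: N_def)
    moreover have "T \<in> closure Bd" unfolding T_def by (rule closure_contains_Inf[OF ne bb])
    ultimately have "N \<inter> Bd \<noteq> {}" using oN open_Int_closure_eq_empty by blast
    then show False by (auto simp: N_def Bd_def good_def)
  qed
  then have "good t" using t by (auto simp: Bd_def)
  then show ?thesis using r(1) by (auto simp: good_def)
qed

text \<open>The Gronwall estimate bounds the difference of two solutions in phase space by a multiple of the
difference of the initial velocities. In particular this bounds the difference of the velocities at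
all times; since both geodesics start at \<open>q0\<close>, integration yields the factor \<open>t\<close> for the positions.\<close>

lemma geodesic_lipschitz_in_velocity:
  assumes U: "(U, x) \<in> A" "q0 \<in> U"
  obtains \<delta> \<epsilon> C where "\<delta> > 0" "\<epsilon> > 0" "C \<ge> 0"
    "\<And>\<gamma>1 J1 \<gamma>2 J2 t. geodesic_from q0 J1 \<gamma>1 \<Longrightarrow> norm (snd (phase x \<gamma>1 0) - a) < \<epsilon> \<Longrightarrow>
       geodesic_from q0 J2 \<gamma>2 \<Longrightarrow> norm (snd (phase x \<gamma>2 0) - a) < \<epsilon> \<Longrightarrow>
       t \<in> J1 \<Longrightarrow> t \<in> J2 \<Longrightarrow> 0 \<le> t \<Longrightarrow> t \<le> \<delta> \<Longrightarrow>
       \<gamma>1 t \<in> U \<and> \<gamma>2 t \<in> U \<and>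
       norm (x (\<gamma>1 t) - x (\<gamma>2 t)) \<le> C * t * norm (snd (phase x \<gamma>1 0) - snd (phase x \<gamma>2 0))"
proof -
  let ?z = "(x q0, a)"
  obtain r L M where r: "r > 0" "cball ?z r \<subseteq> x ` U \<times> UNIV" and LM: "L \<ge> 0" "M \<ge> 0"
    and L: "\<And>u v. u \<in> cball ?z r \<Longrightarrow> v \<in> cball ?z r \<Longrightarrow> norm (spray U x u - spray U x v) \<le> L * norm (u - v)"
    and M: "\<And>u. u \<in> cball ?z r \<Longrightarrow> norm (spray U x u) \<le> M"
    using spray_bounds[OF U(1), of ?z] U(2) by auto
  \<comment> \<open>in this time a solution moves by at most \<open>r / 8\<close> in phase space\<close>
  define \<delta> where "\<delta> = r / (8 * (M + 1))"
  have \<delta>: "\<delta> > 0" "M * \<delta> \<le> r / 8" using r LM by (auto simp: \<delta>_def field_simps)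
  show thesis
  proof (rule that[of \<delta> "r/2" "exp (L * \<delta>)"])
    fix \<gamma>1 J1 \<gamma>2 J2 t
    assume g1: "geodesic_from q0 J1 \<gamma>1" and n1: "norm (snd (phase x \<gamma>1 0) - a) < r/2"
      and g2: "geodesic_from q0 J2 \<gamma>2" and n2: "norm (snd (phase x \<gamma>2 0) - a) < r/2"
      and t: "t \<in> J1" "t \<in> J2" "0 \<le> t" "t \<le> \<delta>"
    note \<gamma>1 = geodesic_fromD[OF g1] and \<gamma>2 = geodesic_fromD[OF g2]
    have ph0: "phase x \<gamma> 0 = (x q0, snd (phase x \<gamma> 0))" if "\<gamma> 0 = q0" for \<gamma>
      using that by (simp add: phase_def)
    have start: "norm (phase x \<gamma> 0 - ?z) \<le> r / 2" if "\<gamma> 0 = q0" "norm (snd (phase x \<gamma> 0) - a) < r/2" for \<gamma>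
      using that by (subst ph0) (auto simp: norm_Pair)
    have Mt: "M * t \<le> r / 8" using \<delta>(2) t LM mult_left_mono[of t \<delta> M] by linarith
    have s1: "\<gamma>1 s \<in> U \<and> phase x \<gamma>1 s \<in> cball ?z r" if "s \<in> {0..t}" for s
      by (rule geodesic_stays_near[OF g1 U r M start[OF \<gamma>1(5) n1] t(1,3) Mt LM(2) that])
    have s2: "\<gamma>2 s \<in> U \<and> phase x \<gamma>2 s \<in> cball ?z r" if "s \<in> {0..t}" for s
      by (rule geodesic_stays_near[OF g2 U r M start[OF \<gamma>2(5) n2] t(2,3) Mt LM(2) that])
    have sub: "{0..t} \<subseteq> J1" "{0..t} \<subseteq> J2"
      using \<gamma>1(3,4) \<gamma>2(3,4) t unfolding is_interval_1 by (meson atLeastAtMost_iff subsetI)+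
    define w where "w s = phase x \<gamma>1 s - phase x \<gamma>2 s" for s
    have wd: "(w has_vector_derivative spray U x (phase x \<gamma>1 s) - spray U x (phase x \<gamma>2 s)) (at s)"
      if "s \<in> {0..t}" for s
      unfolding w_def using s1[OF that] s2[OF that] sub that
      by (intro has_vector_derivative_diff geodesic_phase_derivative[OF \<gamma>1(1,2) U(1)] geodesic_phase_derivative[OF \<gamma>2(1,2) U(1)]) auto
    have wb: "norm (w s) \<le> exp (L * \<delta>) * norm (w 0)" if s: "s \<in> {0..t}" for s
    proof -
      have "norm (w s) \<le> exp (L * (s - 0)) * norm (w 0)"
      proof (rule gronwall_forward)
        fix u assume "u \<in> {0..s}"
        then have u: "u \<in> {0..t}" using s by auto
        show "(w has_vector_derivative spray U x (phase x \<gamma>1 u) - spray U x (phase x \<gamma>2 u)) (at u)" by (rule wd[OF u])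
        show "norm (spray U x (phase x \<gamma>1 u) - spray U x (phase x \<gamma>2 u)) \<le> L * norm (w u)"
          unfolding w_def using s1[OF u] s2[OF u] by (intro L) auto
      qed (use s in auto)
      also have "\<dots> \<le> exp (L * \<delta>) * norm (w 0)"
        using s t LM by (intro mult_right_mono) (auto intro: mult_left_mono)
      finally show ?thesis .
    qed
    have w0: "norm (w 0) = norm (snd (phase x \<gamma>1 0) - snd (phase x \<gamma>2 0))"
      unfolding w_def by (subst ph0[of \<gamma>1], rule \<gamma>1(5), subst ph0[of \<gamma>2], rule \<gamma>2(5)) (simp add: norm_Pair)
    have "norm (fst (w t) - fst (w 0)) \<le> exp (L * \<delta>) * norm (w 0) * t"
    proof (rule mean_value_vector[OF _ _ t(3)])
      fix s assume s: "s \<in> {0..t}"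
      show "((\<lambda>s. fst (w s)) has_vector_derivative fst (spray U x (phase x \<gamma>1 s) - spray U x (phase x \<gamma>2 s))) (at s)"
        by (rule bounded_linear.has_vector_derivative[OF bounded_linear_fst wd[OF s]])
      have "fst (spray U x (phase x \<gamma>1 s) - spray U x (phase x \<gamma>2 s)) = snd (w s)"
        by (simp add: spray_def w_def)
      then show "norm (fst (spray U x (phase x \<gamma>1 s) - spray U x (phase x \<gamma>2 s))) \<le> exp (L * \<delta>) * norm (w 0)"
        using wb[OF s] norm_snd_le[of "snd (w s)" "fst (w s)"] by simp
    qed
    moreover have "fst (w t) - fst (w 0) = x (\<gamma>1 t) - x (\<gamma>2 t)"
      using \<gamma>1(5) \<gamma>2(5) by (simp add: w_def phase_def)
    ultimately show "\<gamma>1 t \<in> U \<and> \<gamma>2 t \<in> U \<and>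
       norm (x (\<gamma>1 t) - x (\<gamma>2 t)) \<le> exp (L * \<delta>) * t * norm (snd (phase x \<gamma>1 0) - snd (phase x \<gamma>2 0))"
      using s1[of t] s2[of t] t w0 by (simp add: mult_ac)
  qed (use r \<delta> in auto)
qed

end

section \<open>Exponential coordinates\<close>

context framed_spacetime
begin

definition ray_geodesic :: "real^4 \<Rightarrow> real set \<Rightarrow> (real \<Rightarrow> 'a) \<Rightarrow> bool" where
  "ray_geodesic V J \<gamma> \<longleftrightarrow> geodesic_from orig J \<gamma> \<and> velocity J \<gamma> 0 = frame_vec V"

lemma ray_geodesicD:
  assumes "ray_geodesic V J \<gamma>"
  shows "geodesic D J \<gamma>" "open J" "is_interval J" "0 \<in> J" "\<gamma> 0 = orig" "velocity J \<gamma> 0 = frame_vec V" "geodesic_from orig J \<gamma>"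
  using assms unfolding ray_geodesic_def geodesic_from_def by auto

lemma geodesic_reaches_iff: "geodesic_reaches V t q \<longleftrightarrow> (\<exists>\<gamma> J. ray_geodesic V J \<gamma> \<and> t \<in> J \<and> \<gamma> t = q)"
  unfolding geodesic_reaches_def ray_geodesic_def geodesic_from_def by auto

lemma Upsilon_ray:
  assumes "ray_geodesic V J \<gamma>" "t \<in> J"
  shows "Upsilon V t = \<gamma> t"
  unfolding Upsilon_def
proof (rule the_equality)
  show "geodesic_reaches V t (\<gamma> t)" using assms unfolding geodesic_reaches_iff by auto
  fix q assume "geodesic_reaches V t q"
  then obtain \<gamma>' J' where g': "ray_geodesic V J' \<gamma>'" "t \<in> J'" "\<gamma>' t = q"
    unfolding geodesic_reaches_iff by auto
  have "\<gamma>' t = \<gamma> t"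
    by (rule geodesic_unique[OF ray_geodesicD(7)[OF g'(1)] ray_geodesicD(7)[OF assms(1)] _ g'(2) assms(2)])
      (simp add: ray_geodesicD(6)[OF g'(1)] ray_geodesicD(6)[OF assms(1)])
  with g' show "q = \<gamma> t" by simp
qed

lemma less_i_star: "ereal \<rho> < i_star \<Longrightarrow> \<exists>s0. injectivity_parameter s0 \<and> \<rho> < s0"
  unfolding i_star_def less_Sup_iff by auto

lemma injectivity_le_i_star: "injectivity_parameter s0 \<Longrightarrow> ereal s0 \<le> i_star"
  unfolding i_star_def by (intro Sup_upper) auto

abbreviation polar_exp :: "real \<times> (real^4) \<Rightarrow> 'a" where
  "polar_exp \<equiv> \<lambda>(\<rho>, V). Upsilon V \<rho>"

lemma injectivity_parameterD:
  assumes "injectivity_parameter s0"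
  shows "s0 > 0" "\<rho> \<in> {0<..<s0} \<Longrightarrow> V \<in> H1 \<Longrightarrow> \<exists>q. geodesic_reaches V \<rho> q"
    "inj_on polar_exp ({0<..<s0} \<times> H1)" "open (polar_exp ` ({0<..<s0} \<times> H1))"
    "smooth_map ({0<..<s0} \<times> H1) polar_exp"
    "(U, x) \<in> A \<Longrightarrow> smooth_on (x ` (U \<inter> polar_exp ` ({0<..<s0} \<times> H1)))
       (inv_into ({0<..<s0} \<times> H1) polar_exp \<circ> inv_into U x)"
    "polar_exp ` ({0<..<s0} \<times> H1) \<subseteq> chronological_future orig"
  using assms unfolding injectivity_parameter_def diffeo_onto_image_def by auto

lemma ray_exists:
  assumes "V \<in> H1" "0 < t" "ereal t < i_star"
  obtains J \<gamma> where "ray_geodesic V J \<gamma>" "t \<in> J" "{0..t} \<subseteq> J"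
proof -
  obtain s0 where s0: "injectivity_parameter s0" "t < s0" using less_i_star[OF assms(3)] by auto
  then obtain q where "geodesic_reaches V t q" using injectivity_parameterD(2)[OF s0(1), of t V] assms by auto
  then obtain J \<gamma> where g: "ray_geodesic V J \<gamma>" "t \<in> J" unfolding geodesic_reaches_iff by auto
  moreover have "{0..t} \<subseteq> J"
    using ray_geodesicD(3,4)[OF g(1)] g(2) unfolding is_interval_1 by (meson atLeastAtMost_iff subsetI)
  ultimately show thesis by (rule that)
qed

lemma exp_orig_scaled: "V \<in> H1 \<Longrightarrow> \<rho> > 0 \<Longrightarrow> exp_orig (\<rho> *\<^sub>R V) = Upsilon V \<rho>"
  unfolding exp_orig_def by (simp add: scaled_H1)

lemma exp_orig_polar: "exp_orig y = polar_exp (mink_radius y, y /\<^sub>R mink_radius y)"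
  unfolding exp_orig_def by simp

lemma polar_unique:
  assumes "polar p \<rho> V" "polar p \<rho>' V'"
  shows "\<rho> = \<rho>'" "V = V'"
proof -
  have "ereal (max \<rho> \<rho>') < i_star" using assms by (auto simp: polar_def max_def)
  from less_i_star[OF this] obtain s0 where s0: "injectivity_parameter s0" "max \<rho> \<rho>' < s0" by blast
  have eq: "polar_exp (\<rho>, V) = polar_exp (\<rho>', V')"
    using assms by (auto simp: polar_def exp_orig_scaled)
  have "(\<rho>, V) = (\<rho>', V')"
    by (rule inj_onD[OF injectivity_parameterD(3)[OF s0(1)] eq]) (use assms s0 in \<open>auto simp: polar_def\<close>)
  then show "\<rho> = \<rho>'" "V = V'" by auto
qed

definition exp_domain :: "(real^4) set" where
  "exp_domain = {y \<in> timelike_cone. ereal (mink_radius y) < i_star}"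

lemma exp_domain_polar: "y \<in> exp_domain \<Longrightarrow> polar (exp_orig y) (mink_radius y) (y /\<^sub>R mink_radius y)"
  using mink_radius_pos[of y] unit_timelike_H1[of y] by (simp add: polar_def exp_domain_def)

lemma polar_exp_domain: "polar p \<rho> V \<Longrightarrow> \<rho> *\<^sub>R V \<in> exp_domain"
  using scaled_H1[of V \<rho>] by (simp add: polar_def exp_domain_def)

lemma log_orig_polar: "polar p \<rho> V \<Longrightarrow> log_orig p = \<rho> *\<^sub>R V"
  unfolding log_orig_def
proof (rule the_equality)
  fix y assume "polar p \<rho> V" "\<exists>\<rho> V. polar p \<rho> V \<and> y = \<rho> *\<^sub>R V"
  then obtain \<rho>' V' where "polar p \<rho>' V'" "y = \<rho>' *\<^sub>R V'" by auto
  then show "y = \<rho> *\<^sub>R V" using polar_unique[OF \<open>polar p \<rho> V\<close>] by metis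
qed auto

lemma rho_polar: "polar p \<rho> V \<Longrightarrow> rho p = \<rho>"
  unfolding rho_def using polar_unique(1) by (intro the_equality) auto

lemma log_exp:
  assumes "y \<in> exp_domain"
  shows "log_orig (exp_orig y) = y"
proof -
  have "mink_radius y \<noteq> 0" using assms mink_radius_pos[of y] by (auto simp: exp_domain_def)
  then show ?thesis using log_orig_polar[OF exp_domain_polar[OF assms]] by simp
qed

lemma exp_in_I_star:
  assumes "y \<in> exp_domain"
  shows "exp_orig y \<in> I_star"
proof -
  have y: "y \<in> timelike_cone" "ereal (mink_radius y) < i_star" using assms by (auto simp: exp_domain_def)
  from less_i_star[OF y(2)] obtain s0 where s0: "injectivity_parameter s0" "mink_radius y < s0" by blast
  have "(mink_radius y, y /\<^sub>R mink_radius y) \<in> {0<..<s0} \<times> H1"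
    using s0 mink_radius_pos[OF y(1)] unit_timelike_H1[OF y(1)] by auto
  then have "exp_orig y \<in> chronological_future orig"
    unfolding exp_orig_polar using injectivity_parameterD(7)[OF s0(1)] by blast
  then show ?thesis unfolding I_star_def using exp_domain_polar[OF assms] by auto
qed

lemma I_star_polar:
  assumes "p \<in> I_star"
  shows "log_orig p \<in> exp_domain" "exp_orig (log_orig p) = p" "rho p = mink_radius (log_orig p)"
proof -
  obtain \<rho> V where V: "polar p \<rho> V" using assms unfolding I_star_def by auto
  show "log_orig p \<in> exp_domain" using polar_exp_domain[OF V] log_orig_polar[OF V] by simp
  show "exp_orig (log_orig p) = p" using V log_orig_polar[OF V] by (simp add: polar_def)
  show "rho p = mink_radius (log_orig p)"
    using rho_polar[OF V] log_orig_polar[OF V] scaled_H1(2)[of V \<rho>] V by (simp add: polar_def)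
qed

lemma I_star_eq: "I_star = exp_orig ` exp_domain"
proof
  show "I_star \<subseteq> exp_orig ` exp_domain"
    using I_star_polar(1,2) by (intro subsetI) (rule image_eqI, auto)
qed (use exp_in_I_star in auto)

lemma log_image: "log_orig ` I_star = exp_domain"
  unfolding I_star_eq image_image using log_exp by simp

text \<open>The supremum \<open>i_star\<close> need not be an injectivity parameter itself, so the exponential map is studied
on the parts of its domain below each such parameter.\<close>

definition cone_upto :: "real \<Rightarrow> (real^4) set" where
  "cone_upto s0 = {y \<in> timelike_cone. mink_radius y < s0}"

lemma open_cone_upto: "open (cone_upto s0)"
proof -
  have "cone_upto s0 = timelike_cone \<inter> mink_radius -` {..<s0}" by (auto simp: cone_upto_def)
  then show ?thesis
    using continuous_open_preimage[OF smooth_on_continuous[OF smooth_on_mink_radius] open_timelike_cone, of "{..<s0}"] by simp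
qed

lemma cone_upto_subset:
  assumes "injectivity_parameter s0"
  shows "cone_upto s0 \<subseteq> exp_domain"
proof
  fix y assume "y \<in> cone_upto s0"
  then have "y \<in> timelike_cone" "ereal (mink_radius y) < ereal s0" by (auto simp: cone_upto_def)
  then show "y \<in> exp_domain"
    using less_le_trans[OF _ injectivity_le_i_star[OF assms]] unfolding exp_domain_def by auto
qed

lemma exp_domain_upto:
  assumes "y \<in> exp_domain"
  obtains s0 where "injectivity_parameter s0" "y \<in> cone_upto s0"
  using assms less_i_star[of "mink_radius y"] by (auto simp: exp_domain_def cone_upto_def)

lemma open_exp_domain: "open exp_domain"
proof (subst open_subopen, intro ballI)
  fix y assume "y \<in> exp_domain"
  then obtain s0 where "injectivity_parameter s0" "y \<in> cone_upto s0" by (rule exp_domain_upto)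
  then show "\<exists>T. open T \<and> y \<in> T \<and> T \<subseteq> exp_domain"
    using open_cone_upto cone_upto_subset by blast
qed

lemma cone_upto_polar:
  "(\<lambda>y. (mink_radius y, y /\<^sub>R mink_radius y)) ` cone_upto s0 \<subseteq> {0<..<s0} \<times> H1"
  using mink_radius_pos unit_timelike_H1 by (auto simp: cone_upto_def)

lemma smooth_on_polar: "smooth_on (cone_upto s0) (\<lambda>y. (mink_radius y, y /\<^sub>R mink_radius y))"
  by (rule smooth_on_subset[OF smooth_on_Pair[OF smooth_on_mink_radius smooth_on_unit_timelike]])
    (auto simp: cone_upto_def)

lemma exp_image_upto: "exp_orig ` cone_upto s0 = polar_exp ` ({0<..<s0} \<times> H1)"
proof
  show "exp_orig ` cone_upto s0 \<subseteq> polar_exp ` ({0<..<s0} \<times> H1)"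
    using cone_upto_polar[of s0] unfolding exp_orig_polar by blast
  show "polar_exp ` ({0<..<s0} \<times> H1) \<subseteq> exp_orig ` cone_upto s0"
  proof
    fix q assume "q \<in> polar_exp ` ({0<..<s0} \<times> H1)"
    then obtain \<rho> V where "\<rho> > 0" "\<rho> < s0" "V \<in> H1" "q = Upsilon V \<rho>" by auto
    then show "q \<in> exp_orig ` cone_upto s0"
      using scaled_H1[of V \<rho>] exp_orig_scaled[of V \<rho>]
      by (intro image_eqI[of _ _ "\<rho> *\<^sub>R V"]) (auto simp: cone_upto_def)
  qed
qed

lemma exp_continuous: "continuous_on exp_domain exp_orig"
proof (rule continuous_at_imp_continuous_on, rule ballI)
  fix y assume "y \<in> exp_domain"
  then obtain s0 where s0: "injectivity_parameter s0" "y \<in> cone_upto s0" by (rule exp_domain_upto)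
  have F: "continuous_on ({0<..<s0} \<times> H1) polar_exp"
    using injectivity_parameterD(5)[OF s0(1)] unfolding smooth_map_def by auto
  have "continuous_on (cone_upto s0) exp_orig"
    unfolding exp_orig_polar[abs_def]
    by (rule continuous_on_compose2[OF F smooth_on_continuous[OF smooth_on_polar] cone_upto_polar])
  then show "isCont exp_orig y" using open_cone_upto s0(2) continuous_on_eq_continuous_at by blast
qed

lemma exp_smooth:
  assumes U: "(U, x) \<in> A"
  shows "smooth_on (exp_domain \<inter> exp_orig -` U) (x \<circ> exp_orig)"
proof (rule smooth_on_local)
  fix y assume "y \<in> exp_domain \<inter> exp_orig -` U"
  then have "y \<in> exp_domain" by simp
  then obtain s0 where s0: "injectivity_parameter s0" "y \<in> cone_upto s0" by (rule exp_domain_upto)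
  let ?S = "{0<..<s0} \<times> H1"
  have F: "smooth_on {s \<in> ?S. polar_exp s \<in> U} (x \<circ> polar_exp)"
    using injectivity_parameterD(5)[OF s0(1)] U unfolding smooth_map_def by auto
  have "smooth_on (cone_upto s0 \<inter> exp_orig -` U)
      (\<lambda>y. (x \<circ> polar_exp) ((\<lambda>y. (mink_radius y, y /\<^sub>R mink_radius y)) y))"
  proof (rule smooth_on_compose[OF F])
    show "smooth_on (cone_upto s0 \<inter> exp_orig -` U) (\<lambda>y. (mink_radius y, y /\<^sub>R mink_radius y))"
      by (rule smooth_on_subset[OF smooth_on_polar]) auto
    show "(\<lambda>y. (mink_radius y, y /\<^sub>R mink_radius y)) ` (cone_upto s0 \<inter> exp_orig -` U) \<subseteq> {s \<in> ?S. polar_exp s \<in> U}"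
      using cone_upto_polar[of s0] by (auto simp: exp_orig_polar)
  qed
  then have "smooth_on (cone_upto s0 \<inter> exp_orig -` U) (x \<circ> exp_orig)"
    by (rule smooth_on_cong) (simp add: exp_orig_polar)
  then have "smooth_on (cone_upto s0 \<inter> (exp_domain \<inter> exp_orig -` U)) (x \<circ> exp_orig)"
    by (rule smooth_on_subset) auto
  then show "\<exists>W. open W \<and> y \<in> W \<and> smooth_on (W \<inter> (exp_domain \<inter> exp_orig -` U)) (x \<circ> exp_orig)"
    using open_cone_upto s0(2) by blast
qed

lemma image_upto_subset:
  assumes "injectivity_parameter s0"
  shows "polar_exp ` ({0<..<s0} \<times> H1) \<subseteq> I_star"
  unfolding exp_image_upto[symmetric] I_star_eq using cone_upto_subset[OF assms] by auto

lemma I_star_upto: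
  assumes "p \<in> I_star"
  obtains s0 where "injectivity_parameter s0" "p \<in> polar_exp ` ({0<..<s0} \<times> H1)"
proof -
  obtain s0 where "injectivity_parameter s0" "log_orig p \<in> cone_upto s0"
    using exp_domain_upto[OF I_star_polar(1)[OF assms]] .
  then show thesis using that exp_image_upto I_star_polar(2)[OF assms] by (metis imageI)
qed

lemma open_I_star: "open I_star"
proof (subst open_subopen, intro ballI)
  fix p assume "p \<in> I_star"
  then obtain s0 where s0: "injectivity_parameter s0" "p \<in> polar_exp ` ({0<..<s0} \<times> H1)" by (rule I_star_upto)
  then show "\<exists>T. open T \<and> p \<in> T \<and> T \<subseteq> I_star"
    using injectivity_parameterD(4)[OF s0(1)] image_upto_subset[OF s0(1)] by (intro exI[of _ "polar_exp ` ({0<..<s0} \<times> H1)"]) auto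
qed

lemma log_upto:
  assumes s0: "injectivity_parameter s0" and p: "p \<in> polar_exp ` ({0<..<s0} \<times> H1)"
  shows "log_orig p = fst (inv_into ({0<..<s0} \<times> H1) polar_exp p) *\<^sub>R
    snd (inv_into ({0<..<s0} \<times> H1) polar_exp p)"
proof -
  obtain \<rho> V where V: "\<rho> \<in> {0<..<s0}" "V \<in> H1" "p = polar_exp (\<rho>, V)" using p by auto
  have "inv_into ({0<..<s0} \<times> H1) polar_exp p = (\<rho>, V)"
    unfolding V(3) using V by (intro inv_into_f_f injectivity_parameterD(3)[OF s0]) auto
  moreover have "polar p \<rho> V"
    using V exp_orig_scaled[of V \<rho>] injectivity_le_i_star[OF s0]
    by (auto simp: polar_def intro: less_le_trans[of "ereal \<rho>" "ereal s0"])
  ultimately show ?thesis using log_orig_polar by simp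
qed

lemma log_smooth:
  assumes U: "(U, x) \<in> A"
  shows "smooth_on (x ` (U \<inter> I_star)) (log_orig \<circ> inv_into U x)"
proof (rule smooth_on_local)
  fix z assume "z \<in> x ` (U \<inter> I_star)"
  then obtain p where p: "p \<in> U" "p \<in> I_star" "z = x p" by auto
  obtain s0 where s0: "injectivity_parameter s0" "p \<in> polar_exp ` ({0<..<s0} \<times> H1)" using I_star_upto[OF p(2)] .
  let ?S = "{0<..<s0} \<times> H1"
  note c = chart_coord_system[OF U]
  have "smooth_on (x ` (U \<inter> polar_exp ` ?S))
      (\<lambda>z. fst ((inv_into ?S polar_exp \<circ> inv_into U x) z) *\<^sub>R snd ((inv_into ?S polar_exp \<circ> inv_into U x) z))"
    by (intro smooth_on_scaleR smooth_on_compose[OF smooth_on_bounded_linear[OF bounded_linear_fst] _ subset_UNIV]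
        smooth_on_compose[OF smooth_on_bounded_linear[OF bounded_linear_snd] _ subset_UNIV]
        injectivity_parameterD(6)[OF s0(1) U])
  then have "smooth_on (x ` (U \<inter> polar_exp ` ?S)) (log_orig \<circ> inv_into U x)"
    by (rule smooth_on_cong) (use log_upto[OF s0(1)] in \<open>force simp: coord_systemD(8)[OF c]\<close>)
  then have "smooth_on (x ` (U \<inter> polar_exp ` ?S) \<inter> x ` (U \<inter> I_star)) (log_orig \<circ> inv_into U x)"
    by (rule smooth_on_subset) auto
  moreover have "open (x ` (U \<inter> polar_exp ` ?S))"
    by (rule coord_open_image[OF c]) (use coord_systemD(1)[OF c] injectivity_parameterD(4)[OF s0(1)] in auto)
  ultimately show "\<exists>W. open W \<and> z \<in> W \<and> smooth_on (W \<inter> x ` (U \<inter> I_star)) (log_orig \<circ> inv_into U x)"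
    using p s0 by (intro exI[of _ "x ` (U \<inter> polar_exp ` ?S)"]) auto
qed

lemma log_continuous: "continuous_on I_star log_orig"
proof (rule continuous_at_imp_continuous_on, rule ballI)
  fix p assume p: "p \<in> I_star"
  obtain U x where U: "(U, x) \<in> A" "p \<in> U" by (rule chart_at)
  note c = chart_coord_system[OF U(1)]
  have "continuous_on (U \<inter> I_star) (\<lambda>q. (log_orig \<circ> inv_into U x) (x q))"
    by (rule continuous_on_compose2[OF smooth_on_continuous[OF log_smooth[OF U(1)]]
          continuous_on_subset[OF coord_systemD(4)[OF c]]]) auto
  then have "continuous_on (U \<inter> I_star) log_orig"
    by (rule continuous_on_eq) (auto simp: coord_systemD(8)[OF c])
  moreover have "open (U \<inter> I_star)" using coord_systemD(1)[OF c] open_I_star by auto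
  ultimately show "isCont log_orig p" using p U continuous_on_eq_continuous_at by blast
qed

lemma inj_on_log: "inj_on log_orig I_star"
  using I_star_polar(2) by (metis inj_onI)

lemma inv_log: "y \<in> exp_domain \<Longrightarrow> inv_into I_star log_orig y = exp_orig y"
  using inv_into_f_f[OF inj_on_log exp_in_I_star] log_exp by metis

lemma exp_coord_system: "coord_system I_star log_orig"
  unfolding coord_system_def
proof (intro conjI open_I_star inj_on_log log_continuous)
  show "open (log_orig ` I_star)" by (simp add: log_image open_exp_domain)
  show "continuous_on (log_orig ` I_star) (inv_into I_star log_orig)"
    unfolding log_image by (rule continuous_on_eq[OF exp_continuous]) (simp add: inv_log)
  have "smooth_on (log_orig ` (U \<inter> I_star)) (x \<circ> inv_into I_star log_orig)" if U: "(U, x) \<in> A" for U x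
  proof (rule smooth_on_cong)
    show "smooth_on (log_orig ` (U \<inter> I_star)) (x \<circ> exp_orig)"
      by (rule smooth_on_subset[OF exp_smooth[OF U]]) (auto simp: I_star_polar)
  qed (auto simp: inv_log I_star_polar)
  then show "\<forall>(U, x)\<in>A. smooth_on (x ` (U \<inter> I_star)) (log_orig \<circ> inv_into U x) \<and>
        smooth_on (log_orig ` (U \<inter> I_star)) (x \<circ> inv_into I_star log_orig)"
    using log_smooth by auto
qed

text \<open>The push-forward of \<open>\<xi>\<close> under the exponential map.\<close>

definition push :: "(real^4 \<Rightarrow> real^4) \<Rightarrow> 'a vfield" where
  "push \<xi> p = chart_vec (I_star, log_orig) p (\<xi> (log_orig p))"

lemma push_smooth: "smooth_on exp_domain \<xi> \<Longrightarrow> smooth_vfield I_star (push \<xi>)"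
  unfolding push_def[abs_def]
  by (rule smooth_vfield_coord[OF exp_coord_system open_I_star order_refl]) (simp add: log_image)

lemma push_tangent: "p \<in> I_star \<Longrightarrow> push \<xi> p \<in> tangent_space p"
  unfolding push_def by (rule chart_vec_tangent[OF exp_coord_system])

lemma d_exp_push:
  assumes p: "p \<in> I_star"
  shows "d_exp_orig (log_orig p) w = chart_vec (I_star, log_orig) p w"
proof -
  have "frechet_derivative (f \<circ> exp_orig) (at (log_orig p)) = frechet_derivative (f \<circ> inv_into I_star log_orig) (at (log_orig p))"
    for f :: "'a \<Rightarrow> real"
    by (rule frechet_derivative_cong_open[OF open_exp_domain I_star_polar(1)[OF p]]) (simp add: inv_log)
  then show ?thesis by (simp add: d_exp_orig_def chart_vec_def I_star_polar(2)[OF p])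
qed

lemma boost_eq_push: "p \<in> I_star \<Longrightarrow> boost i p = push (flat_boost i) p"
  unfolding boost_def push_def by (rule d_exp_push)

lemma push_bracket:
  assumes \<xi>: "smooth_on exp_domain \<xi>" and \<eta>: "smooth_on exp_domain \<eta>"
    and X: "\<And>q. q \<in> I_star \<Longrightarrow> X q = push \<xi> q" and Y: "\<And>q. q \<in> I_star \<Longrightarrow> Y q = push \<eta> q"
    and p: "p \<in> I_star"
  shows "bracket X Y p = push (\<lambda>y. frechet_derivative \<eta> (at y) (\<xi> y) - frechet_derivative \<xi> (at y) (\<eta> y)) p"
  unfolding push_def
  by (rule bracket_coord[OF exp_coord_system open_I_star order_refl p])
    (use assms in \<open>simp_all add: log_image push_def\<close>)

abbreviation radial :: "'a vfield" where
  "radial \<equiv> push (\<lambda>y. y /\<^sub>R mink_radius y)"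

lemma smooth_on_unit_exp_domain: "smooth_on exp_domain (\<lambda>y. y /\<^sub>R mink_radius y)"
  by (rule smooth_on_subset[OF smooth_on_unit_timelike]) (auto simp: exp_domain_def)

lemma smooth_on_so31: "M \<in> so31 \<Longrightarrow> smooth_on S M"
  unfolding so31_def by (auto intro: smooth_on_linear)

lemma radial_smooth: "smooth_vfield I_star radial"
  by (rule push_smooth[OF smooth_on_unit_exp_domain])

lemma push_so31_smooth: "M \<in> so31 \<Longrightarrow> smooth_vfield I_star (push M)"
  by (rule push_smooth[OF smooth_on_so31])

lemma so31_derivative:
  assumes "M \<in> so31"
  shows "frechet_derivative M (at y) = M"
  by (rule frechet_derivative_at[symmetric], rule bounded_linear_imp_has_derivative)
    (use assms in \<open>simp add: so31_def linear_conv_bounded_linear\<close>)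

text \<open>Both derivatives in the coordinate formula of the bracket equal \<open>M y / mink_radius y\<close>: on one side
because \<open>M\<close> is linear, on the other because \<open>mink_radius\<close> is stationary in the direction \<open>M y\<close>.\<close>

lemma bracket_so31_radial:
  assumes M: "M \<in> so31" and X: "\<And>q. q \<in> I_star \<Longrightarrow> X q = push M q" and Y: "\<And>q. q \<in> I_star \<Longrightarrow> Y q = radial q"
    and p: "p \<in> I_star"
  shows "bracket X Y p = (\<lambda>f. 0)"
proof -
  let ?y = "log_orig p"
  have y: "?y \<in> timelike_cone" using I_star_polar(1)[OF p] by (simp add: exp_domain_def)
  have lin: "linear M" using M by (simp add: so31_def)
  have "frechet_derivative (\<lambda>y. y /\<^sub>R mink_radius y) (at ?y) (M ?y) = M ?y /\<^sub>R mink_radius ?y"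
    using frechet_derivative_at[OF unit_timelike_has_derivative[OF y], symmetric] M mink_inner_sym[of ?y "M ?y"]
    by (simp add: so31_def)
  moreover have "frechet_derivative M (at ?y) (?y /\<^sub>R mink_radius ?y) = M ?y /\<^sub>R mink_radius ?y"
    using so31_derivative[OF M] linear_scale[OF lin] by simp
  ultimately show ?thesis
    using push_bracket[OF smooth_on_so31[OF M] smooth_on_unit_exp_domain X Y p]
    by (simp add: push_def chart_vec_0[OF exp_coord_system p])
qed

lemma bracket_so31:
  assumes M: "M \<in> so31" and X: "\<And>q. q \<in> I_star \<Longrightarrow> X q = push M q"
    and N: "N \<in> so31" and Y: "\<And>q. q \<in> I_star \<Longrightarrow> Y q = push N q" and p: "p \<in> I_star"
  shows "bracket X Y p = push (\<lambda>y. N (M y) - M (N y)) p"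
  using push_bracket[OF smooth_on_so31[OF M] smooth_on_so31[OF N] X Y p]
  by (simp add: so31_derivative[OF M] so31_derivative[OF N])

lemma exp_ray_in_I_star:
  "V \<in> H1 \<Longrightarrow> 0 < t \<Longrightarrow> ereal t < i_star \<Longrightarrow> t *\<^sub>R V \<in> exp_domain \<and> exp_orig (t *\<^sub>R V) \<in> I_star"
  using exp_in_I_star scaled_H1[of V t] by (auto simp: exp_domain_def)

text \<open>Rays are integral curves of the radial field.\<close>

lemma radial_derivative_along_ray:
  assumes V: "V \<in> H1" and t: "0 < t" "ereal t < i_star"
    and N: "open N" "exp_orig (t *\<^sub>R V) \<in> N" and f: "smooth_fun N f"
  shows "((\<lambda>s. f (exp_orig (s *\<^sub>R V))) has_real_derivative radial (exp_orig (t *\<^sub>R V)) f) (at t)"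
proof -
  let ?p = "exp_orig (t *\<^sub>R V)"
  have y: "t *\<^sub>R V \<in> exp_domain" and p: "?p \<in> I_star" using exp_ray_in_I_star[OF V t] by auto
  have sm: "smooth_at ?p f" using N f unfolding smooth_at_def by auto
  have "((f \<circ> inv_into I_star log_orig) has_derivative
      frechet_derivative (f \<circ> inv_into I_star log_orig) (at (t *\<^sub>R V))) (at (t *\<^sub>R V))"
    using smooth_at_has_derivative[OF exp_coord_system p sm] log_exp[OF y] by simp
  then have D: "((f \<circ> exp_orig) has_derivative
      frechet_derivative (f \<circ> inv_into I_star log_orig) (at (t *\<^sub>R V))) (at (t *\<^sub>R V))"
    by (rule has_derivative_transform_within_open[OF _ open_exp_domain y]) (simp add: inv_log)
  have "((\<lambda>s. s *\<^sub>R V) has_derivative (\<lambda>h. h *\<^sub>R V)) (at t)"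
    by (intro has_derivative_scaleR_left has_derivative_ident)
  from diff_chain_at[OF this D]
  have "((\<lambda>s. f (exp_orig (s *\<^sub>R V))) has_derivative
     (\<lambda>h. frechet_derivative (f \<circ> inv_into I_star log_orig) (at (t *\<^sub>R V)) (h *\<^sub>R V))) (at t)"
    by (simp add: o_def)
  moreover have "frechet_derivative (f \<circ> inv_into I_star log_orig) (at (t *\<^sub>R V)) (h *\<^sub>R V) = h *\<^sub>R radial ?p f" for h
    using linear_scale[OF has_derivative_linear[OF D]] sm scaled_H1[OF V t(1)] t
    by (simp add: push_def chart_vec_apply log_exp[OF y])
  ultimately show ?thesis
    by (simp add: has_real_derivative_iff_has_vector_derivative has_vector_derivative_def)
qed

end

section \<open>The Gauss lemma\<close>

context framed_spacetime
begin

lemma ray_equals_exp: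
  assumes "V \<in> H1" "ray_geodesic V J \<gamma>" "s \<in> J" "0 < s"
  shows "exp_orig (s *\<^sub>R V) = \<gamma> s"
  using exp_orig_scaled[OF assms(1,4)] Upsilon_ray[OF assms(2,3)] by simp

lemma ray_chart_domain:
  assumes V: "V \<in> H1" and g: "ray_geodesic V J \<gamma>" and U: "(U, x) \<in> A"
    and t: "t \<in> J" "0 < t" "ereal t < i_star" "\<gamma> t \<in> U"
  obtains K where "open K" "t \<in> K" "K \<subseteq> J \<inter> \<gamma> -` U" "\<And>s. s \<in> K \<Longrightarrow> 0 < s \<and> ereal s < i_star"
proof -
  obtain s0 where s0: "injectivity_parameter s0" "t < s0" using less_i_star[OF t(3)] by auto
  show thesis
  proof (rule that)
    show "open ((J \<inter> \<gamma> -` U) \<inter> {0<..<s0})"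
      by (intro open_Int geodesic_chart_domain(1)[OF ray_geodesicD(1,2)[OF g] U] open_greaterThanLessThan)
    show "0 < s \<and> ereal s < i_star" if "s \<in> (J \<inter> \<gamma> -` U) \<inter> {0<..<s0}" for s
      using that less_le_trans[OF _ injectivity_le_i_star[OF s0(1)], of "ereal s"] by auto
  qed (use t s0 in auto)
qed

lemma radial_component_along_ray:
  assumes V: "V \<in> H1" and g: "ray_geodesic V J \<gamma>" and U: "(U, x) \<in> A"
    and t: "t \<in> J" "0 < t" "ereal t < i_star" "\<gamma> t \<in> U"
  shows "radial (\<gamma> t) (\<lambda>q. x q $ \<alpha>) = snd (phase x \<gamma> t) $ \<alpha>"
    and "deriv (\<lambda>s. x (\<gamma> s) $ \<alpha>) t = radial (\<gamma> t) (\<lambda>q. x q $ \<alpha>)"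
proof -
  note c = chart_coord_system[OF U] and eq = ray_equals_exp[OF V g]
  obtain K where K: "open K" "t \<in> K" "K \<subseteq> J \<inter> \<gamma> -` U" "\<And>s. s \<in> K \<Longrightarrow> 0 < s \<and> ereal s < i_star"
    using ray_chart_domain[OF V g U t] by blast
  have "((\<lambda>s. x (exp_orig (s *\<^sub>R V)) $ \<alpha>) has_real_derivative radial (\<gamma> t) (\<lambda>q. x q $ \<alpha>)) (at t)"
    using radial_derivative_along_ray[OF V t(2,3) coord_systemD(1)[OF c] _ coord_smooth_fun[OF c], of \<alpha>] t eq[OF t(1,2)]
    by simp
  then have "((\<lambda>s. x (\<gamma> s) $ \<alpha>) has_real_derivative radial (\<gamma> t) (\<lambda>q. x q $ \<alpha>)) (at t)"
    by (rule has_field_derivative_transform_within_open[OF _ K(1,2)]) (use K eq in auto)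
  then show 1: "deriv (\<lambda>s. x (\<gamma> s) $ \<alpha>) t = radial (\<gamma> t) (\<lambda>q. x q $ \<alpha>)" by (rule DERIV_imp_deriv)
  have "(x \<circ> \<gamma> has_vector_derivative snd (phase x \<gamma> t)) (at t)"
    unfolding phase_def snd_conv
    by (rule smooth_curve_derivative[OF geodesic_chart_domain[OF ray_geodesicD(1,2)[OF g] U]]) (use t in auto)
  from deriv_component[OF this, of \<alpha>] 1
  show "radial (\<gamma> t) (\<lambda>q. x q $ \<alpha>) = snd (phase x \<gamma> t) $ \<alpha>" by (simp add: o_def)
qed

lemma I_star_ray:
  assumes "p \<in> I_star"
  obtains V t where "V \<in> H1" "0 < t" "ereal t < i_star" "p = exp_orig (t *\<^sub>R V)"
  using assms unfolding I_star_def polar_def by auto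

text \<open>Rays are geodesics as well as integral curves of the radial field, so the geodesic equation along
them is the coordinate expression of \<open>D radial radial = 0\<close>.\<close>

lemma radial_geodesic:
  assumes p: "p \<in> I_star"
  shows "D radial radial p = (\<lambda>h. 0)"
proof -
  obtain V t where V: "V \<in> H1" "0 < t" "ereal t < i_star" "p = exp_orig (t *\<^sub>R V)" using I_star_ray[OF p] .
  obtain J \<gamma> where g: "ray_geodesic V J \<gamma>" "t \<in> J" using ray_exists[OF V(1-3)] by blast
  note eq = ray_equals_exp[OF V(1) g(1)]
  have pt: "\<gamma> t = p" using eq[OF g(2) V(2)] V(4) by simp
  obtain U x where U: "(U, x) \<in> A" "p \<in> U" by (rule chart_at)
  note c = chart_coord_system[OF U(1)]
  let ?W = "U \<inter> I_star"
  have W: "open ?W" "?W \<subseteq> U" "p \<in> ?W" using coord_systemD(1)[OF c] open_I_star U p by auto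
  have sm: "smooth_vfield ?W radial" by (rule smooth_vfield_subset[OF radial_smooth]) auto
  have tU: "\<gamma> t \<in> U" using U pt by simp
  obtain K where K: "open K" "t \<in> K" "K \<subseteq> J \<inter> \<gamma> -` U" "\<And>s. s \<in> K \<Longrightarrow> 0 < s \<and> ereal s < i_star"
    using ray_chart_domain[OF V(1) g(1) U(1) g(2) V(2,3) tU] by blast
  have d1: "deriv (\<lambda>s. x (\<gamma> s) $ \<alpha>) s = radial (\<gamma> s) (\<lambda>q. x q $ \<alpha>)" if "s \<in> K" for s \<alpha>
    by (rule radial_component_along_ray(2)[OF V(1) g(1) U(1)]) (use that K in auto)
  have d2: "deriv (deriv (\<lambda>s. x (\<gamma> s) $ \<alpha>)) t = radial p (\<lambda>q. radial q (\<lambda>q. x q $ \<alpha>))" for \<alpha>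
  proof (rule DERIV_imp_deriv)
    have "((\<lambda>s. radial (exp_orig (s *\<^sub>R V)) (\<lambda>q. x q $ \<alpha>)) has_real_derivative
        radial p (\<lambda>q. radial q (\<lambda>q. x q $ \<alpha>))) (at t)"
      using radial_derivative_along_ray[OF V(1-3) W(1) _ smooth_vfield_component[OF c W(1,2) sm, of \<alpha>]] W(3) V(4) by simp
    then show "(deriv (\<lambda>s. x (\<gamma> s) $ \<alpha>) has_real_derivative radial p (\<lambda>q. radial q (\<lambda>q. x q $ \<alpha>))) (at t)"
      by (rule has_field_derivative_transform_within_open[OF _ K(1,2)]) (use K eq d1 in auto)
  qed
  have "\<forall>\<alpha>. deriv (deriv (\<lambda>s. x (\<gamma> s) $ \<alpha>)) t
          + (\<Sum>\<beta>\<in>UNIV. \<Sum>\<delta>\<in>UNIV. christoffel D (U, x) (\<gamma> t) \<alpha> \<beta> \<delta>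
               * deriv (\<lambda>s. x (\<gamma> s) $ \<beta>) t * deriv (\<lambda>s. x (\<gamma> s) $ \<delta>) t) = 0"
    using bspec[OF bspec[OF conjunct2[OF ray_geodesicD(1)[OF g(1), unfolded geodesic_def]] g(2)] U(1)] tU by simp
  then have "D radial radial p (\<lambda>q. x q $ \<alpha>) = 0" for \<alpha>
    using D_coord_component[OF U(1) W sm sm, of \<alpha>] by (simp add: d1[OF K(2)] d2 pt)
  moreover have "D radial radial p = chart_vec (U, x) p (\<chi> \<alpha>. D radial radial p (\<lambda>q. x q $ \<alpha>))"
    by (rule tangent_eq_chart_vec[OF c U(2) smooth_vfield_tangent[OF D_smooth[OF W(1) sm sm] W(3)]])
  ultimately have "D radial radial p = chart_vec (U, x) p 0" by (simp add: zero_vec_def)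
  then show ?thesis by (simp add: chart_vec_0[OF c U(2)])
qed

lemma constant_along_ray:
  assumes V: "V \<in> H1" and f: "smooth_fun I_star f" and zero: "\<And>p. p \<in> I_star \<Longrightarrow> radial p f = 0"
    and s: "0 < s" "s \<le> t" "ereal t < i_star"
  shows "f (exp_orig (s *\<^sub>R V)) = f (exp_orig (t *\<^sub>R V))"
proof -
  have "((\<lambda>u. f (exp_orig (u *\<^sub>R V))) has_real_derivative 0) (at u within {s..t})" if "u \<in> {s..t}" for u
  proof -
    have "ereal u < i_star" by (rule le_less_trans[OF _ s(3)]) (use that in simp)
    then have u: "0 < u" "ereal u < i_star" using that s by auto
    have "exp_orig (u *\<^sub>R V) \<in> I_star" using exp_ray_in_I_star[OF V u] by simp
    from radial_derivative_along_ray[OF V u open_I_star this f] zero[OF this]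
    show ?thesis by (auto intro: has_field_derivative_at_within)
  qed
  then have "\<exists>k. \<forall>u\<in>{s..t}. f (exp_orig (u *\<^sub>R V)) = k"
    by (intro has_field_derivative_zero_constant) auto
  then show ?thesis using s by auto
qed

text \<open>The coordinate components at \<open>orig\<close> of the initial velocity of the ray in direction \<open>V\<close>.\<close>

definition chart_frame :: "('a \<Rightarrow> real^4) \<Rightarrow> real^4 \<Rightarrow> real^4" where
  "chart_frame x V = (\<chi> i. frame_vec V (\<lambda>q. x q $ i))"

lemma linear_chart_frame: "linear (chart_frame x)"
  unfolding chart_frame_def frame_vec_def
  by (auto intro!: linearI simp: vec_eq_iff algebra_simps sum.distrib sum_distrib_left)

lemma frame_vec_tangent: "frame_vec V \<in> tangent_space orig"
  unfolding frame_vec_def by (rule tangent_space_sum) (rule frame)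

lemma frame_vec_chart:
  assumes "(U, x) \<in> A" "orig \<in> U"
  shows "frame_vec V = chart_vec (U, x) orig (chart_frame x V)"
  unfolding chart_frame_def by (rule tangent_eq_chart_vec[OF chart_coord_system[OF assms(1)] assms(2) frame_vec_tangent])

lemma ray_initial_phase:
  assumes g: "ray_geodesic V J \<gamma>" and U: "(U, x) \<in> A" "orig \<in> U"
  shows "snd (phase x \<gamma> 0) = chart_frame x V"
  using velocity_coord[OF ray_geodesicD(1,2)[OF g] U(1) ray_geodesicD(4)[OF g]] ray_geodesicD(5,6)[OF g] U(2)
  by (simp add: chart_frame_def vec_eq_iff)

lemma metric_frame_vec: "g orig (frame_vec V) (frame_vec V) = mink_inner V V"
proof -
  obtain U x where U: "(U, x) \<in> A" "orig \<in> U" by (rule chart_at)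
  note c = chart_coord_system[OF U(1)]
  define \<beta> where "\<beta> \<mu> = (\<chi> i. e \<mu> (\<lambda>q. x q $ i))" for \<mu>
  have e_eq: "chart_vec (U, x) orig (\<beta> \<mu>) = e \<mu>" for \<mu>
    using tangent_eq_chart_vec[OF c U(2) frame(1)] unfolding \<beta>_def by simp
  have V: "frame_vec V = chart_vec (U, x) orig (\<Sum>\<mu>\<in>UNIV. V $ \<mu> *\<^sub>R \<beta> \<mu>)"
    unfolding chart_vec_sum[OF c U(2)] by (simp add: frame_vec_def e_eq)
  have "g orig (frame_vec V) (e \<nu>) = (\<Sum>\<mu>\<in>UNIV. V $ \<mu> * mink \<mu> \<nu>)" for \<nu>
    unfolding V by (simp add: e_eq frame(2) linear_sum[OF metric_linear[OF c U(2) frame(1)]]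
        linear_scale[OF metric_linear[OF c U(2) frame(1)]])
  moreover have "g orig (frame_vec V) (frame_vec V) = (\<Sum>\<nu>\<in>UNIV. V $ \<nu> * g orig (frame_vec V) (e \<nu>))"
    unfolding V[symmetric]
    by (subst (2) V) (simp add: linear_sum[OF metric_linear_right[OF c U(2) frame_vec_tangent]]
        linear_scale[OF metric_linear_right[OF c U(2) frame_vec_tangent]] e_eq)
  ultimately show ?thesis
    by (simp add: mink_inner_eq_sum[symmetric] sum_4_0 algebra_simps)
qed

lemma ray_near_orig:
  assumes V: "V \<in> H1" and g: "ray_geodesic V J \<gamma>" and U: "(U, x) \<in> A" "orig \<in> U" and t1: "0 < t1" "ereal t1 < i_star"
  shows "\<forall>\<^sub>F t in at_right 0. 0 < t \<and> t \<le> t1 \<and> ereal t < i_star \<and> t \<in> J \<and> \<gamma> t \<in> U \<inter> I_star"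
proof -
  have "\<forall>\<^sub>F t in at 0. t \<in> J \<inter> \<gamma> -` U"
    using geodesic_chart_domain(1)[OF ray_geodesicD(1,2)[OF g] U(1)] ray_geodesicD(4,5)[OF g] U
    by (intro eventually_at_in_open') auto
  then have "\<forall>\<^sub>F t in at_right 0. t \<in> J \<inter> \<gamma> -` U" by (rule filter_leD[OF at_le, rotated]) simp
  moreover have "\<forall>\<^sub>F t in at_right 0. t \<in> {0<..<t1}"
    using t1(1) by (rule eventually_at_right_real)
  ultimately show ?thesis
  proof eventually_elim
    case (elim t)
    then have t: "0 < t" "ereal t < i_star" by (auto intro: less_trans[OF _ t1(2)])
    then show ?case
      using elim exp_ray_in_I_star[OF V t] ray_equals_exp[OF V g _ t(1)] by auto
  qed
qed

lemma ray_velocity_tendsto: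
  assumes g: "ray_geodesic V J \<gamma>" and U: "(U, x) \<in> A" "orig \<in> U"
  shows "((\<lambda>t. snd (phase x \<gamma> t)) \<longlongrightarrow> chart_frame x V) (at_right 0)"
proof -
  have "continuous_on (J \<inter> \<gamma> -` U) (\<lambda>t. snd (phase x \<gamma> t))"
    by (intro continuous_on_snd phase_continuous[OF ray_geodesicD(1,2)[OF g] U(1)])
  moreover have "open (J \<inter> \<gamma> -` U)" "0 \<in> J \<inter> \<gamma> -` U"
    using geodesic_chart_domain(1)[OF ray_geodesicD(1,2)[OF g] U(1)] ray_geodesicD(4,5)[OF g] U by auto
  ultimately have "isCont (\<lambda>t. snd (phase x \<gamma> t)) 0" using continuous_on_eq_continuous_at by blast
  then show ?thesis
    using ray_initial_phase[OF g U] by (auto simp: isCont_def intro: Lim_at_imp_Lim_at_within)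
qed

text \<open>A ray is a smooth curve through \<open>orig\<close> also at parameter \<open>0\<close>, where its velocity is \<open>frame_vec V\<close>.
Hence the product with a field has a limit as soon as the components of the field do.\<close>

lemma metric_radial_limit:
  assumes V: "V \<in> H1" and g: "ray_geodesic V J \<gamma>" and U: "(U, x) \<in> A" "orig \<in> U" and t1: "0 < t1" "ereal t1 < i_star"
    and X: "\<And>p. p \<in> I_star \<Longrightarrow> X p \<in> tangent_space p"
    and b: "((\<lambda>t. \<chi> i. X (\<gamma> t) (\<lambda>q. x q $ i)) \<longlongrightarrow> b) (at_right 0)"
  shows "((\<lambda>t. g (\<gamma> t) (radial (\<gamma> t)) (X (\<gamma> t))) \<longlongrightarrow> g orig (frame_vec V) (chart_vec (U, x) orig b)) (at_right 0)"
proof -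
  note c = chart_coord_system[OF U(1)]
  let ?X = "\<lambda>t. \<chi> i. X (\<gamma> t) (\<lambda>q. x q $ i)" and ?v = "\<lambda>t. snd (phase x \<gamma> t)"
  let ?G = "\<lambda>i j q. g q (chart_vec (U, x) q (axis i 1)) (chart_vec (U, x) q (axis j 1))"
  note v = ray_velocity_tendsto[OF g U]
  have "continuous_on J \<gamma>" using ray_geodesicD(1)[OF g] unfolding geodesic_def smooth_map_def by auto
  then have "isCont \<gamma> 0" using ray_geodesicD(2,4)[OF g] continuous_on_eq_continuous_at by blast
  then have \<gamma>0: "(\<gamma> \<longlongrightarrow> orig) (at_right 0)"
    using ray_geodesicD(5)[OF g] by (auto simp: isCont_def intro: Lim_at_imp_Lim_at_within)
  have G: "((\<lambda>t. ?G i j (\<gamma> t)) \<longlongrightarrow> ?G i j orig) (at_right 0)" for i j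
  proof (rule isCont_tendsto_compose[OF _ \<gamma>0])
    have "continuous_on U (?G i j)"
      by (intro smooth_fun_continuous metric_smooth coord_systemD(1)[OF c] coord_field_smooth[OF c])
    then show "isCont (?G i j) orig" using coord_systemD(1)[OF c] U(2) continuous_on_eq_continuous_at by blast
  qed
  have "((\<lambda>t. \<Sum>i\<in>UNIV. \<Sum>j\<in>UNIV. ?v t $ i * ?X t $ j * ?G i j (\<gamma> t)) \<longlongrightarrow>
      (\<Sum>i\<in>UNIV. \<Sum>j\<in>UNIV. chart_frame x V $ i * b $ j * ?G i j orig)) (at_right 0)"
    by (intro tendsto_sum tendsto_mult G tendsto_vec_nth v b)
  moreover have "\<forall>\<^sub>F t in at_right 0. g (\<gamma> t) (radial (\<gamma> t)) (X (\<gamma> t)) =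
      (\<Sum>i\<in>UNIV. \<Sum>j\<in>UNIV. ?v t $ i * ?X t $ j * ?G i j (\<gamma> t))"
    using ray_near_orig[OF V g U t1]
  proof eventually_elim
    case (elim t)
    then have t: "0 < t" and tU: "t \<in> J" "\<gamma> t \<in> U" "ereal t < i_star" "\<gamma> t \<in> I_star" by auto
    have "radial (\<gamma> t) = chart_vec (U, x) (\<gamma> t) (\<chi> i. radial (\<gamma> t) (\<lambda>q. x q $ i))"
      by (rule tangent_eq_chart_vec[OF c tU(2) push_tangent[OF tU(4)]])
    then have "radial (\<gamma> t) = chart_vec (U, x) (\<gamma> t) (?v t)"
      by (simp add: radial_component_along_ray(1)[OF V g U(1) tU(1) t tU(3,2)])
    moreover have "X (\<gamma> t) = chart_vec (U, x) (\<gamma> t) (?X t)"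
      by (rule tangent_eq_chart_vec[OF c tU(2) X[OF tU(4)]])
    ultimately show ?case
      using metric_components[OF c tU(2), of "?v t" "?X t"] by simp
  qed
  ultimately have "((\<lambda>t. g (\<gamma> t) (radial (\<gamma> t)) (X (\<gamma> t))) \<longlongrightarrow>
      (\<Sum>i\<in>UNIV. \<Sum>j\<in>UNIV. chart_frame x V $ i * b $ j * ?G i j orig)) (at_right 0)"
    by (simp only: tendsto_cong)
  then show ?thesis
    using metric_components[OF c U(2), of "chart_frame x V" b] frame_vec_chart[OF U, of V] by simp
qed

lemma constant_along_ray_eq_limit:
  assumes V: "V \<in> H1" and t1: "0 < t1" "ereal t1 < i_star" and g: "ray_geodesic V J \<gamma>" "t1 \<in> J"
    and f: "smooth_fun I_star f" and zero: "\<And>p. p \<in> I_star \<Longrightarrow> radial p f = 0"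
    and lim: "((\<lambda>t. f (\<gamma> t)) \<longlongrightarrow> l) (at_right 0)"
  shows "f (exp_orig (t1 *\<^sub>R V)) = l"
proof -
  obtain U x where U: "(U, x) \<in> A" "orig \<in> U" by (rule chart_at)
  have "\<forall>\<^sub>F t in at_right 0. f (\<gamma> t) = f (exp_orig (t1 *\<^sub>R V))"
    using ray_near_orig[OF V g(1) U t1]
  proof eventually_elim
    case (elim t)
    then show ?case
      using constant_along_ray[OF V f zero, of t t1] t1(2) ray_equals_exp[OF V g(1), of t] by simp
  qed
  then have "((\<lambda>t. f (\<gamma> t)) \<longlongrightarrow> f (exp_orig (t1 *\<^sub>R V))) (at_right 0)"
    by (simp add: tendsto_cong)
  from tendsto_unique[OF _ this lim] show ?thesis by simp
qed

text \<open>The product is constant along a ray because the ray is a geodesic, and its limit at \<open>orig\<close> is the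
Minkowski square of an element of \<open>H1\<close>.\<close>

lemma radial_unit:
  assumes p: "p \<in> I_star"
  shows "g p (radial p) (radial p) = -1"
proof -
  obtain V t where V: "V \<in> H1" "0 < t" "ereal t < i_star" "p = exp_orig (t *\<^sub>R V)" using I_star_ray[OF p] .
  obtain J \<gamma> where g: "ray_geodesic V J \<gamma>" "t \<in> J" using ray_exists[OF V(1-3)] by blast
  obtain U x where U: "(U, x) \<in> A" "orig \<in> U" by (rule chart_at)
  have comp: "((\<lambda>s. \<chi> i. radial (\<gamma> s) (\<lambda>q. x q $ i)) \<longlongrightarrow> chart_frame x V) (at_right 0)"
  proof -
    have "\<forall>\<^sub>F s in at_right 0. (\<chi> i. radial (\<gamma> s) (\<lambda>q. x q $ i)) = snd (phase x \<gamma> s)"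
      using ray_near_orig[OF V(1) g(1) U V(2,3)]
      by eventually_elim (simp add: radial_component_along_ray(1)[OF V(1) g(1) U(1)])
    with ray_velocity_tendsto[OF g(1) U] show ?thesis by (simp only: tendsto_cong)
  qed
  have f: "smooth_fun I_star (\<lambda>q. g q (radial q) (radial q))"
    by (rule metric_smooth[OF open_I_star radial_smooth radial_smooth])
  have "radial q (\<lambda>q. g q (radial q) (radial q)) = 0" if q: "q \<in> I_star" for q
    using D_metric[OF open_I_star radial_smooth radial_smooth q radial_smooth]
      metric_zero[OF push_tangent[OF q]] radial_geodesic[OF q] by simp
  from constant_along_ray_eq_limit[OF V(1-3) g f this
      metric_radial_limit[OF V(1) g(1) U V(2,3) push_tangent comp]]
  have "g p (radial p) (radial p) = g orig (frame_vec V) (frame_vec V)"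
    by (simp add: V(4) frame_vec_chart[OF U, symmetric])
  then show ?thesis using V(1) by (simp add: metric_frame_vec H1_eq)
qed

lemma push_components:
  assumes U: "(U, x) \<in> A" and p: "p \<in> I_star" "p \<in> U"
  shows "(\<chi> i. push \<xi> p (\<lambda>q. x q $ i)) = frechet_derivative (x \<circ> exp_orig) (at (log_orig p)) (\<xi> (log_orig p))"
proof -
  note c = chart_coord_system[OF U]
  have "open (exp_domain \<inter> exp_orig -` U)"
    by (intro continuous_open_preimage exp_continuous open_exp_domain coord_systemD(1)[OF c])
  then have "frechet_derivative (x \<circ> inv_into I_star log_orig) (at (log_orig p)) = frechet_derivative (x \<circ> exp_orig) (at (log_orig p))"
    by (rule frechet_derivative_cong_open) (use p in \<open>auto simp: inv_log I_star_polar\<close>)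
  then show ?thesis
    unfolding push_def chart_vec_change[OF exp_coord_system c p] by (simp add: chart_vec_coord[OF c p(2)])
qed

text \<open>At the point with parameter \<open>t\<close> the field is the variation of the ray as its direction \<open>V\<close> moves in
\<open>H1\<close> with velocity \<open>M V\<close>; the Lipschitz dependence on the direction bounds this variation by a
multiple of \<open>t\<close>.\<close>

lemma push_so31_near_orig:
  assumes V: "V \<in> H1" and g: "ray_geodesic V J \<gamma>" and U: "(U, x) \<in> A" "orig \<in> U" and t1: "0 < t1" "ereal t1 < i_star"
    and M: "M \<in> so31"
  obtains C where "\<forall>\<^sub>F t in at_right 0. norm (\<chi> i. push M (\<gamma> t) (\<lambda>q. x q $ i)) \<le> C * t"
proof -
  have lin: "linear M" using M by (simp add: so31_def)
  obtain \<delta> \<epsilon> C where C: "\<delta> > 0" "\<epsilon> > 0" "C \<ge> 0"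
    "\<And>\<gamma>1 J1 \<gamma>2 J2 t. geodesic_from orig J1 \<gamma>1 \<Longrightarrow> norm (snd (phase x \<gamma>1 0) - chart_frame x V) < \<epsilon> \<Longrightarrow>
       geodesic_from orig J2 \<gamma>2 \<Longrightarrow> norm (snd (phase x \<gamma>2 0) - chart_frame x V) < \<epsilon> \<Longrightarrow>
       t \<in> J1 \<Longrightarrow> t \<in> J2 \<Longrightarrow> 0 \<le> t \<Longrightarrow> t \<le> \<delta> \<Longrightarrow>
       \<gamma>1 t \<in> U \<and> \<gamma>2 t \<in> U \<and>
       norm (x (\<gamma>1 t) - x (\<gamma>2 t)) \<le> C * t * norm (snd (phase x \<gamma>1 0) - snd (phase x \<gamma>2 0))"
    using geodesic_lipschitz_in_velocity[OF U, of "chart_frame x V"] by metis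
  \<comment> \<open>a curve in \<open>H1\<close> through \<open>V\<close> with initial velocity \<open>M V\<close>\<close>
  define N where "N s = (V + s *\<^sub>R M V) /\<^sub>R mink_radius (V + s *\<^sub>R M V)" for s :: real
  have Vc: "V \<in> timelike_cone" "mink_radius V = 1" using scaled_H1[OF V, of 1] by auto
  have N0: "N 0 = V" by (simp add: N_def Vc)
  have Nd: "(N has_vector_derivative M V) (at 0)"
  proof -
    have 1: "((\<lambda>s. V + s *\<^sub>R M V) has_derivative (\<lambda>h. h *\<^sub>R M V)) (at (0::real))"
      by (auto intro!: derivative_eq_intros)
    have 2: "((\<lambda>y. y /\<^sub>R mink_radius y) has_derivative
      (\<lambda>v. v /\<^sub>R mink_radius V + (mink_inner V v / mink_radius V ^ 3) *\<^sub>R V)) (at (V + 0 *\<^sub>R M V))"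
      using unit_timelike_has_derivative[OF Vc(1)] by simp
    have "mink_inner V (M V) = 0" using M mink_inner_sym[of V "M V"] by (simp add: so31_def)
    then show ?thesis
      using has_derivative_compose[OF 1 2] unfolding has_vector_derivative_def
      by (simp add: N_def[abs_def] Vc mink_inner_linear)
  qed
  then have Ncont: "isCont N 0" using has_vector_derivative_continuous by blast
  have evH: "\<forall>\<^sub>F s in at 0. N s \<in> H1"
  proof -
    have "isCont (\<lambda>s. V + s *\<^sub>R M V) 0" by (intro continuous_intros)
    then have "((\<lambda>s. V + s *\<^sub>R M V) \<longlongrightarrow> V) (at 0)" by (simp add: isCont_def)
    from topological_tendstoD[OF this open_timelike_cone Vc(1)]
    show ?thesis by eventually_elim (simp add: N_def unit_timelike_H1)
  qed
  have bl: "bounded_linear (chart_frame x)" using linear_chart_frame by (simp add: linear_conv_bounded_linear)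
  obtain B where B: "B > 0" "\<And>u. norm (chart_frame x u) \<le> norm u * B"
    using bounded_linear.pos_bounded[OF bl] by auto
  have evE: "\<forall>\<^sub>F s in at 0. norm (chart_frame x (N s) - chart_frame x V) < \<epsilon>"
  proof -
    have "(N \<longlongrightarrow> V) (at 0)" using Ncont N0 by (simp add: isCont_def)
    from tendstoD[OF bounded_linear.tendsto[OF bl this] C(2)]
    show ?thesis by (simp add: dist_norm)
  qed
  have "\<forall>\<^sub>F t in at_right 0. t \<in> {0<..<\<delta>}" using C(1) by (rule eventually_at_right_real)
  with ray_near_orig[OF V g U t1]
  have "\<forall>\<^sub>F t in at_right 0. norm (\<chi> i. push M (\<gamma> t) (\<lambda>q. x q $ i)) \<le> (C * B * norm (M V)) * t"
  proof eventually_elim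
    case (elim t)
    then have t: "0 < t" and tt: "t \<in> J" "\<gamma> t \<in> U" "ereal t < i_star" "\<gamma> t \<in> I_star" "t \<le> \<delta>" by auto
    have eq: "exp_orig (t *\<^sub>R V) = \<gamma> t" by (rule ray_equals_exp[OF V g tt(1) t])
    have y: "t *\<^sub>R V \<in> exp_domain \<inter> exp_orig -` U"
      using exp_ray_in_I_star[OF V t tt(3)] tt eq by simp
    have lg: "log_orig (\<gamma> t) = t *\<^sub>R V" using y log_exp[of "t *\<^sub>R V"] eq by simp
    let ?K = "\<lambda>s. (x \<circ> exp_orig) (t *\<^sub>R N s)"
    let ?D = "frechet_derivative (x \<circ> exp_orig) (at (t *\<^sub>R V))"
    have oD: "open (exp_domain \<inter> exp_orig -` U)"
      by (intro continuous_open_preimage exp_continuous open_exp_domain coord_systemD(1)[OF chart_coord_system[OF U(1)]])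
    have "((\<lambda>s. t *\<^sub>R N s) has_derivative (\<lambda>h. t *\<^sub>R (h *\<^sub>R M V))) (at 0)"
      using Nd unfolding has_vector_derivative_def by (rule has_derivative_scaleR_right)
    moreover have "((x \<circ> exp_orig) has_derivative ?D) (at (t *\<^sub>R N 0))"
      using smooth_on_has_derivative[OF oD exp_smooth[OF U(1)] y] by (simp add: N0)
    ultimately have "(?K has_derivative (\<lambda>h. ?D (t *\<^sub>R (h *\<^sub>R M V)))) (at 0)"
      by (rule has_derivative_compose)
    moreover have "linear ?D"
      by (rule has_derivative_linear[OF smooth_on_has_derivative[OF oD exp_smooth[OF U(1)] y]])
    ultimately have Kd: "(?K has_vector_derivative t *\<^sub>R ?D (M V)) (at 0)"
      unfolding has_vector_derivative_def by (simp add: linear_scale mult.commute[of t])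
    have "\<forall>\<^sub>F s in at 0. norm (?K s - ?K 0) \<le> (C * t * B) * norm (N s - N 0)"
      using evH evE
    proof eventually_elim
      case (elim s)
      obtain J' \<gamma>' where g': "ray_geodesic (N s) J' \<gamma>'" "t \<in> J'" using ray_exists[OF elim(1) t tt(3)] by blast
      have "norm (x (\<gamma>' t) - x (\<gamma> t)) \<le> C * t * norm (snd (phase x \<gamma>' 0) - snd (phase x \<gamma> 0))"
        using C(4)[OF ray_geodesicD(7)[OF g'(1)] _ ray_geodesicD(7)[OF g] _ g'(2) tt(1) _ tt(5)] elim(2) C(2) t
        by (simp add: ray_initial_phase[OF g'(1) U] ray_initial_phase[OF g U])
      also have "\<dots> = C * t * norm (chart_frame x (N s - V))"
        by (simp add: ray_initial_phase[OF g'(1) U] ray_initial_phase[OF g U] linear_diff[OF linear_chart_frame])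
      also have "\<dots> \<le> C * t * (norm (N s - V) * B)"
        using C(3) t B(2) by (intro mult_left_mono) auto
      finally show ?case
        by (simp add: N0 eq ray_equals_exp[OF elim(1) g' t] mult_ac)
    qed
    from vector_derivative_norm_le[OF Kd Nd this]
    have "norm (?D (t *\<^sub>R M V)) \<le> C * t * B * norm (M V)"
      using linear_scale[OF \<open>linear ?D\<close>] by simp
    moreover have "(\<chi> i. push M (\<gamma> t) (\<lambda>q. x q $ i)) = ?D (t *\<^sub>R M V)"
      using push_components[OF U(1) tt(4,2), of M] by (simp add: lg linear_scale[OF lin])
    ultimately show ?case by (simp add: mult_ac)
  qed
  then show thesis by (rule that)
qed

text \<open>The derivative of the product along the radial field is
\<open>g radial (D radial (push M)) = g radial (D (push M) radial)\<close>, half the derivative of the constant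
\<open>g radial radial\<close> along \<open>push M\<close>. So the product is constant along a ray, and it tends to \<open>0\<close> at
\<open>orig\<close>.\<close>

lemma gauss_lemma:
  assumes M: "M \<in> so31" and p: "p \<in> I_star"
  shows "g p (radial p) (push M p) = 0"
proof -
  obtain V t where V: "V \<in> H1" "0 < t" "ereal t < i_star" "p = exp_orig (t *\<^sub>R V)" using I_star_ray[OF p] .
  obtain J \<gamma> where g: "ray_geodesic V J \<gamma>" "t \<in> J" using ray_exists[OF V(1-3)] by blast
  obtain U x where U: "(U, x) \<in> A" "orig \<in> U" by (rule chart_at)
  note c = chart_coord_system[OF U(1)] and sM = push_so31_smooth[OF M]
  obtain C where C: "\<forall>\<^sub>F s in at_right 0. norm (\<chi> i. push M (\<gamma> s) (\<lambda>q. x q $ i)) \<le> C * s"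
    using push_so31_near_orig[OF V(1) g(1) U V(2,3) M] by blast
  have comp: "((\<lambda>s. \<chi> i. push M (\<gamma> s) (\<lambda>q. x q $ i)) \<longlongrightarrow> 0) (at_right 0)"
  proof (rule Lim_null_comparison[OF C])
    show "((\<lambda>s. C * s) \<longlongrightarrow> 0) (at_right 0)" by (rule tendsto_eq_intros tendsto_ident_at | simp)+
  qed
  have f: "smooth_fun I_star (\<lambda>q. g q (radial q) (push M q))"
    by (rule metric_smooth[OF open_I_star radial_smooth sM])
  have "radial q (\<lambda>q. g q (radial q) (push M q)) = 0" if q: "q \<in> I_star" for q
  proof -
    note T = smooth_vfield_tangent[OF D_smooth[OF open_I_star _ _] q] and P = push_tangent[OF q]
    have "(\<lambda>h. D (push M) radial q h - D radial (push M) q h) = (\<lambda>h. 0)"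
      using D_torsion_free[OF open_I_star sM radial_smooth q] bracket_so31_radial[OF M refl refl q] by simp
    then have comm: "D radial (push M) q = D (push M) radial q" by (simp add: fun_eq_iff)
    have "push M q (\<lambda>q. g q (radial q) (radial q)) = 0"
      using tangent_locally_const[OF P open_I_star q, of "\<lambda>q. g q (radial q) (radial q)" "-1"] radial_unit by simp
    moreover have "push M q (\<lambda>q. g q (radial q) (radial q)) = 2 * g q (radial q) (D (push M) radial q)"
      using D_metric[OF open_I_star sM radial_smooth q radial_smooth] metric_sym[OF T[OF sM radial_smooth] P] by simp
    moreover have "radial q (\<lambda>q. g q (radial q) (push M q)) = g q (radial q) (D radial (push M) q)"
      using D_metric[OF open_I_star radial_smooth radial_smooth q sM] radial_geodesic[OF q] metric_zero[OF P] by simp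
    ultimately show ?thesis using comm by simp
  qed
  from constant_along_ray_eq_limit[OF V(1-3) g f this metric_radial_limit[OF V(1) g(1) U V(2,3) push_tangent comp]]
  show ?thesis using metric_zero(2)[OF frame_vec_tangent] by (simp add: V(4) chart_vec_0[OF c U(2)])
qed

text \<open>Every tangent vector is a multiple of the radial one plus a value of an \<open>so31\<close> field, and \<open>rho\<close> is
stationary along \<open>so31\<close> fields. By the Gauss lemma the radial vector therefore represents \<open>- d rho\<close>,
and it is the only vector that does because the metric is nondegenerate.\<close>

lemma normal_eq_radial:
  assumes p: "p \<in> I_star"
  shows "normal p = radial p"
proof -
  let ?y = "log_orig p"
  have y: "?y \<in> timelike_cone" using I_star_polar(1)[OF p] by (simp add: exp_domain_def)
  have r: "mink_radius ?y > 0" by (rule mink_radius_pos[OF y])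
  let ?v = "\<lambda>f. -1 * radial p f"
  have vT: "?v \<in> tangent_space p" by (rule tangent_space_scale[OF push_tangent[OF p]])
  have v: "g p ?v w = w rho" if w: "w \<in> tangent_space p" for w
  proof -
    obtain \<omega> where \<omega>: "w = chart_vec (I_star, log_orig) p \<omega>"
      using w tangent_space_eq_range[OF exp_coord_system p] by auto
    obtain a M where M: "M \<in> so31" "\<omega> = a *\<^sub>R ?y + M ?y" using radial_plus_so31[OF y] .
    have lin: "linear M" using M by (simp add: so31_def)
    have l: "linear (\<lambda>\<xi>. g p (radial p) (chart_vec (I_star, log_orig) p \<xi>))"
      by (rule metric_linear_right[OF exp_coord_system p push_tangent[OF p]])
    have ar: "a * mink_radius ?y * inverse (mink_radius ?y) = a" using r by simp
    have "g p (radial p) w = a * mink_radius ?y * g p (radial p) (radial p) + g p (radial p) (push M p)"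
      using linear_add[OF l, of "a *\<^sub>R ?y" "M ?y"] linear_scale[OF l, of "a * mink_radius ?y" "?y /\<^sub>R mink_radius ?y"]
      by (simp add: \<omega> M(2) push_def ar)
    then have 1: "g p (radial p) w = - a * mink_radius ?y" using radial_unit[OF p] gauss_lemma[OF M(1) p] by simp
    have "smooth_on exp_domain mink_radius"
      by (rule smooth_on_subset[OF smooth_on_mink_radius]) (auto simp: exp_domain_def)
    then have "w rho = frechet_derivative mink_radius (at ?y) \<omega>"
      unfolding \<omega> by (intro chart_vec_fun[OF exp_coord_system open_I_star order_refl p]) (simp_all add: log_image I_star_polar(3))
    also have "\<dots> = - mink_inner ?y \<omega> / mink_radius ?y"
      using frechet_derivative_at[OF mink_radius_has_derivative[OF y], symmetric] by simp
    also have "\<dots> = a * mink_radius ?y"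
      using M r mink_radius_sq[OF y] mink_inner_sym[of ?y "M ?y"] by (simp add: mink_inner_linear so31_def)
    finally have 2: "w rho = a * mink_radius ?y" .
    have "g p ?v w = - g p (radial p) w"
      using metric_lincomb[OF push_tangent[OF p] push_tangent[OF p] w, of "-1" _ 0] by simp
    with 1 2 show ?thesis by simp
  qed
  have "gradient g rho p = ?v"
    unfolding gradient_def
  proof (rule the_equality)
    show "?v \<in> tangent_space p \<and> (\<forall>w\<in>tangent_space p. g p ?v w = w rho)" using vT v by blast
    fix u assume u: "u \<in> tangent_space p \<and> (\<forall>w\<in>tangent_space p. g p u w = w rho)"
    have "(\<lambda>f. 1 * u f + (-1) * ?v f) = (\<lambda>f. 0)"
    proof (rule metric_nondegenerate[of _ p])
      show "(\<lambda>f. 1 * u f + (-1) * ?v f) \<in> tangent_space p"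
        by (rule tangent_space_add[OF tangent_space_scale[OF conjunct1[OF u]] tangent_space_scale[OF vT]])
      show "g p (\<lambda>f. 1 * u f + (-1) * ?v f) w = 0" if "w \<in> tangent_space p" for w
        unfolding metric_lincomb[OF conjunct1[OF u] vT that] using u v that by simp
    qed
    then show "u = ?v" by (simp add: fun_eq_iff eq_neg_iff_add_eq_0)
  qed
  then show ?thesis unfolding normal_def by simp
qed


section \<open>Lie derivatives of the deformation tensor\<close>

text \<open>Outside \<open>I_star\<close> the values of the boosts and of the normal are unspecified, while brackets are
fields on the whole manifold. The classes of fields in the induction therefore constrain the
values on \<open>I_star\<close> only.\<close>

definition radial_on :: "'a vfield \<Rightarrow> bool" where
  "radial_on X \<longleftrightarrow> (\<forall>p\<in>I_star. X p = radial p)"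

definition so31_on :: "'a vfield \<Rightarrow> bool" where
  "so31_on X \<longleftrightarrow> (\<exists>M\<in>so31. \<forall>p\<in>I_star. X p = push M p)"

definition zero_on :: "'a vfield \<Rightarrow> bool" where
  "zero_on X \<longleftrightarrow> (\<forall>p\<in>I_star. X p = (\<lambda>f. 0))"

text \<open>The property of tensors that is passed on by Lie derivatives along boosts. The first argument may
also be zero: Lie derivatives insert the vanishing bracket of a boost with a radial field, and a
tensor, being represented by an arbitrary functional, need not vanish there by itself.\<close>

definition radially_trivial :: "'a tensor2 \<Rightarrow> bool" where
  "radially_trivial \<pi> \<longleftrightarrow>
     (\<forall>X Y. (radial_on X \<or> zero_on X) \<and> (radial_on Y \<or> so31_on Y) \<longrightarrow> (\<forall>p\<in>I_star. \<pi> X Y p = 0))"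

lemma boost_so31_on: "i \<in> spatial \<Longrightarrow> so31_on (boost i)"
  unfolding so31_on_def using flat_boost_so31 boost_eq_push by blast

lemma normal_radial_on: "radial_on normal"
  unfolding radial_on_def using normal_eq_radial by blast

lemma zero_so31_on: "zero_on X \<Longrightarrow> so31_on X"
  unfolding so31_on_def
proof (rule bexI)
  assume X: "zero_on X"
  show "(\<lambda>y. 0) \<in> so31" by (simp add: so31_def linear_zero mink_inner_expand)
  show "\<forall>p\<in>I_star. X p = push (\<lambda>y. 0) p" using X unfolding zero_on_def by (simp add: push_def chart_vec_0[OF exp_coord_system])
qed

lemma radial_on_smooth: "radial_on X \<Longrightarrow> smooth_vfield I_star X"
  unfolding radial_on_def by (rule smooth_vfield_cong[OF radial_smooth]) simp

lemma so31_on_smooth: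
  assumes "so31_on X"
  shows "smooth_vfield I_star X"
proof -
  obtain M where "M \<in> so31" "\<forall>p\<in>I_star. X p = push M p" using assms unfolding so31_on_def by blast
  then show ?thesis by (intro smooth_vfield_cong[OF push_so31_smooth]) auto
qed

lemma bracket_so31_on_radial_on:
  assumes "so31_on R" "radial_on X"
  shows "zero_on (bracket R X)"
proof -
  obtain M where M: "M \<in> so31" "\<And>p. p \<in> I_star \<Longrightarrow> R p = push M p" using assms(1) unfolding so31_on_def by blast
  show ?thesis
    unfolding zero_on_def using bracket_so31_radial[OF M] assms(2) unfolding radial_on_def by blast
qed

lemma bracket_so31_on:
  assumes "so31_on R" "so31_on X"
  shows "so31_on (bracket R X)"
proof -
  obtain M where M: "M \<in> so31" "\<And>p. p \<in> I_star \<Longrightarrow> R p = push M p" using assms(1) unfolding so31_on_def by blast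
  obtain N where N: "N \<in> so31" "\<And>p. p \<in> I_star \<Longrightarrow> X p = push N p" using assms(2) unfolding so31_on_def by blast
  show ?thesis
    unfolding so31_on_def using bracket_so31[OF M N] so31_commutator[OF M(1) N(1)] by blast
qed

lemma bracket_zero_on:
  assumes "so31_on R" "zero_on Z"
  shows "zero_on (bracket R Z)"
  unfolding zero_on_def
proof
  fix p assume p: "p \<in> I_star"
  have "R p \<in> tangent_space p" by (rule smooth_vfield_tangent[OF so31_on_smooth[OF assms(1)] p])
  then have "R p (\<lambda>q. Z q f) = 0" for f
    by (rule tangent_locally_const[OF _ open_I_star p]) (use assms(2) in \<open>simp add: zero_on_def\<close>)
  then show "bracket R Z p = (\<lambda>f. 0)"
    using assms(2) p by (simp add: bracket_def germ_def zero_on_def)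
qed

lemma radially_trivial_lie:
  assumes R: "so31_on R" and \<pi>: "radially_trivial \<pi>"
  shows "radially_trivial (lie_derivative R \<pi>)"
  unfolding radially_trivial_def
proof (intro allI impI ballI, elim conjE)
  fix X Y p
  assume X: "radial_on X \<or> zero_on X" and Y: "radial_on Y \<or> so31_on Y" and p: "p \<in> I_star"
  have "R p \<in> tangent_space p" by (rule smooth_vfield_tangent[OF so31_on_smooth[OF R] p])
  then have "R p (\<lambda>q. \<pi> X Y q) = 0"
    by (rule tangent_locally_const[OF _ open_I_star p]) (use X Y \<pi> in \<open>simp add: radially_trivial_def\<close>)
  moreover have "zero_on (bracket R X)"
    using X bracket_so31_on_radial_on[OF R] bracket_zero_on[OF R] by blast
  then have "\<pi> (bracket R X) Y p = 0" using \<pi> Y p unfolding radially_trivial_def by blast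
  moreover have "so31_on (bracket R Y)"
    using Y zero_so31_on[OF bracket_so31_on_radial_on[OF R]] bracket_so31_on[OF R] by blast
  then have "\<pi> X (bracket R Y) p = 0" using \<pi> X p unfolding radially_trivial_def by blast
  ultimately show "lie_derivative R \<pi> X Y p = 0" by (simp add: lie_derivative_def)
qed

lemma metric_radial_on:
  assumes X: "radial_on X" and p: "p \<in> I_star"
  shows "radial_on Y \<Longrightarrow> g p (X p) (Y p) = -1" and "so31_on Y \<Longrightarrow> g p (X p) (Y p) = 0"
  using X p radial_unit[OF p] gauss_lemma[OF _ p] unfolding radial_on_def so31_on_def by auto

text \<open>For a radial field \<open>X\<close> the fields \<open>X\<close> and \<open>R\<close> commute, hence \<open>D X R = D R X\<close>. Since \<open>g X Y\<close> is
constant, \<open>g (D R X) Y = - g X (D R Y)\<close>; the two terms of the deformation tensor add up to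
\<open>- g X [R, Y]\<close>, which is zero because \<open>[R, Y]\<close> is zero or an \<open>so31\<close> field.\<close>

lemma radially_trivial_deformation:
  assumes R: "so31_on R"
  shows "radially_trivial (deformation g D R)"
  unfolding radially_trivial_def
proof (intro allI impI ballI, elim conjE)
  fix X Y p
  assume X: "radial_on X \<or> zero_on X" and Y: "radial_on Y \<or> so31_on Y" and p: "p \<in> I_star"
  note o = open_I_star
  have sR: "smooth_vfield I_star R" by (rule so31_on_smooth[OF R])
  have sY: "smooth_vfield I_star Y" using Y radial_on_smooth so31_on_smooth by blast
  have T: "D W Z p \<in> tangent_space p" if "smooth_vfield I_star W" "smooth_vfield I_star Z" for W Z
    by (rule smooth_vfield_tangent[OF D_smooth[OF o that] p])
  show "deformation g D R X Y p = 0"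
    using X
  proof
    assume X: "zero_on X"
    then have "D X R p = (\<lambda>f. 0)" "X p = (\<lambda>f. 0)"
      using D_zero_left(2)[OF o sR p, of X] p by (auto simp: zero_on_def)
    then show ?thesis
      using metric_zero(1)[OF smooth_vfield_tangent[OF sY p]] metric_zero(2)[OF T[OF sY sR]]
      by (simp add: deformation_def)
  next
    assume X: "radial_on X"
    have sX: "smooth_vfield I_star X" by (rule radial_on_smooth[OF X])
    have XT: "X p \<in> tangent_space p" by (rule smooth_vfield_tangent[OF sX p])
    have RT: "R p \<in> tangent_space p" by (rule smooth_vfield_tangent[OF sR p])
    have swap: "D Z R p = (\<lambda>f. D R Z p f - bracket R Z p f)" if sZ: "smooth_vfield I_star Z" for Z
      using fun_cong[OF D_torsion_free[OF o sR sZ p]] by (intro ext) (smt (verit))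
    have DXR: "D X R p = D R X p"
      using swap[OF sX] bracket_so31_on_radial_on[OF R X] p by (simp add: zero_on_def)
    have const: "R p (\<lambda>q. g q (X q) (Y q)) = 0"
      using Y
    proof
      assume "radial_on Y"
      then show ?thesis using metric_radial_on(1)[OF X] by (intro tangent_locally_const[OF RT o p])
    next
      assume "so31_on Y"
      then show ?thesis using metric_radial_on(2)[OF X] by (intro tangent_locally_const[OF RT o p])
    qed
    have "g p (D R X p) (Y p) + g p (X p) (D R Y p) = 0"
      using D_metric[OF o sR sX p sY] const by simp
    moreover have "g p (D Y R p) (X p) = g p (X p) (D R Y p)"
    proof -
      have "so31_on (bracket R Y)"
        using Y zero_so31_on[OF bracket_so31_on_radial_on[OF R]] bracket_so31_on[OF R] by blast
      then have "g p (X p) (bracket R Y p) = 0" "bracket R Y p \<in> tangent_space p"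
        using metric_radial_on(2)[OF X p] smooth_vfield_tangent[OF so31_on_smooth p] by auto
      then have "g p (\<lambda>f. 1 * D R Y p f + (-1) * bracket R Y p f) (X p) = g p (D R Y p) (X p)"
        using metric_lincomb[OF T[OF sR sY] _ XT, of "bracket R Y p" 1 "-1"] metric_sym[OF _ XT] by simp
      then show ?thesis using swap[OF sY] metric_sym[OF T[OF sR sY] XT] by simp
    qed
    ultimately show ?thesis by (simp add: deformation_def DXR)
  qed
qed

lemma radially_trivial_lie_boosts:
  assumes "k \<in> spatial" "set js \<subseteq> spatial"
  shows "radially_trivial (lie_boosts js (boost_deformation k))"
  using assms(2)
proof (induction js)
  case Nil
  show ?case
    using radially_trivial_deformation[OF boost_so31_on[OF assms(1)]]
    by (simp add: lie_boosts_def boost_deformation_def)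
next
  case (Cons j js)
  then show ?case
    using radially_trivial_lie[OF boost_so31_on[of j]] by (simp add: lie_boosts_def)
qed

end

theorem proposition2p3:
  fixes A :: "'a::{t2_space, second_countable_topology} chart set"
    and g :: "'a metric" and T :: "'a vfield" and D :: "'a connection"
    and orig :: 'a and e :: "4 \<Rightarrow> 'a tvec"
  assumes "framed_spacetime A g T D orig e"
  shows "\<forall>k\<in>spatial. \<forall>m::nat. \<forall>js::4 list. length js = m \<and> set js \<subseteq> spatial \<longrightarrow>
    (\<forall>i\<in>spatial. \<forall>p \<in> framed_spacetime.I_star A g T D orig e.
       framed_spacetime.lie_boosts A g T D orig e js
         (framed_spacetime.boost_deformation A g T D orig e k)
         (framed_spacetime.normal A g T D orig e)
         (framed_spacetime.normal A g T D orig e) p = 0 \<and>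
       framed_spacetime.lie_boosts A g T D orig e js
         (framed_spacetime.boost_deformation A g T D orig e k)
         (framed_spacetime.normal A g T D orig e)
         (framed_spacetime.boost A g T D orig e i) p = 0)"
proof -
  interpret framed_spacetime A g T D orig e by (rule assms)
  show ?thesis
    using radially_trivial_lie_boosts normal_radial_on boost_so31_on unfolding radially_trivial_def by blast
qed

end
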